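(* Let $(A,\cdot_A,a_A)$ be a left-symmetric algebroid. (1) Let $(\mathfrak B,N)$ be a pseudo-Hessian-Nijenhuis structure on $A$ with $\mathfrak B$ nondegenerate. Then $(H,N)$, where $H^\sharp=(\mathfrak B^\natural)^{-1}$, is a Koszul-Vinberg-Nijenhuis structure on $A$. (2) Conversely, if $(H,N)$ is a Koszul-Vinberg-Nijenhuis structure on $A$ and $H$ is nondegenerate, then $(\mathfrak B,N)$, where $\mathfrak B^\natural=(H^\sharp)^{-1}$, is a pseudo-Hessian-Nijenhuis structure on $A$.
   Context: Left-symmetric algebroids. A left-symmetric algebroid $(A,\cdot_A,a_A)$ is a smooth real vector bundle $A\to M$ with an $\mathbb R$-bilinear operation $\cdot_A$ on $\Gamma(A)$ such that $x\cdot_A(y\cdot_A z)-(x\cdot_A y)\cdot_A z$ is symmetric in $x,y$, and a bundle map $a_A:A\to TM$ such that $x\cdot_A(fy)=f(x\cdot_A y)+a_A(x)(f)\,y$ and $(fx)\cdot_A y=f(x\cdot_A y)$ for $x,y\in\Gamma(A)$, $f\in C^\infty(M)$. Put $[x,y]_A=x\cdot_A y-y\cdot_A x$; $(A,[-,-]_A,a_A)$ is a Lie algebroid. Nijenhuis operators. A bundle map $N:A\to A$ (over the identity) is a Nijenhuis operator on $A$ if $N(x)\cdot_A N(y)=N\big(x\cdot_A N(y)+N(x)\cdot_A y-N(x\cdot_A y)\big)$ for all $x,y\in\Gamma(A)$. Then $x\cdot_N y=N(x)\cdot_A y+x\cdot_A N(y)-N(x\cdot_A y)$ and $a_N=a_A\circ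 N$ make $(A,\cdot_N,a_N)$ a left-symmetric algebroid; $[x,y]_N=x\cdot_N y-y\cdot_N x$. $N^*:A^*\to A^*$ is the dual map. Koszul-Vinberg structures. $\mathrm{Sym}^2(A)$ is the set of symmetric sections $H$ of $A\otimes A$; $H^\sharp:A^*\to A$ is $\langle H^\sharp(\alpha),\beta\rangle=H(\alpha,\beta)$; $H$ is nondegenerate if $H^\sharp$ is invertible. For $\alpha_i\in\Gamma(A^* )$, $$\begin{aligned}[\![ H,H]\!]_A(\alpha_1,\alpha_2,\alpha_3)=\ &a_A(H^\sharp(\alpha_1))\langle H^\sharp(\alpha_2),\alpha_3\rangle-a_A(H^\sharp(\alpha_2))\langle H^\sharp(\alpha_1),\alpha_3\rangle+\langle\alpha_1,H^\sharp(\alpha_2)\cdot_A H^\sharp(\alpha_3)\rangle\\&-\langle\alpha_2,H^\sharp(\alpha_1)\cdot_A H^\sharp(\alpha_3)\rangle-\langle\alpha_3,[H^\sharp(\alpha_1),H^\sharp(\alpha_2)]_A\rangle.\end{aligned}$$ $H$ is a Koszul-Vinberg structure if $[\![ H,H]\!]_A=0$. Products on $\Gamma(A^* )$. $\langle\mathcal L_x\alpha,y\rangle=a_A(x)\langle\alpha,y\rangle-\langle\alpha,[x,y]_A\rangle$, $\langle R_x\alpha,y\rangle=-\langle\alpha,y\cdot_A x\rangle$, $\langle d_Af,x\rangle=a_A(x)(f)$. Set $\alpha\cdot^{H^\sharp}\beta=\mathcal L_{H^\sharp(\alpha)}\beta-R_{H^\sharp(\beta)}\alpha-d_A(H(\alpha,\beta))$.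 Let $\mathcal L^N,R^N,d_A^N$ be given by the same formulas with $(\cdot_A,[-,-]_A,a_A)$ replaced by $(\cdot_N,[-,-]_N,a_N)$, and set $\alpha\star^{H^\sharp}\beta=\mathcal L^N_{H^\sharp(\alpha)}\beta-R^N_{H^\sharp(\beta)}\alpha-d^N_A(H(\alpha,\beta))$ and $\alpha\cdot^{H^\sharp}_{N^*}\beta=N^*(\alpha)\cdot^{H^\sharp}\beta+\alpha\cdot^{H^\sharp}N^*(\beta)-N^*(\alpha\cdot^{H^\sharp}\beta)$. Koszul-Vinberg-Nijenhuis (KVN) structure: a pair $(H,N)$ with $H$ a Koszul-Vinberg structure and $N$ a Nijenhuis operator on $A$ such that $N\circ H^\sharp=H^\sharp\circ N^*$ and $\alpha\star^{H^\sharp}\beta=\alpha\cdot^{H^\sharp}_{N^*}\beta$ for all $\alpha,\beta\in\Gamma(A^* )$. Pseudo-Hessian structures. $\mathrm{Sym}^2(A^* )$ is the set of symmetric sections $\mathfrak B$ of $A^*\otimes A^*$; $\mathfrak B^\natural:A\to A^*$ is $\langle\mathfrak B^\natural(x),y\rangle=\mathfrak B(x,y)$; $\mathfrak B$ is nondegenerate if $\mathfrak B^\natural$ is invertible. $\delta_A\mathfrak B(x,y,z)=a_A(x)\mathfrak B(y,z)-a_A(y)\mathfrak B(x,z)-\mathfrak B(y,x\cdot_A z)+\mathfrak B(x,y\cdot_A z)-\mathfrak B([x,y]_A,z)$; $\mathfrak B$ is a pseudo-Hessian structure on $A$ if $\delta_A\mathfrak B=0$. Pseudo-Hessian-Nijenhuis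 (HN) structure: a pair $(\mathfrak B,N)$ with $\mathfrak B$ a pseudo-Hessian structure and $N$ a Nijenhuis operator on $A$ such that $\mathfrak B(N(x),y)=\mathfrak B(x,N(y))$ for all $x,y\in\Gamma(A)$ and $\delta_A\mathfrak B_N=0$, where $\mathfrak B_N(x,y)=\mathfrak B(N(x),y)$. *)

theory Defs
  imports "HOL-Analysis.Analysis"
begin

section \<open>Smooth maps and smooth manifolds\<close>

fun C_k_on :: "nat \<Rightarrow> 'e::real_normed_vector set \<Rightarrow> ('e \<Rightarrow> 'b::real_normed_vector) \<Rightarrow> bool" where
  "C_k_on 0 S f \<longleftrightarrow> continuous_on S f"
| "C_k_on (Suc k) S f \<longleftrightarrow>
     (\<forall>x\<in>S. f differentiable (at x)) \<and> (\<forall>v. C_k_on k S (\<lambda>x. frechet_derivative f (at x) v))"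

text \<open>Only used for open sets of finite-dimensional spaces.\<close>

definition smooth_on :: "'e::real_normed_vector set \<Rightarrow> ('e \<Rightarrow> 'b::real_normed_vector) \<Rightarrow> bool" where
  "smooth_on S f \<longleftrightarrow> (\<forall>k. C_k_on k S f)"

text \<open>Model spaces are finite-dimensional inner product spaces rather than types of class
  \<open>euclidean_space\<close>, because the latter excludes dimension zero (zero-dimensional base, rank zero).\<close>

definition finite_dim :: "'e::real_inner itself \<Rightarrow> bool" where
  "finite_dim _ \<longleftrightarrow> (\<exists>B::'e set. finite B \<and> span B = UNIV)"

type_synonym ('m, 'e) chart = "'m set \<times> ('m \<Rightarrow> 'e)"

abbreviation chart_inv :: "('m, 'e) chart \<Rightarrow> 'e \<Rightarrow> 'm" where
  "chart_inv k \<equiv> inv_into (fst k) (snd k)"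

text \<open>The manifold is the whole type \<open>'m\<close>; it is Hausdorff and second countable by its type class.\<close>

definition smooth_atlas ::
    "('m::{t2_space, second_countable_topology}, 'e::real_inner) chart set \<Rightarrow> bool" where
  "smooth_atlas C \<longleftrightarrow>
     finite_dim TYPE('e) \<and>
     (\<Union>k\<in>C. fst k) = UNIV \<and>
     (\<forall>k\<in>C. open (fst k) \<and> open (snd k ` fst k) \<and>
        homeomorphism (fst k) (snd k ` fst k) (snd k) (chart_inv k)) \<and>
     (\<forall>k\<in>C. \<forall>l\<in>C. smooth_on (snd k ` (fst k \<inter> fst l)) (snd l \<circ> chart_inv k))"

definition smooth_fun_on ::
    "('m, 'e::real_normed_vector) chart set \<Rightarrow> 'm set \<Rightarrow> ('m \<Rightarrow> 'b::real_normed_vector) \<Rightarrow> bool" where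
  "smooth_fun_on C U f \<longleftrightarrow> (\<forall>k\<in>C. smooth_on (snd k ` (fst k \<inter> U)) (f \<circ> chart_inv k))"

text \<open>A tangent vector at \<open>p\<close> is its family of coordinate representatives in all the charts around
  \<open>p\<close>, transforming by the derivatives of the transition maps (and \<open>0\<close> at all other charts).\<close>

definition tangent_space ::
    "('m, 'e::real_normed_vector) chart set \<Rightarrow> 'm \<Rightarrow> (('m, 'e) chart \<Rightarrow> 'e) set" where
  "tangent_space C p = {X.
     (\<forall>k\<in>C. \<forall>l\<in>C. p \<in> fst k \<inter> fst l \<longrightarrow>
        X l = frechet_derivative (snd l \<circ> chart_inv k) (at (snd k p)) (X k)) \<and>
     (\<forall>k. k \<notin> C \<or> p \<notin> fst k \<longrightarrow> X k = 0)}"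

text \<open>The derivative \<open>X(f)\<close> of \<open>f\<close> along \<open>X \<in> T\<^sub>pM\<close>; it does not depend on the chart.\<close>

definition tangent_deriv ::
    "('m, 'e::real_normed_vector) chart set \<Rightarrow> 'm \<Rightarrow> (('m, 'e) chart \<Rightarrow> 'e) \<Rightarrow> ('m \<Rightarrow> real) \<Rightarrow> real" where
  "tangent_deriv C p X f =
     (let k = (SOME k. k \<in> C \<and> p \<in> fst k)
      in frechet_derivative (f \<circ> chart_inv k) (at (snd k p)) (X k))"


section \<open>Smooth vector bundles\<close>

text \<open>The fibres are linear subspaces of one real vector space \<open>'a\<close>, which carries no topology and
  need not be finite-dimensional; every vector bundle has this form up to isomorphism, e.g. with the
  direct sum of all its fibres as \<open>'a\<close>. Fibres over different points need not be disjoint: the total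
  space is the set of pairs \<open>(p, v)\<close> with \<open>v \<in> fib p\<close>. A local trivialization \<open>(U, \<phi>)\<close>
  consists of linear isomorphisms \<open>\<phi> p\<close> of \<open>fib p\<close> onto the typical fibre \<open>'f\<close>, for \<open>p \<in> U\<close>.\<close>

record ('m, 'e, 'a, 'f) vector_bundle =
  charts :: "('m, 'e) chart set"
  fib :: "'m \<Rightarrow> 'a set"
  trivs :: "('m set \<times> ('m \<Rightarrow> 'a \<Rightarrow> 'f)) set"

definition linear_map_on :: "'a::real_vector set \<Rightarrow> ('a \<Rightarrow> 'b::real_vector) \<Rightarrow> bool" where
  "linear_map_on S f \<longleftrightarrow>
     (\<forall>v\<in>S. \<forall>w\<in>S. f (v + w) = f v + f w) \<and> (\<forall>c. \<forall>v\<in>S. f (c *\<^sub>R v) = c *\<^sub>R f v)"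

abbreviation lift ::
    "('m, 'e, 'a, 'f, 'z) vector_bundle_scheme \<Rightarrow> ('m \<Rightarrow> 'a \<Rightarrow> 'f) \<Rightarrow> 'm \<Rightarrow> 'f \<Rightarrow> 'a" where
  "lift A \<phi> p \<equiv> inv_into (fib A p) (\<phi> p)"

definition vector_bundle ::
    "('m::{t2_space, second_countable_topology}, 'e::real_inner, 'a::real_vector, 'f::real_inner, 'z)
       vector_bundle_scheme \<Rightarrow> bool" where
  "vector_bundle A \<longleftrightarrow>
     smooth_atlas (charts A) \<and>
     finite_dim TYPE('f) \<and>
     (\<forall>p. subspace (fib A p)) \<and>
     (\<Union>(U, \<phi>)\<in>trivs A. U) = UNIV \<and>
     (\<forall>(U, \<phi>)\<in>trivs A. open U \<and>
        (\<forall>p\<in>U. linear_map_on (fib A p) (\<phi> p) \<and> bij_betw (\<phi> p) (fib A p) UNIV)) \<and>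
     (\<forall>(U, \<phi>)\<in>trivs A. \<forall>(V, \<psi>)\<in>trivs A. \<forall>w.
        smooth_fun_on (charts A) (U \<inter> V) (\<lambda>p. \<psi> p (lift A \<phi> p w)))"

abbreviation smooth_fun ::
    "('m, 'e::real_normed_vector, 'a, 'f, 'z) vector_bundle_scheme \<Rightarrow> ('m \<Rightarrow> real) \<Rightarrow> bool" where
  "smooth_fun A f \<equiv> smooth_fun_on (charts A) UNIV f"

definition sections ::
    "('m, 'e::real_normed_vector, 'a, 'f::real_normed_vector, 'z) vector_bundle_scheme \<Rightarrow> ('m \<Rightarrow> 'a) set" where
  "sections A = {x. (\<forall>p. x p \<in> fib A p) \<and>
     (\<forall>(U, \<phi>)\<in>trivs A. smooth_fun_on (charts A) U (\<lambda>p. \<phi> p (x p)))}"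

text \<open>The fibre of the dual bundle. Linear functionals on a fibre are extended by \<open>0\<close> outside of it,
  so that they are determined by their restriction to the fibre.\<close>

definition dual_fib :: "('m, 'e, 'a::real_vector, 'f, 'z) vector_bundle_scheme \<Rightarrow> 'm \<Rightarrow> ('a \<Rightarrow> real) set" where
  "dual_fib A p = {\<xi>. linear_map_on (fib A p) \<xi> \<and> (\<forall>v. v \<notin> fib A p \<longrightarrow> \<xi> v = 0)}"

definition dual_sections ::
    "('m, 'e::real_normed_vector, 'a::real_vector, 'f, 'z) vector_bundle_scheme \<Rightarrow> ('m \<Rightarrow> 'a \<Rightarrow> real) set" where
  "dual_sections A = {\<alpha>. (\<forall>p. \<alpha> p \<in> dual_fib A p) \<and>
     (\<forall>(U, \<phi>)\<in>trivs A. \<forall>w. smooth_fun_on (charts A) U (\<lambda>p. \<alpha> p (lift A \<phi> p w)))}"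

definition pair :: "('m \<Rightarrow> 'a \<Rightarrow> real) \<Rightarrow> ('m \<Rightarrow> 'a) \<Rightarrow> 'm \<Rightarrow> real" where
  "pair \<alpha> x = (\<lambda>p. \<alpha> p (x p))"

text \<open>The section of the dual bundle given by its pairings \<open>F y\<close> with all sections \<open>y\<close>.\<close>

definition dual_section_of ::
    "('m, 'e::real_normed_vector, 'a::real_vector, 'f::real_normed_vector, 'z) vector_bundle_scheme \<Rightarrow>
       (('m \<Rightarrow> 'a) \<Rightarrow> 'm \<Rightarrow> real) \<Rightarrow> 'm \<Rightarrow> 'a \<Rightarrow> real" where
  "dual_section_of A F = (THE \<alpha>. \<alpha> \<in> dual_sections A \<and> (\<forall>y\<in>sections A. pair \<alpha> y = F y))"

definition bundle_endo ::
    "('m, 'e::real_normed_vector, 'a::real_vector, 'f::real_normed_vector, 'z) vector_bundle_scheme \<Rightarrow>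
       ('m \<Rightarrow> 'a \<Rightarrow> 'a) \<Rightarrow> bool" where
  "bundle_endo A N \<longleftrightarrow>
     (\<forall>p. linear_map_on (fib A p) (N p) \<and> N p ` fib A p \<subseteq> fib A p) \<and>
     (\<forall>(U, \<phi>)\<in>trivs A. \<forall>(V, \<psi>)\<in>trivs A. \<forall>w.
        smooth_fun_on (charts A) (U \<inter> V) (\<lambda>p. \<psi> p (N p (lift A \<phi> p w))))"

definition app :: "('m \<Rightarrow> 'a \<Rightarrow> 'b) \<Rightarrow> ('m \<Rightarrow> 'a) \<Rightarrow> 'm \<Rightarrow> 'b" where
  "app N x = (\<lambda>p. N p (x p))"

definition dual_map ::
    "('m, 'e, 'a, 'f, 'z) vector_bundle_scheme \<Rightarrow> ('m \<Rightarrow> 'a \<Rightarrow> 'a) \<Rightarrow> 'm \<Rightarrow> ('a \<Rightarrow> real) \<Rightarrow> 'a \<Rightarrow> real" where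
  "dual_map A N p \<xi> = (\<lambda>v. if v \<in> fib A p then \<xi> (N p v) else 0)"

definition bundle_map_to_tangent ::
    "('m, 'e::real_normed_vector, 'a::real_vector, 'f, 'z) vector_bundle_scheme \<Rightarrow>
       ('m \<Rightarrow> 'a \<Rightarrow> ('m, 'e) chart \<Rightarrow> 'e) \<Rightarrow> bool" where
  "bundle_map_to_tangent A a \<longleftrightarrow>
     (\<forall>p. a p ` fib A p \<subseteq> tangent_space (charts A) p \<and> (\<forall>k. linear_map_on (fib A p) (\<lambda>v. a p v k))) \<and>
     (\<forall>(U, \<phi>)\<in>trivs A. \<forall>k\<in>charts A. \<forall>w.
        smooth_fun_on (charts A) (U \<inter> fst k) (\<lambda>p. a p (lift A \<phi> p w) k))"


section \<open>Symmetric tensors\<close>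

text \<open>Elements of \<open>A\<^sub>p \<otimes> A\<^sub>p\<close> are represented by the corresponding bilinear forms on the dual of
  the fibre \<open>A\<^sub>p\<close>. Linearity in the first argument follows from symmetry. The values of \<open>H p\<close> and
  \<open>B p\<close> at arguments outside of the fibres are irrelevant. Smoothness means smoothness of the
  coefficients with respect to local trivializations.\<close>

abbreviation colift ::
    "('m, 'e, 'a, 'f::real_inner, 'z) vector_bundle_scheme \<Rightarrow> ('m \<Rightarrow> 'a \<Rightarrow> 'f) \<Rightarrow> 'm \<Rightarrow> 'f \<Rightarrow> 'a \<Rightarrow> real" where
  "colift A \<phi> p u \<equiv> (\<lambda>v. if v \<in> fib A p then \<phi> p v \<bullet> u else 0)"

definition Sym2 ::
    "('m, 'e::real_normed_vector, 'a::real_vector, 'f::real_inner, 'z) vector_bundle_scheme \<Rightarrow>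
       ('m \<Rightarrow> ('a \<Rightarrow> real) \<Rightarrow> ('a \<Rightarrow> real) \<Rightarrow> real) set" where
  "Sym2 A = {H.
     (\<forall>p. \<forall>\<xi>\<in>dual_fib A p. \<forall>\<eta>\<in>dual_fib A p.
        H p \<xi> \<eta> = H p \<eta> \<xi> \<and>
        (\<forall>\<zeta>\<in>dual_fib A p. H p \<xi> (\<lambda>v. \<eta> v + \<zeta> v) = H p \<xi> \<eta> + H p \<xi> \<zeta>) \<and>
        (\<forall>c. H p \<xi> (\<lambda>v. c * \<eta> v) = c * H p \<xi> \<eta>)) \<and>
     (\<forall>(U, \<phi>)\<in>trivs A. \<forall>u w.
        smooth_fun_on (charts A) U (\<lambda>p. H p (colift A \<phi> p u) (colift A \<phi> p w)))}"

definition Sym2_dual ::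
    "('m, 'e::real_normed_vector, 'a::real_vector, 'f, 'z) vector_bundle_scheme \<Rightarrow>
       ('m \<Rightarrow> 'a \<Rightarrow> 'a \<Rightarrow> real) set" where
  "Sym2_dual A = {B.
     (\<forall>p. \<forall>v\<in>fib A p. linear_map_on (fib A p) (B p v) \<and> (\<forall>w\<in>fib A p. B p v w = B p w v)) \<and>
     (\<forall>(U, \<phi>)\<in>trivs A. \<forall>u w.
        smooth_fun_on (charts A) U (\<lambda>p. B p (lift A \<phi> p u) (lift A \<phi> p w)))}"

definition sharp ::
    "('m, 'e, 'a::real_vector, 'f, 'z) vector_bundle_scheme \<Rightarrow>
       ('m \<Rightarrow> ('a \<Rightarrow> real) \<Rightarrow> ('a \<Rightarrow> real) \<Rightarrow> real) \<Rightarrow> 'm \<Rightarrow> ('a \<Rightarrow> real) \<Rightarrow> 'a" where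
  "sharp A H p \<xi> = (THE v. v \<in> fib A p \<and> (\<forall>\<eta>\<in>dual_fib A p. \<eta> v = H p \<xi> \<eta>))"

definition natural ::
    "('m, 'e, 'a, 'f, 'z) vector_bundle_scheme \<Rightarrow> ('m \<Rightarrow> 'a \<Rightarrow> 'a \<Rightarrow> real) \<Rightarrow> 'm \<Rightarrow> 'a \<Rightarrow> 'a \<Rightarrow> real" where
  "natural A B p v = (\<lambda>w. if w \<in> fib A p then B p v w else 0)"

definition nondegenerate ::
    "('m, 'e, 'a::real_vector, 'f, 'z) vector_bundle_scheme \<Rightarrow>
       ('m \<Rightarrow> ('a \<Rightarrow> real) \<Rightarrow> ('a \<Rightarrow> real) \<Rightarrow> real) \<Rightarrow> bool" where
  "nondegenerate A H \<longleftrightarrow> (\<forall>p. bij_betw (sharp A H p) (dual_fib A p) (fib A p))"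

definition nondegenerate_dual ::
    "('m, 'e, 'a::real_vector, 'f, 'z) vector_bundle_scheme \<Rightarrow> ('m \<Rightarrow> 'a \<Rightarrow> 'a \<Rightarrow> real) \<Rightarrow> bool" where
  "nondegenerate_dual A B \<longleftrightarrow> (\<forall>p. bij_betw (natural A B p) (fib A p) (dual_fib A p))"

text \<open>The tensor \<open>H\<close> with \<open>H\<^sup>\<sharp> = (B\<^sup>\<natural>)\<^sup>-\<^sup>1\<close>, via \<open>H(\<xi>, \<eta>) = \<langle>H\<^sup>\<sharp>(\<xi>), \<eta>\<rangle>\<close>, and the tensor \<open>B\<close>
  with \<open>B\<^sup>\<natural> = (H\<^sup>\<sharp>)\<^sup>-\<^sup>1\<close>, via \<open>B(v, w) = \<langle>B\<^sup>\<natural>(v), w\<rangle>\<close>; see the two lemmas below.\<close>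

definition inverse_of_dual ::
    "('m, 'e, 'a, 'f, 'z) vector_bundle_scheme \<Rightarrow> ('m \<Rightarrow> 'a \<Rightarrow> 'a \<Rightarrow> real) \<Rightarrow>
       'm \<Rightarrow> ('a \<Rightarrow> real) \<Rightarrow> ('a \<Rightarrow> real) \<Rightarrow> real" where
  "inverse_of_dual A B p \<xi> \<eta> = \<eta> (inv_into (fib A p) (natural A B p) \<xi>)"

definition inverse_of ::
    "('m, 'e, 'a::real_vector, 'f, 'z) vector_bundle_scheme \<Rightarrow>
       ('m \<Rightarrow> ('a \<Rightarrow> real) \<Rightarrow> ('a \<Rightarrow> real) \<Rightarrow> real) \<Rightarrow> 'm \<Rightarrow> 'a \<Rightarrow> 'a \<Rightarrow> real" where
  "inverse_of A H p v w = inv_into (dual_fib A p) (sharp A H p) v w"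

lemma colift_in_dual_fib:
  assumes "vector_bundle A" "(U, \<phi>) \<in> trivs A" "p \<in> U"
  shows "colift A \<phi> p u \<in> dual_fib A p"
proof -
  have "subspace (fib A p)" "linear_map_on (fib A p) (\<phi> p)"
    using assms unfolding vector_bundle_def by auto
  then show ?thesis
    by (auto simp: dual_fib_def linear_map_on_def inner_add_left subspace_add subspace_scale)
qed

lemma dual_fib_separates:
  assumes A: "vector_bundle A" and v: "v \<in> fib A p" and w: "w \<in> fib A p"
    and eq: "\<And>\<eta>. \<eta> \<in> dual_fib A p \<Longrightarrow> \<eta> v = \<eta> w"
  shows "v = w"
proof -
  have "p \<in> (\<Union>(U, \<phi>)\<in>trivs A. U)"
    using A unfolding vector_bundle_def by auto
  then obtain U \<phi> where U: "(U, \<phi>) \<in> trivs A" "p \<in> U"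
    by auto
  have "\<phi> p v \<bullet> u = \<phi> p w \<bullet> u" for u
    using eq[OF colift_in_dual_fib[OF A U, of u]] v w by simp
  then have "(\<phi> p v - \<phi> p w) \<bullet> (\<phi> p v - \<phi> p w) = 0"
    by (simp only: inner_diff_left)
  then have "\<phi> p v = \<phi> p w"
    by simp
  moreover have "inj_on (\<phi> p) (fib A p)"
    using A U unfolding vector_bundle_def bij_betw_def by auto
  ultimately show ?thesis
    using v w by (auto dest: inj_onD)
qed

lemma sharp_inverse_of_dual:
  assumes A: "vector_bundle A" and B: "nondegenerate_dual A B" and \<xi>: "\<xi> \<in> dual_fib A p"
  shows "sharp A (inverse_of_dual A B) p \<xi> = inv_into (fib A p) (natural A B p) \<xi>"
proof -
  have "natural A B p ` fib A p = dual_fib A p"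
    using B unfolding nondegenerate_dual_def bij_betw_def by auto
  then have "inv_into (fib A p) (natural A B p) \<xi> \<in> fib A p"
    using \<xi> by (metis inv_into_into)
  then show ?thesis
    unfolding sharp_def inverse_of_dual_def
    by (intro the_equality) (auto intro: dual_fib_separates[OF A])
qed

lemma natural_inverse_of:
  assumes H: "nondegenerate A H" and v: "v \<in> fib A p"
  shows "natural A (inverse_of A H) p v = inv_into (dual_fib A p) (sharp A H p) v"
proof -
  have "sharp A H p ` dual_fib A p = fib A p"
    using H unfolding nondegenerate_def bij_betw_def by auto
  then have "inv_into (dual_fib A p) (sharp A H p) v \<in> dual_fib A p"
    using v by (metis inv_into_into)
  then show ?thesis
    by (auto simp: natural_def inverse_of_def dual_fib_def fun_eq_iff)
qed


section \<open>Left-symmetric algebroids\<close>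

text \<open>The operation \<open>mul\<close> is only constrained on sections.\<close>

record ('m, 'e, 'a, 'f) algebroid = "('m, 'e, 'a, 'f) vector_bundle" +
  mul :: "('m \<Rightarrow> 'a) \<Rightarrow> ('m \<Rightarrow> 'a) \<Rightarrow> 'm \<Rightarrow> 'a"
  anchor :: "'m \<Rightarrow> 'a \<Rightarrow> ('m, 'e) chart \<Rightarrow> 'e"

definition act ::
    "('m, 'e::real_normed_vector, 'a, 'f, 'z) algebroid_scheme \<Rightarrow> ('m \<Rightarrow> 'a) \<Rightarrow> ('m \<Rightarrow> real) \<Rightarrow> 'm \<Rightarrow> real" where
  "act A x f = (\<lambda>p. tangent_deriv (charts A) p (anchor A p (x p)) f)"

definition bracket ::
    "('m, 'e, 'a::real_vector, 'f, 'z) algebroid_scheme \<Rightarrow> ('m \<Rightarrow> 'a) \<Rightarrow> ('m \<Rightarrow> 'a) \<Rightarrow> 'm \<Rightarrow> 'a" where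
  "bracket A x y = (\<lambda>p. mul A x y p - mul A y x p)"

definition left_symmetric_algebroid ::
    "('m::{t2_space, second_countable_topology}, 'e::real_inner, 'a::real_vector, 'f::real_inner, 'z)
       algebroid_scheme \<Rightarrow> bool" where
  "left_symmetric_algebroid A \<longleftrightarrow>
     vector_bundle A \<and>
     bundle_map_to_tangent A (anchor A) \<and>
     (\<forall>x\<in>sections A. \<forall>y\<in>sections A. mul A x y \<in> sections A) \<and>
     (\<forall>x\<in>sections A. \<forall>y\<in>sections A. \<forall>z\<in>sections A.
        mul A (\<lambda>p. x p + y p) z = (\<lambda>p. mul A x z p + mul A y z p) \<and>
        mul A x (\<lambda>p. y p + z p) = (\<lambda>p. mul A x y p + mul A x z p)) \<and>
     (\<forall>c. \<forall>x\<in>sections A. \<forall>y\<in>sections A.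
        mul A (\<lambda>p. c *\<^sub>R x p) y = (\<lambda>p. c *\<^sub>R mul A x y p) \<and>
        mul A x (\<lambda>p. c *\<^sub>R y p) = (\<lambda>p. c *\<^sub>R mul A x y p)) \<and>
     (\<forall>x\<in>sections A. \<forall>y\<in>sections A. \<forall>z\<in>sections A.
        (\<lambda>p. mul A x (mul A y z) p - mul A (mul A x y) z p) =
        (\<lambda>p. mul A y (mul A x z) p - mul A (mul A y x) z p)) \<and>
     (\<forall>f. smooth_fun A f \<longrightarrow> (\<forall>x\<in>sections A. \<forall>y\<in>sections A.
        mul A x (\<lambda>p. f p *\<^sub>R y p) = (\<lambda>p. f p *\<^sub>R mul A x y p + act A x f p *\<^sub>R y p) \<and>
        mul A (\<lambda>p. f p *\<^sub>R x p) y = (\<lambda>p. f p *\<^sub>R mul A x y p)))"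

definition deformed_mul ::
    "('m, 'e, 'a::real_vector, 'f, 'z) algebroid_scheme \<Rightarrow> ('m \<Rightarrow> 'a \<Rightarrow> 'a) \<Rightarrow>
       ('m \<Rightarrow> 'a) \<Rightarrow> ('m \<Rightarrow> 'a) \<Rightarrow> 'm \<Rightarrow> 'a" where
  "deformed_mul A N x y =
     (\<lambda>p. mul A (app N x) y p + mul A x (app N y) p - app N (mul A x y) p)"

definition nijenhuis_operator ::
    "('m, 'e::real_normed_vector, 'a::real_vector, 'f::real_normed_vector, 'z) algebroid_scheme \<Rightarrow>
       ('m \<Rightarrow> 'a \<Rightarrow> 'a) \<Rightarrow> bool" where
  "nijenhuis_operator A N \<longleftrightarrow>
     bundle_endo A N \<and>
     (\<forall>x\<in>sections A. \<forall>y\<in>sections A.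
        mul A (app N x) (app N y) =
        app N (\<lambda>p. mul A x (app N y) p + mul A (app N x) y p - app N (mul A x y) p))"

text \<open>The algebroid \<open>(A, \<cdot>\<^sub>N, a\<^sub>N)\<close>.\<close>

definition deformation ::
    "('m, 'e, 'a::real_vector, 'f, 'z) algebroid_scheme \<Rightarrow> ('m \<Rightarrow> 'a \<Rightarrow> 'a) \<Rightarrow>
       ('m, 'e, 'a, 'f, 'z) algebroid_scheme" where
  "deformation A N = A\<lparr>mul := deformed_mul A N, anchor := (\<lambda>p v. anchor A p (N p v))\<rparr>"


section \<open>Koszul-Vinberg-Nijenhuis structures\<close>

definition sharp_sec ::
    "('m, 'e, 'a::real_vector, 'f, 'z) vector_bundle_scheme \<Rightarrow>
       ('m \<Rightarrow> ('a \<Rightarrow> real) \<Rightarrow> ('a \<Rightarrow> real) \<Rightarrow> real) \<Rightarrow> ('m \<Rightarrow> 'a \<Rightarrow> real) \<Rightarrow> 'm \<Rightarrow> 'a" where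
  "sharp_sec A H \<alpha> = app (sharp A H) \<alpha>"

definition KV_bracket ::
    "('m, 'e::real_normed_vector, 'a::real_vector, 'f, 'z) algebroid_scheme \<Rightarrow>
       ('m \<Rightarrow> ('a \<Rightarrow> real) \<Rightarrow> ('a \<Rightarrow> real) \<Rightarrow> real) \<Rightarrow>
       ('m \<Rightarrow> 'a \<Rightarrow> real) \<Rightarrow> ('m \<Rightarrow> 'a \<Rightarrow> real) \<Rightarrow> ('m \<Rightarrow> 'a \<Rightarrow> real) \<Rightarrow> 'm \<Rightarrow> real" where
  "KV_bracket A H \<alpha>\<^sub>1 \<alpha>\<^sub>2 \<alpha>\<^sub>3 = (\<lambda>p.
     act A (sharp_sec A H \<alpha>\<^sub>1) (pair \<alpha>\<^sub>3 (sharp_sec A H \<alpha>\<^sub>2)) p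
     - act A (sharp_sec A H \<alpha>\<^sub>2) (pair \<alpha>\<^sub>3 (sharp_sec A H \<alpha>\<^sub>1)) p
     + pair \<alpha>\<^sub>1 (mul A (sharp_sec A H \<alpha>\<^sub>2) (sharp_sec A H \<alpha>\<^sub>3)) p
     - pair \<alpha>\<^sub>2 (mul A (sharp_sec A H \<alpha>\<^sub>1) (sharp_sec A H \<alpha>\<^sub>3)) p
     - pair \<alpha>\<^sub>3 (bracket A (sharp_sec A H \<alpha>\<^sub>1) (sharp_sec A H \<alpha>\<^sub>2)) p)"

definition koszul_vinberg_structure ::
    "('m, 'e::real_normed_vector, 'a::real_vector, 'f::real_inner, 'z) algebroid_scheme \<Rightarrow>
       ('m \<Rightarrow> ('a \<Rightarrow> real) \<Rightarrow> ('a \<Rightarrow> real) \<Rightarrow> real) \<Rightarrow> bool" where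
  "koszul_vinberg_structure A H \<longleftrightarrow>
     H \<in> Sym2 A \<and>
     (\<forall>\<alpha>\<^sub>1\<in>dual_sections A. \<forall>\<alpha>\<^sub>2\<in>dual_sections A. \<forall>\<alpha>\<^sub>3\<in>dual_sections A.
        KV_bracket A H \<alpha>\<^sub>1 \<alpha>\<^sub>2 \<alpha>\<^sub>3 = (\<lambda>p. 0))"

definition lie_deriv ::
    "('m, 'e::real_normed_vector, 'a::real_vector, 'f::real_normed_vector, 'z) algebroid_scheme \<Rightarrow>
       ('m \<Rightarrow> 'a) \<Rightarrow> ('m \<Rightarrow> 'a \<Rightarrow> real) \<Rightarrow> 'm \<Rightarrow> 'a \<Rightarrow> real" where
  "lie_deriv A x \<alpha> = dual_section_of A (\<lambda>y p. act A x (pair \<alpha> y) p - pair \<alpha> (bracket A x y) p)"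

definition Rmul ::
    "('m, 'e::real_normed_vector, 'a::real_vector, 'f::real_normed_vector, 'z) algebroid_scheme \<Rightarrow>
       ('m \<Rightarrow> 'a) \<Rightarrow> ('m \<Rightarrow> 'a \<Rightarrow> real) \<Rightarrow> 'm \<Rightarrow> 'a \<Rightarrow> real" where
  "Rmul A x \<alpha> = dual_section_of A (\<lambda>y p. - pair \<alpha> (mul A y x) p)"

definition alg_diff ::
    "('m, 'e::real_normed_vector, 'a::real_vector, 'f::real_normed_vector, 'z) algebroid_scheme \<Rightarrow>
       ('m \<Rightarrow> real) \<Rightarrow> 'm \<Rightarrow> 'a \<Rightarrow> real" where
  "alg_diff A f = dual_section_of A (\<lambda>x. act A x f)"

definition sharp_prod ::
    "('m, 'e::real_normed_vector, 'a::real_vector, 'f::real_normed_vector, 'z) algebroid_scheme \<Rightarrow>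
       ('m \<Rightarrow> ('a \<Rightarrow> real) \<Rightarrow> ('a \<Rightarrow> real) \<Rightarrow> real) \<Rightarrow>
       ('m \<Rightarrow> 'a \<Rightarrow> real) \<Rightarrow> ('m \<Rightarrow> 'a \<Rightarrow> real) \<Rightarrow> 'm \<Rightarrow> 'a \<Rightarrow> real" where
  "sharp_prod A H \<alpha> \<beta> = (\<lambda>p v.
     lie_deriv A (sharp_sec A H \<alpha>) \<beta> p v
     - Rmul A (sharp_sec A H \<beta>) \<alpha> p v
     - alg_diff A (\<lambda>q. H q (\<alpha> q) (\<beta> q)) p v)"

text \<open>The product \<open>\<star>\<close> is \<open>sharp_prod\<close> of the deformed algebroid; \<open>H\<^sup>\<sharp>\<close> only depends on the
  underlying bundle.\<close>

definition star_prod ::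
    "('m, 'e::real_normed_vector, 'a::real_vector, 'f::real_normed_vector, 'z) algebroid_scheme \<Rightarrow>
       ('m \<Rightarrow> ('a \<Rightarrow> real) \<Rightarrow> ('a \<Rightarrow> real) \<Rightarrow> real) \<Rightarrow> ('m \<Rightarrow> 'a \<Rightarrow> 'a) \<Rightarrow>
       ('m \<Rightarrow> 'a \<Rightarrow> real) \<Rightarrow> ('m \<Rightarrow> 'a \<Rightarrow> real) \<Rightarrow> 'm \<Rightarrow> 'a \<Rightarrow> real" where
  "star_prod A H N = sharp_prod (deformation A N) H"

definition dual_deformed_prod ::
    "('m, 'e::real_normed_vector, 'a::real_vector, 'f::real_normed_vector, 'z) algebroid_scheme \<Rightarrow>
       ('m \<Rightarrow> ('a \<Rightarrow> real) \<Rightarrow> ('a \<Rightarrow> real) \<Rightarrow> real) \<Rightarrow> ('m \<Rightarrow> 'a \<Rightarrow> 'a) \<Rightarrow>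
       ('m \<Rightarrow> 'a \<Rightarrow> real) \<Rightarrow> ('m \<Rightarrow> 'a \<Rightarrow> real) \<Rightarrow> 'm \<Rightarrow> 'a \<Rightarrow> real" where
  "dual_deformed_prod A H N \<alpha> \<beta> = (\<lambda>p v.
     sharp_prod A H (app (dual_map A N) \<alpha>) \<beta> p v
     + sharp_prod A H \<alpha> (app (dual_map A N) \<beta>) p v
     - app (dual_map A N) (sharp_prod A H \<alpha> \<beta>) p v)"

definition KVN_structure ::
    "('m, 'e::real_normed_vector, 'a::real_vector, 'f::real_inner, 'z) algebroid_scheme \<Rightarrow>
       ('m \<Rightarrow> ('a \<Rightarrow> real) \<Rightarrow> ('a \<Rightarrow> real) \<Rightarrow> real) \<Rightarrow> ('m \<Rightarrow> 'a \<Rightarrow> 'a) \<Rightarrow> bool" where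
  "KVN_structure A H N \<longleftrightarrow>
     koszul_vinberg_structure A H \<and>
     nijenhuis_operator A N \<and>
     (\<forall>p. \<forall>\<xi>\<in>dual_fib A p. N p (sharp A H p \<xi>) = sharp A H p (dual_map A N p \<xi>)) \<and>
     (\<forall>\<alpha>\<in>dual_sections A. \<forall>\<beta>\<in>dual_sections A.
        star_prod A H N \<alpha> \<beta> = dual_deformed_prod A H N \<alpha> \<beta>)"


section \<open>Pseudo-Hessian-Nijenhuis structures\<close>

definition eval2 :: "('m \<Rightarrow> 'a \<Rightarrow> 'a \<Rightarrow> real) \<Rightarrow> ('m \<Rightarrow> 'a) \<Rightarrow> ('m \<Rightarrow> 'a) \<Rightarrow> 'm \<Rightarrow> real" where
  "eval2 B x y = (\<lambda>p. B p (x p) (y p))"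

definition delta ::
    "('m, 'e::real_normed_vector, 'a::real_vector, 'f, 'z) algebroid_scheme \<Rightarrow>
       ('m \<Rightarrow> 'a \<Rightarrow> 'a \<Rightarrow> real) \<Rightarrow> ('m \<Rightarrow> 'a) \<Rightarrow> ('m \<Rightarrow> 'a) \<Rightarrow> ('m \<Rightarrow> 'a) \<Rightarrow> 'm \<Rightarrow> real" where
  "delta A B x y z = (\<lambda>p.
     act A x (eval2 B y z) p - act A y (eval2 B x z) p
     - eval2 B y (mul A x z) p + eval2 B x (mul A y z) p
     - eval2 B (bracket A x y) z p)"

definition delta_closed ::
    "('m, 'e::real_normed_vector, 'a::real_vector, 'f::real_normed_vector, 'z) algebroid_scheme \<Rightarrow>
       ('m \<Rightarrow> 'a \<Rightarrow> 'a \<Rightarrow> real) \<Rightarrow> bool" where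
  "delta_closed A B \<longleftrightarrow>
     (\<forall>x\<in>sections A. \<forall>y\<in>sections A. \<forall>z\<in>sections A. delta A B x y z = (\<lambda>p. 0))"

definition pseudo_hessian_structure ::
    "('m, 'e::real_normed_vector, 'a::real_vector, 'f::real_normed_vector, 'z) algebroid_scheme \<Rightarrow>
       ('m \<Rightarrow> 'a \<Rightarrow> 'a \<Rightarrow> real) \<Rightarrow> bool" where
  "pseudo_hessian_structure A B \<longleftrightarrow> B \<in> Sym2_dual A \<and> delta_closed A B"

definition HN_structure ::
    "('m, 'e::real_normed_vector, 'a::real_vector, 'f::real_normed_vector, 'z) algebroid_scheme \<Rightarrow>
       ('m \<Rightarrow> 'a \<Rightarrow> 'a \<Rightarrow> real) \<Rightarrow> ('m \<Rightarrow> 'a \<Rightarrow> 'a) \<Rightarrow> bool" where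
  "HN_structure A B N \<longleftrightarrow>
     pseudo_hessian_structure A B \<and>
     nijenhuis_operator A N \<and>
     (\<forall>x\<in>sections A. \<forall>y\<in>sections A. eval2 B (app N x) y = eval2 B x (app N y)) \<and>
     delta_closed A (\<lambda>p v w. B p (N p v) w)"

end

theory Submission
  imports Defs
begin

text \<open>Write \<open>\<alpha> = B\<^sup>\<natural>x\<close>, \<open>\<beta> = B\<^sup>\<natural>y\<close>. Under this identification of \<open>\<Gamma>(A)\<close> with \<open>\<Gamma>(A\<^sup>*)\<close> the bracket
  \<open>\<lbrakk>H, H\<rbrakk>\<^sub>A\<close> becomes \<open>\<delta>\<^sub>AB\<close>, and \<open>\<langle>\<alpha> \<cdot> \<beta>, z\<rangle> = \<delta>\<^sub>AB(x,z,y) + B(x \<cdot>\<^sub>A y, z)\<close>. Applying the latter to \<open>A\<close> and to its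
  deformation by \<open>N\<close> shows that, for closed \<open>B\<close>, the products \<open>\<star>\<close> and \<open>\<cdot>\<^bsub>N*\<^esub>\<close> differ by \<open>\<delta>\<^sup>NB(x,z,y)\<close>, where
  \<open>\<delta>\<^sup>N\<close> belongs to the deformation. The identity
  \<open>\<delta>\<^sup>NB(x,y,z) = \<delta>\<^sub>AB(Nx,y,z) + \<delta>\<^sub>AB(x,Ny,z) + \<delta>\<^sub>AB(x,y,Nz) - 2 \<delta>\<^sub>AB\<^sub>N(x,y,z)\<close>
  then reduces their equality to \<open>\<delta>\<^sub>AB\<^sub>N = 0\<close>. The rest is analytic: bump functions give enough global
  sections, so that \<open>C\<^sup>\<infinity>\<close>-linear functionals are sections of the dual bundle, and inverses of smooth
  families of linear maps are smooth.\<close>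

text \<open>The products on dual sections are built from \<open>dual_section_of\<close>, a definite
  description over global dual sections, and \<open>mul\<close> is constrained on global sections
  only. Hence no product can be evaluated before the described section is known to exist and to be
  unique, and localization has to pass through cut-off global sections instead of restricting the
  algebroid to open sets.

  Smoothness is always given for fixed directions of the model space or fixed vectors of the typical
  fibre, whereas chain rule, inverses and pairings involve varying ones. A finite Parseval frame,
  available in every dimension including zero, exchanges a varying vector for fixed ones with smooth
  coefficients.

  Both halves of the theorem follow from one equivalence for mutually inverse tensors
  \<open>B\<close> and \<open>H\<close>. They differ only in which of the two tensors has to be
  recognized as a smooth symmetric inverse of the other.\<close>

section \<open>Calculus of smooth maps\<close>

text \<open>On an open set the values of a map determine its derivatives, so agreement on
  \<open>S\<close> passes to each directional derivative; the induction therefore varies both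
  maps.\<close>

lemma C_k_on_cong:
  assumes "open S" "C_k_on k S f" "\<And>x. x \<in> S \<Longrightarrow> f x = g x"
  shows "C_k_on k S g"
  using assms(2,3)
proof (induction k arbitrary: f g)
  case 0
  then show ?case by (simp cong: continuous_on_cong)
next
  case (Suc k)
  have D: "(f has_derivative frechet_derivative f (at x)) (at x)" if "x \<in> S" for x
    using Suc.prems(1) that frechet_derivative_works by auto
  then have D': "(g has_derivative frechet_derivative f (at x)) (at x)" if "x \<in> S" for x
    using has_derivative_transform_within_open[OF _ assms(1) that] Suc.prems(2) that by blast
  then have eq: "frechet_derivative f (at x) = frechet_derivative g (at x)" if "x \<in> S" for x
    using that frechet_derivative_at by blast
  have "C_k_on k S (\<lambda>x. frechet_derivative g (at x) v)" for v
    by (rule Suc.IH[of "\<lambda>x. frechet_derivative f (at x) v"]) (use Suc.prems(1) eq in auto)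
  then show ?case
    using D' by (auto simp: differentiable_def)
qed

text \<open>Frees the inductive steps from \<open>frechet_derivative\<close>: any explicit formula
  for the derivative may serve, and only its regularity in x for each fixed v remains to be
  checked.\<close>

lemma C_k_on_Suc_intro:
  assumes "open S"
    and D: "\<And>x. x \<in> S \<Longrightarrow> (f has_derivative f' x) (at x)"
    and "\<And>v. C_k_on k S (\<lambda>x. f' x v)"
  shows "C_k_on (Suc k) S f"
proof -
  have "f' x = frechet_derivative f (at x)" if "x \<in> S" for x
    using D[OF that] frechet_derivative_at by blast
  then have "C_k_on k S (\<lambda>x. frechet_derivative f (at x) v)" for v
    by (intro C_k_on_cong[OF assms(1,3)]) simp
  then show ?thesis
    using D by (auto simp: differentiable_def)
qed

lemma C_k_on_Suc_deriv:
  assumes "C_k_on (Suc k) S f" "x \<in> S"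
  shows "(f has_derivative frechet_derivative f (at x)) (at x)"
  using assms frechet_derivative_works by auto

lemma C_k_on_mono: "C_k_on (Suc k) S f \<Longrightarrow> C_k_on k S f"
proof (induction k arbitrary: f)
  case 0
  then show ?case
    by (auto intro!: continuous_at_imp_continuous_on differentiable_imp_continuous_within)
next
  case (Suc k)
  then show ?case by (metis C_k_on.simps(2))
qed

text \<open>Derivatives are taken at points of the whole space, not within \<open>S\<close>, so only
  a neighbourhood of each point matters.\<close>

lemma C_k_on_local:
  assumes "\<And>x. x \<in> S \<Longrightarrow> \<exists>T. open T \<and> x \<in> T \<and> C_k_on k T f"
  shows "C_k_on k S f"
  using assms
proof (induction k arbitrary: f)
  case 0
  show ?case
    unfolding C_k_on.simps
  proof (rule continuous_at_imp_continuous_on, rule ballI)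
    fix x assume "x \<in> S"
    then obtain T where "open T" "x \<in> T" "continuous_on T f"
      using 0 by auto
    then show "isCont f x"
      by (simp add: continuous_on_eq_continuous_at)
  qed
next
  case (Suc k)
  have "C_k_on k S (\<lambda>x. frechet_derivative f (at x) v)" for v
    by (rule Suc.IH) (use Suc.prems in force)
  with Suc.prems show ?case by force
qed

lemma C_k_on_subset: "C_k_on k T f \<Longrightarrow> S \<subseteq> T \<Longrightarrow> C_k_on k S f"
  by (induction k arbitrary: f) (auto intro: continuous_on_subset)

lemma C_k_on_const: "C_k_on k S (\<lambda>x. c)"
proof (induction k arbitrary: c)
  case (Suc k)
  then show ?case by (simp add: frechet_derivative_const)
qed simp

lemma C_k_on_linear:
  assumes "bounded_linear f"
  shows "C_k_on k S f"
proof (cases k)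
  case 0
  then show ?thesis
    using assms by (simp add: linear_continuous_on)
next
  case (Suc n)
  have D: "(f has_derivative f) (at x)" for x
    using assms by (rule bounded_linear_imp_has_derivative)
  have "frechet_derivative f (at x) = f" for x
    using D frechet_derivative_at by metis
  then show ?thesis
    using D by (auto simp: Suc differentiable_def C_k_on_const)
qed

lemma C_k_on_add:
  assumes "open S" "C_k_on k S f" "C_k_on k S g"
  shows "C_k_on k S (\<lambda>x. f x + g x)"
  using assms(2,3)
proof (induction k arbitrary: f g)
  case 0
  then show ?case by (simp add: continuous_on_add)
next
  case (Suc k)
  show ?case
    by (rule C_k_on_Suc_intro[OF assms(1) has_derivative_add[OF C_k_on_Suc_deriv C_k_on_Suc_deriv]])
      (use Suc assms(1) in auto)
qed

text \<open>Leibniz rule: both terms of the derivative are again values of \<open>bil\<close> at C^k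
  maps. Scaling, inner products and multiplication are instances.\<close>

lemma C_k_on_bilinear:
  assumes S: "open S" and bil: "bounded_bilinear bil" and "C_k_on k S f" "C_k_on k S g"
  shows "C_k_on k S (\<lambda>x. bil (f x) (g x))"
  using assms(3,4)
proof (induction k arbitrary: f g)
  case 0
  then show ?case by (simp add: bounded_bilinear.continuous_on[OF bil])
next
  case (Suc k)
  show ?case
    by (rule C_k_on_Suc_intro[OF S bounded_bilinear.FDERIV[OF bil C_k_on_Suc_deriv C_k_on_Suc_deriv]])
      (use Suc S C_k_on_mono[OF Suc.prems(1)] C_k_on_mono[OF Suc.prems(2)] in
        \<open>auto intro!: C_k_on_add simp del: C_k_on.simps(1)\<close>)
qed

lemma C_k_on_scaleR:
  "open S \<Longrightarrow> C_k_on k S f \<Longrightarrow> C_k_on k S g \<Longrightarrow> C_k_on k S (\<lambda>x. f x *\<^sub>R g x)"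
  by (rule C_k_on_bilinear[OF _ bounded_bilinear_scaleR])

lemma C_k_on_inner:
  "open S \<Longrightarrow> C_k_on k S f \<Longrightarrow> C_k_on k S g \<Longrightarrow> C_k_on k S (\<lambda>x. f x \<bullet> g x)"
  by (rule C_k_on_bilinear[OF _ bounded_bilinear_inner])

lemma C_k_on_uminus: "open S \<Longrightarrow> C_k_on k S f \<Longrightarrow> C_k_on k S (\<lambda>x. - f x)"
  using C_k_on_scaleR[OF _ C_k_on_const[of k S "-1"]] by simp

lemma C_k_on_sum:
  assumes "open S" "\<And>i. i \<in> I \<Longrightarrow> C_k_on k S (f i)"
  shows "C_k_on k S (\<lambda>x. \<Sum>i\<in>I. f i x)"
  using assms(2) by (induction I rule: infinite_finite_induct) (auto intro: C_k_on_const C_k_on_add assms(1))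

text \<open>The derivative of 1/f is -f'/f^2, in which the reciprocal occurs undifferentiated. Its
  regularity thus rises by one order at each step.\<close>

lemma C_k_on_inverse:
  fixes f :: "'e::real_normed_vector \<Rightarrow> real"
  assumes S: "open S" and "C_k_on k S f" and nz: "\<And>x. x \<in> S \<Longrightarrow> f x \<noteq> 0"
  shows "C_k_on k S (\<lambda>x. inverse (f x))"
  using assms(2)
proof (induction k)
  case 0
  then show ?case using nz by (auto intro: continuous_on_inverse)
next
  case (Suc k)
  have D: "((\<lambda>x. inverse (f x)) has_derivative
      (\<lambda>h. - (inverse (f x) * frechet_derivative f (at x) h * inverse (f x)))) (at x)" if "x \<in> S" for x
    by (rule Deriv.has_derivative_inverse[OF nz[OF that] C_k_on_Suc_deriv[OF Suc.prems that]])
  have IH: "C_k_on k S (\<lambda>x. inverse (f x))"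
    using Suc C_k_on_mono by blast
  show ?case
    by (rule C_k_on_Suc_intro[OF S D], assumption, intro C_k_on_uminus C_k_on_bilinear[OF _ bounded_bilinear_mult] S IH)
      (use Suc.prems in \<open>auto intro: S\<close>)
qed

section \<open>Parseval frames and the chain rule\<close>

text \<open>A Parseval frame: coordinates without the class \<^class>\<open>euclidean_space\<close>.\<close>

definition frame :: "'b::real_inner set \<Rightarrow> bool" where
  "frame E \<longleftrightarrow> finite E \<and> (\<forall>v. (\<Sum>e\<in>E. (v \<bullet> e) *\<^sub>R e) = v)"

text \<open>Orthogonalize a finite spanning set and normalize. The expansion is linear in v, so it
  has to be verified on the generators only.\<close>

lemma finite_dim_frame:
  assumes "finite_dim TYPE('b::real_inner)"
  obtains E :: "'b::real_inner set" where "frame E"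
proof -
  obtain B :: "'b set" where "finite B" "span B = UNIV"
    using assms unfolding finite_dim_def by auto
  then obtain C :: "'b set" where C: "finite C" "span C = UNIV" "pairwise orthogonal C"
    using basis_orthogonal[of B] by auto
  \<comment> \<open>The orthogonal generators may include 0, which cannot be normalized and
    contributes nothing to the span.\<close>
  define E where "E = (\<lambda>c. c /\<^sub>R norm c) ` (C - {0})"
  \<comment> \<open>Distinct generators stay distinct after normalization because they are
    orthogonal; this permits summing over \<open>C - {0}\<close> instead of
    \<open>E\<close>.\<close>
  have inj: "inj_on (\<lambda>c. c /\<^sub>R norm c) (C - {0})"
  proof (rule inj_onI)
    fix c d assume cd: "c \<in> C - {0}" "d \<in> C - {0}" "c /\<^sub>R norm c = d /\<^sub>R norm d"
    show "c = d"
    proof (rule ccontr)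
      assume "c \<noteq> d"
      then have "c \<bullet> d = 0"
        using C(3) cd unfolding pairwise_def orthogonal_def by auto
      then have "(c /\<^sub>R norm c) \<bullet> (d /\<^sub>R norm d) = 0"
        by simp
      then show False
        using cd by simp
    qed
  qed
  have "(\<Sum>e\<in>E. (v \<bullet> e) *\<^sub>R e) = v" for v
  proof -
    have "v \<in> span C" using C by simp
    then show ?thesis
    proof (induction rule: span_induct_alt)
      case base
      then show ?case by simp
    next
      case (step a x y)
      have x: "(\<Sum>e\<in>E. (x \<bullet> e) *\<^sub>R e) = x"
      proof -
        have "(\<Sum>e\<in>E. (x \<bullet> e) *\<^sub>R e)
            = (\<Sum>c\<in>C - {0}. (x \<bullet> (c /\<^sub>R norm c)) *\<^sub>R (c /\<^sub>R norm c))"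
          unfolding E_def by (simp add: sum.reindex[OF inj])
        also have "\<dots> = (\<Sum>c\<in>C - {0}. if c = x then x else 0)"
        proof (rule sum.cong[OF refl])
          fix c assume c: "c \<in> C - {0}"
          show "(x \<bullet> (c /\<^sub>R norm c)) *\<^sub>R (c /\<^sub>R norm c) = (if c = x then x else 0)"
          proof (cases "c = x")
            case True
            then have "inverse (norm x) * (norm x)\<^sup>2 * inverse (norm x) = 1"
              using c True by (simp add: field_simps power2_eq_square)
            then show ?thesis using True by (simp add: power2_norm_eq_inner[symmetric])
          next
            case False
            then have "x \<bullet> c = 0"
              using C(3) c step(1) unfolding pairwise_def orthogonal_def by (auto simp: inner_commute)
            then show ?thesis using False by simp
          qed
        qed
        also have "\<dots> = x"
          using step(1) C(1) by auto
        finally show ?thesis .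
      qed
      have "(\<Sum>e\<in>E. ((a *\<^sub>R x + y) \<bullet> e) *\<^sub>R e)
          = a *\<^sub>R (\<Sum>e\<in>E. (x \<bullet> e) *\<^sub>R e) + (\<Sum>e\<in>E. (y \<bullet> e) *\<^sub>R e)"
        by (simp add: inner_add_left scaleR_add_left sum.distrib scaleR_sum_right)
      then show ?case
        using step.IH x by simp
    qed
  qed
  then have "frame E"
    unfolding frame_def E_def using C(1) by auto
  then show ?thesis by (rule that)
qed

lemma frame_sum: "frame E \<Longrightarrow> (\<Sum>e\<in>E. (v \<bullet> e) *\<^sub>R e) = v"
  and frame_finite: "frame E \<Longrightarrow> finite E"
  unfolding frame_def by auto

lemma frame_linear:
  fixes f :: "'b::real_inner \<Rightarrow> 'c::real_vector"
  assumes "frame (E::'b set)" "linear f"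
  shows "f v = (\<Sum>e\<in>E. (v \<bullet> e) *\<^sub>R f e)"
proof -
  have "f v = f (\<Sum>e\<in>E. (v \<bullet> e) *\<^sub>R e)"
    using frame_sum[OF assms(1)] by simp
  then show ?thesis
    by (simp add: linear_sum[OF assms(2)] linear_cmul[OF assms(2)])
qed

text \<open>Linear maps out of a finite-dimensional space are continuous, since the frame writes
  them as finite sums of continuous functionals times constants.\<close>

lemma frame_bounded_linear:
  fixes f :: "'b::real_inner \<Rightarrow> 'c::real_normed_vector"
  assumes "frame (E::'b set)" "linear f"
  shows "bounded_linear f"
proof -
  have "bounded_linear (\<lambda>v. \<Sum>e\<in>E. (v \<bullet> e) *\<^sub>R f e)"
    by (intro bounded_linear_sum bounded_linear_compose[OF bounded_linear_scaleR_left] bounded_linear_inner_left)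
  moreover have "f = (\<lambda>v. \<Sum>e\<in>E. (v \<bullet> e) *\<^sub>R f e)"
    by (rule ext) (rule frame_linear[OF assms])
  ultimately show ?thesis by metis
qed

lemma finite_dim_real: "finite_dim TYPE(real)"
  unfolding finite_dim_def by (rule exI[of _ "{1}"]) (auto simp: span_singleton)

text \<open>In the chain rule the direction in which g is differentiated varies with x, while
  \<open>C_k_on\<close> speaks of fixed directions. The frame expands the varying direction into
  fixed ones, with coefficients of class C^k.\<close>

lemma C_k_on_compose:
  fixes f :: "'e::real_normed_vector \<Rightarrow> 'b::real_inner"
  assumes fd: "finite_dim TYPE('b)" and S: "open S" and T: "open T"
    and "C_k_on k S f" "C_k_on k T g" and ST: "\<And>x. x \<in> S \<Longrightarrow> f x \<in> T"
  shows "C_k_on k S (\<lambda>x. g (f x))"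
  using assms(4,5)
proof (induction k arbitrary: g)
  case 0
  then show ?case
    using continuous_on_compose2[of T g S f] ST by auto
next
  case (Suc k)
  obtain E :: "'b set" where E: "frame E"
    using finite_dim_frame[OF fd] .
  let ?f = "\<lambda>x. frechet_derivative f (at x)" and ?g = "\<lambda>x. frechet_derivative g (at x)"
  have g': "(g has_derivative ?g (f x)) (at (f x))" if "x \<in> S" for x
    by (rule C_k_on_Suc_deriv[OF Suc.prems(2) ST[OF that]])
  have D: "((\<lambda>x. g (f x)) has_derivative (\<lambda>v. \<Sum>e\<in>E. (?f x v \<bullet> e) *\<^sub>R ?g (f x) e)) (at x)"
    if x: "x \<in> S" for x
  proof (rule has_derivative_eq_rhs)
    show "((\<lambda>x. g (f x)) has_derivative (\<lambda>v. ?g (f x) (?f x v))) (at x)"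
      by (rule has_derivative_compose[OF C_k_on_Suc_deriv[OF Suc.prems(1) x] g'[OF x]])
    show "(\<lambda>v. ?g (f x) (?f x v)) = (\<lambda>v. \<Sum>e\<in>E. (?f x v \<bullet> e) *\<^sub>R ?g (f x) e)"
      by (rule ext) (rule frame_linear[OF E has_derivative_linear[OF g'[OF x]]])
  qed
  have "C_k_on k S (\<lambda>x. ?g (f x) e)" for e
    using Suc.IH[of "\<lambda>y. ?g y e"] Suc.prems(2) C_k_on_mono[OF Suc.prems(1)] by simp
  moreover have "C_k_on k S (\<lambda>x. ?f x v)" for v
    using Suc.prems(1) by simp
  ultimately show ?case
    by (intro C_k_on_Suc_intro[OF S D] C_k_on_sum C_k_on_scaleR C_k_on_inner C_k_on_const S)
qed

section \<open>Inverses of smooth families of linear maps\<close>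

text \<open>A product rule for a factor c that is merely continuous: at a zero of h, the product of
  c y - c x and h y is of smaller order than y - x. It serves to differentiate inverses that are so
  far known only to be continuous.\<close>

lemma has_derivative_scaleR_vanishing:
  assumes c: "isCont c x" and h: "(h has_derivative h') (at x)" and h0: "h x = 0"
  shows "((\<lambda>y. c y *\<^sub>R h y) has_derivative (\<lambda>v. c x *\<^sub>R h' v)) (at x)"
proof -
  obtain K where K: "\<And>v. norm (h' v) \<le> norm v * K"
    using bounded_linear.bounded[OF has_derivative_bounded_linear[OF h]] by blast
  \<comment> \<open>A bound for the growth of h near x: \<open>K\<close> bounds its derivative and
    the remainder contributes 1. The absolute value makes \<open>L\<close> positive, so that it can
    be divided by.\<close>
  define L where "L = \<bar>K\<bar> + 1"
  have L: "L > 0" "\<And>v. norm (h' v) \<le> norm v * (L - 1)"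
    unfolding L_def using order_trans[OF K mult_left_mono[OF abs_ge_self norm_ge_zero]] by auto
  have "((\<lambda>y. (c y - c x) *\<^sub>R h y) has_derivative (\<lambda>v. 0)) (at x)"
    unfolding has_derivative_at_alt
  proof (intro conjI allI impI)
    fix e :: real assume e: "e > 0"
    obtain d1 where d1: "d1 > 0" "\<And>y. norm (y - x) < d1 \<Longrightarrow> norm (h y - h x - h' (y - x)) \<le> 1 * norm (y - x)"
      using h unfolding has_derivative_at_alt by (metis zero_less_one)
    have "e / L > 0" using e L by simp
    then obtain d2 where d2: "d2 > 0" "\<And>y. dist y x < d2 \<Longrightarrow> dist (c y) (c x) < e / L"
      using c unfolding continuous_at_eps_delta by meson
    show "\<exists>d>0. \<forall>y. norm (y - x) < d \<longrightarrow>
        norm ((c y - c x) *\<^sub>R h y - (c x - c x) *\<^sub>R h x - 0) \<le> e * norm (y - x)"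
    proof (intro exI[of _ "min d1 d2"] conjI allI impI)
      fix y assume y: "norm (y - x) < min d1 d2"
      have "norm (h y) = norm ((h y - h x - h' (y - x)) + h' (y - x))"
        using h0 by simp
      also have "\<dots> \<le> norm (h y - h x - h' (y - x)) + norm (h' (y - x))"
        by (rule norm_triangle_ineq)
      also have "\<dots> \<le> 1 * norm (y - x) + norm (y - x) * (L - 1)"
        using d1(2)[of y] y L(2)[of "y - x"] by (intro add_mono) auto
      finally have *: "norm (h y) \<le> L * norm (y - x)"
        by (simp add: algebra_simps)
      have "\<bar>c y - c x\<bar> \<le> e / L"
        using d2(2)[of y] y by (auto simp: dist_norm)
      then have "\<bar>c y - c x\<bar> * norm (h y) \<le> e / L * (L * norm (y - x))"
        using * by (intro mult_mono) (use e L in auto)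
      then show "norm ((c y - c x) *\<^sub>R h y - (c x - c x) *\<^sub>R h x - 0) \<le> e * norm (y - x)"
        using L by simp
    qed (use d1 d2 in simp)
  qed (rule bounded_linear_zero)
  moreover have "((\<lambda>y. c x *\<^sub>R h y) has_derivative (\<lambda>v. c x *\<^sub>R h' v)) (at x)"
    by (rule has_derivative_scaleR_right[OF h])
  ultimately have "((\<lambda>y. c x *\<^sub>R h y + (c y - c x) *\<^sub>R h y) has_derivative (\<lambda>v. c x *\<^sub>R h' v + 0)) (at x)"
    by (rule has_derivative_add[rotated])
  then show ?thesis
    by (simp add: algebra_simps)
qed

lemma linear_inv_of_bij:
  assumes "linear f" "bij f"
  shows "linear (inv f)"
proof (rule linearI)
  show "inv f (x + y) = inv f x + inv f y" for x y
    by (rule inv_f_eq) (use assms in \<open>auto simp: bij_def linear_add surj_f_inv_f\<close>)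
  show "inv f (c *\<^sub>R x) = c *\<^sub>R inv f x" for c x
    by (rule inv_f_eq) (use assms in \<open>auto simp: bij_def linear_cmul surj_f_inv_f\<close>)
qed

text \<open>With L = inv (G x0), the identity inv (G x) w = L w - L (G x - G x0) (inv (G x) w)
  compares the two inverses. Expanding the innermost vector in the frame leaves only the maps x -> G
  x e for fixed e, whose continuity is given. The identity is a conclusion of its own because it
  will be differentiated.\<close>

lemma linear_inverse_continuous:
  fixes G :: "'e::real_normed_vector \<Rightarrow> 'f::real_inner \<Rightarrow> 'f"
  assumes E: "frame (E::'f set)" and S: "open S" and x0: "x0 \<in> S"
    and cont: "\<And>w. isCont (\<lambda>x. G x w) x0"
    and lin: "\<And>x. x \<in> S \<Longrightarrow> linear (G x) \<and> bij (G x)"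
  shows "isCont (\<lambda>x. inv (G x) w) x0"
    and "x \<in> S \<Longrightarrow> inv (G x) w =
      inv (G x0) w - (\<Sum>e\<in>E. (inv (G x) w \<bullet> e) *\<^sub>R inv (G x0) (G x e - G x0 e))"
proof -
  let ?L = "inv (G x0)"
  have linL: "linear ?L"
    using lin[OF x0] by (simp add: linear_inv_of_bij)
  have inv1: "G x (inv (G x) w) = w" if "x \<in> S" for x w
    using lin[OF that] by (simp add: bij_is_surj surj_f_inv_f)
  have inv2: "?L (G x0 w) = w" for w
    using lin[OF x0] by (simp add: bij_is_inj)
  show eq: "inv (G x) w = ?L w - (\<Sum>e\<in>E. (inv (G x) w \<bullet> e) *\<^sub>R ?L (G x e - G x0 e))"
    if "x \<in> S" for x
  proof -
    let ?u = "inv (G x) w"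
    have "linear (\<lambda>y. ?L (G x y - G x0 y))"
      using linear_compose[OF linear_compose_sub linL] lin[OF that] lin[OF x0] by (auto simp: o_def)
    then have "(\<Sum>e\<in>E. (?u \<bullet> e) *\<^sub>R ?L (G x e - G x0 e)) = ?L (G x ?u - G x0 ?u)"
      using frame_linear[OF E, of "\<lambda>y. ?L (G x y - G x0 y)" ?u] by simp
    also have "\<dots> = ?L w - ?u"
      by (simp add: inv1[OF that] linear_diff[OF linL] inv2)
    finally show ?thesis by simp
  qed
  have bL: "isCont ?L y" for y
    using frame_bounded_linear[OF E linL] by (rule bounded_linear.isCont[OF _ continuous_ident])
  \<comment> \<open>A bound for the operator norm of the perturbation L (G x - G x0).\<close>
  define \<epsilon> where "\<epsilon> x = (\<Sum>e\<in>E. norm e * norm (?L (G x e - G x0 e)))" for x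
  have "((\<lambda>x. ?L (G x e - G x0 e)) \<longlongrightarrow> 0) (at x0)" for e
  proof -
    have "((\<lambda>x. G x e - G x0 e) \<longlongrightarrow> 0) (at x0)"
      using cont[of e] unfolding isCont_def by (simp add: LIM_zero)
    from isCont_tendsto_compose[OF bL this] show ?thesis
      by (simp add: linear_0[OF linL])
  qed
  then have "(\<epsilon> \<longlongrightarrow> (\<Sum>e\<in>E. norm e * norm (0::'f))) (at x0)"
    unfolding \<epsilon>_def by (intro tendsto_intros)
  then have \<epsilon>: "(\<epsilon> \<longlongrightarrow> 0) (at x0)" by simp
  have bound: "norm (inv (G x) w - ?L w) \<le> norm (inv (G x) w) * \<epsilon> x" if "x \<in> S" for x
  proof -
    let ?u = "inv (G x) w"
    have "norm (?u - ?L w) = norm (\<Sum>e\<in>E. (?u \<bullet> e) *\<^sub>R ?L (G x e - G x0 e))"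
      by (subst eq[OF that]) (simp add: norm_minus_commute)
    also have "\<dots> \<le> (\<Sum>e\<in>E. norm ?u * (norm e * norm (?L (G x e - G x0 e))))"
      by (rule sum_norm_le) (simp add: Cauchy_Schwarz_ineq2 mult_right_mono flip: mult.assoc)
    finally show ?thesis
      by (simp add: \<epsilon>_def sum_distrib_left)
  qed
  \<comment> \<open>Below 1/2 the term \<open>norm (inv (G x) w) * \<epsilon> x\<close> can be
    absorbed into the left-hand side, which costs the factor 2 in the bound.\<close>
  have "\<forall>\<^sub>F x in at x0. \<epsilon> x < 1/2"
    by (rule order_tendstoD(2)[OF \<epsilon>]) simp
  moreover have "\<forall>\<^sub>F x in at x0. x \<in> S"
    using S x0 by (simp add: eventually_at_in_open')
  ultimately have "\<forall>\<^sub>F x in at x0. norm (inv (G x) w - ?L w) \<le> 2 * norm (?L w) * \<epsilon> x"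
  proof eventually_elim
    case (elim x)
    have \<epsilon>0: "\<epsilon> x \<ge> 0"
      unfolding \<epsilon>_def by (intro sum_nonneg) auto
    have "norm (inv (G x) w) \<le> norm (?L w) + norm (inv (G x) w) * \<epsilon> x"
      using bound[OF elim(2)] norm_triangle_ineq2[of "inv (G x) w" "?L w"] by linarith
    moreover have "norm (inv (G x) w) * \<epsilon> x \<le> norm (inv (G x) w) * (1/2)"
      using elim(1) by (intro mult_left_mono) auto
    ultimately have "norm (inv (G x) w) \<le> 2 * norm (?L w)"
      by linarith
    from order_trans[OF bound[OF elim(2)] mult_right_mono[OF this \<epsilon>0]] show ?case .
  qed
  then have "((\<lambda>x. inv (G x) w - ?L w) \<longlongrightarrow> 0) (at x0)"
    by (rule Lim_null_comparison) (use tendsto_mult_left[OF \<epsilon>, of "2 * norm (?L w)"] in simp)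
  then show "isCont (\<lambda>x. inv (G x) w) x0"
    unfolding isCont_def by (rule LIM_zero_cancel)
qed

text \<open>In the identity of \<open>linear_inverse_continuous\<close> each summand is a continuous
  coefficient times a term vanishing at x0, which is the situation of
  \<open>has_derivative_scaleR_vanishing\<close>. The resulting derivative, minus inv G composed
  with the derivative of G and inv G, contains the inverse undifferentiated, so the order rises by
  induction.\<close>

lemma C_k_on_linear_inverse:
  fixes G :: "'e::real_normed_vector \<Rightarrow> 'f::real_inner \<Rightarrow> 'f"
  assumes E: "frame (E::'f set)" and S: "open S"
    and "\<And>w. C_k_on k S (\<lambda>x. G x w)"
    and lin: "\<And>x. x \<in> S \<Longrightarrow> linear (G x) \<and> bij (G x)"
  shows "C_k_on k S (\<lambda>x. inv (G x) w)"
  using assms(3)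
proof (induction k arbitrary: w)
  case 0
  have cont: "isCont (\<lambda>x. G x w) x0" if "x0 \<in> S" for x0 w
    using 0 that S by (auto simp: continuous_on_eq_continuous_at)
  have "isCont (\<lambda>x. inv (G x) w) x0" if "x0 \<in> S" for x0
    by (rule linear_inverse_continuous(1)[where G=G, OF E S that cont[OF that] lin])
  then show ?case
    by (simp add: continuous_at_imp_continuous_on)
next
  case (Suc k)
  have IH: "C_k_on k S (\<lambda>x. inv (G x) w)" for w
    using Suc.IH Suc.prems C_k_on_mono by blast
  let ?D = "\<lambda>x e v. frechet_derivative (\<lambda>x. G x e) (at x) v"
  have linI: "linear (inv (G x))" if "x \<in> S" for x
    using lin[OF that] by (simp add: linear_inv_of_bij)
  \<comment> \<open>The inner sum takes the varying vector \<open>?D x0 e v\<close> out of the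
    inverse, since the induction hypothesis concerns the inverse at fixed vectors.\<close>
  have D: "((\<lambda>x. inv (G x) w) has_derivative
      (\<lambda>v. 0 - (\<Sum>e\<in>E. (inv (G x0) w \<bullet> e) *\<^sub>R (\<Sum>e'\<in>E. (?D x0 e v \<bullet> e') *\<^sub>R inv (G x0) e')))) (at x0)"
    if x0: "x0 \<in> S" for x0
  proof -
    have G: "((\<lambda>x. G x e) has_derivative ?D x0 e) (at x0)" for e
      using C_k_on_Suc_deriv[OF Suc.prems x0] .
    have cont: "isCont (\<lambda>x. G x e) x0" for e
      using G by (rule has_derivative_continuous)
    have c: "isCont (\<lambda>x. inv (G x) w) x0"
      by (rule linear_inverse_continuous(1)[where G=G, OF E S x0 cont lin])
    have ci: "isCont (\<lambda>x. inv (G x) w \<bullet> e) x0" for e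
      using c by simp
    have h: "((\<lambda>x. inv (G x0) (G x e - G x0 e)) has_derivative
        (\<lambda>v. inv (G x0) (?D x0 e v - 0))) (at x0)" for e
      by (intro bounded_linear.has_derivative[OF frame_bounded_linear[OF E linI[OF x0]]]
          has_derivative_diff G has_derivative_const)
    have "((\<lambda>x. inv (G x0) w - (\<Sum>e\<in>E. (inv (G x) w \<bullet> e) *\<^sub>R inv (G x0) (G x e - G x0 e)))
      has_derivative (\<lambda>v. 0 - (\<Sum>e\<in>E. (inv (G x0) w \<bullet> e) *\<^sub>R inv (G x0) (?D x0 e v - 0)))) (at x0)"
      by (intro has_derivative_diff has_derivative_const has_derivative_sum
          has_derivative_scaleR_vanishing h ci) (simp add: linear_0[OF linI[OF x0]])
    then have "((\<lambda>x. inv (G x) w) has_derivative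
        (\<lambda>v. 0 - (\<Sum>e\<in>E. (inv (G x0) w \<bullet> e) *\<^sub>R inv (G x0) (?D x0 e v - 0)))) (at x0)"
    proof (rule has_derivative_transform_within_open[OF _ S x0])
      fix x assume "x \<in> S"
      then show "inv (G x0) w - (\<Sum>e\<in>E. (inv (G x) w \<bullet> e) *\<^sub>R inv (G x0) (G x e - G x0 e))
          = inv (G x) w"
        using linear_inverse_continuous(2)[where G=G, OF E S x0 cont lin] by metis
    qed
    moreover have "inv (G x0) (?D x0 e v - 0) = (\<Sum>e'\<in>E. (?D x0 e v \<bullet> e') *\<^sub>R inv (G x0) e')" for e v
      using frame_linear[OF E linI[OF x0], of "?D x0 e v"] by simp
    ultimately show ?thesis by (simp only:)
  qed
  have "C_k_on k S (\<lambda>x. ?D x e v)" for e v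
    using Suc.prems by simp
  then have "C_k_on k S (\<lambda>x. 0 + - (\<Sum>e\<in>E. (inv (G x) w \<bullet> e) *\<^sub>R (\<Sum>e'\<in>E. (?D x e v \<bullet> e') *\<^sub>R inv (G x) e')))" for v
    by (intro C_k_on_add C_k_on_uminus C_k_on_sum C_k_on_scaleR C_k_on_inner C_k_on_const S IH)
  then show ?case
    by (intro C_k_on_Suc_intro[OF S D]) simp_all
qed

section \<open>Closure properties of smooth maps\<close>

lemma smooth_on_cong: "open S \<Longrightarrow> smooth_on S f \<Longrightarrow> (\<And>x. x \<in> S \<Longrightarrow> f x = g x) \<Longrightarrow> smooth_on S g"
  unfolding smooth_on_def using C_k_on_cong by blast

lemma smooth_on_local:
  "(\<And>x. x \<in> S \<Longrightarrow> \<exists>T. open T \<and> x \<in> T \<and> smooth_on T f) \<Longrightarrow> smooth_on S f"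
  unfolding smooth_on_def by (metis C_k_on_local)

lemma smooth_on_subset: "smooth_on T f \<Longrightarrow> S \<subseteq> T \<Longrightarrow> smooth_on S f"
  unfolding smooth_on_def using C_k_on_subset by blast

lemma smooth_on_const: "smooth_on S (\<lambda>x. c)"
  unfolding smooth_on_def by (simp add: C_k_on_const)

lemma smooth_on_linear: "bounded_linear f \<Longrightarrow> smooth_on S f"
  unfolding smooth_on_def by (simp add: C_k_on_linear)

lemma smooth_on_add:
  "open S \<Longrightarrow> smooth_on S f \<Longrightarrow> smooth_on S g \<Longrightarrow> smooth_on S (\<lambda>x. f x + g x)"
  unfolding smooth_on_def by (simp add: C_k_on_add)

lemma smooth_on_uminus: "open S \<Longrightarrow> smooth_on S f \<Longrightarrow> smooth_on S (\<lambda>x. - f x)"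
  unfolding smooth_on_def by (simp add: C_k_on_uminus)

lemma smooth_on_scaleR:
  "open S \<Longrightarrow> smooth_on S f \<Longrightarrow> smooth_on S g \<Longrightarrow> smooth_on S (\<lambda>x. f x *\<^sub>R g x)"
  unfolding smooth_on_def by (simp add: C_k_on_scaleR)

lemma smooth_on_inner:
  "open S \<Longrightarrow> smooth_on S f \<Longrightarrow> smooth_on S g \<Longrightarrow> smooth_on S (\<lambda>x. f x \<bullet> g x)"
  unfolding smooth_on_def by (simp add: C_k_on_inner)

lemma smooth_on_sum:
  "open S \<Longrightarrow> (\<And>i. i \<in> I \<Longrightarrow> smooth_on S (f i)) \<Longrightarrow> smooth_on S (\<lambda>x. \<Sum>i\<in>I. f i x)"
  unfolding smooth_on_def by (simp add: C_k_on_sum)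

lemma smooth_on_inverse:
  fixes f :: "'e::real_normed_vector \<Rightarrow> real"
  shows "open S \<Longrightarrow> smooth_on S f \<Longrightarrow> (\<And>x. x \<in> S \<Longrightarrow> f x \<noteq> 0) \<Longrightarrow> smooth_on S (\<lambda>x. inverse (f x))"
  unfolding smooth_on_def by (simp add: C_k_on_inverse)

lemma smooth_on_compose:
  fixes f :: "'e::real_normed_vector \<Rightarrow> 'b::real_inner"
  shows "finite_dim TYPE('b) \<Longrightarrow> open S \<Longrightarrow> open T \<Longrightarrow> smooth_on S f \<Longrightarrow> smooth_on T g \<Longrightarrow>
    (\<And>x. x \<in> S \<Longrightarrow> f x \<in> T) \<Longrightarrow> smooth_on S (\<lambda>x. g (f x))"
  unfolding smooth_on_def using C_k_on_compose by blast

lemma smooth_on_linear_inverse: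
  fixes G :: "'e::real_normed_vector \<Rightarrow> 'f::real_inner \<Rightarrow> 'f"
  assumes "finite_dim TYPE('f)" "open S" "\<And>w. smooth_on S (\<lambda>x. G x w)"
    and "\<And>x. x \<in> S \<Longrightarrow> linear (G x) \<and> bij (G x)"
  shows "smooth_on S (\<lambda>x. inv (G x) w)"
proof -
  obtain E :: "'f set" where "frame E"
    using finite_dim_frame[OF assms(1)] .
  then show ?thesis
    using assms(2-) unfolding smooth_on_def by (blast intro: C_k_on_linear_inverse)
qed

lemma smooth_on_has_derivative:
  "smooth_on S f \<Longrightarrow> x \<in> S \<Longrightarrow> (f has_derivative frechet_derivative f (at x)) (at x)"
  unfolding smooth_on_def using C_k_on_Suc_deriv by blast

lemma smooth_on_derivative_along:
  fixes f :: "'e::real_inner \<Rightarrow> 'b::real_normed_vector"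
  assumes fd: "finite_dim TYPE('e)" and S: "open S" and f: "smooth_on S f" and v: "smooth_on S v"
  shows "smooth_on S (\<lambda>x. frechet_derivative f (at x) (v x))"
proof -
  obtain E :: "'e set" where E: "frame E"
    using finite_dim_frame[OF fd] .
  have "smooth_on S (\<lambda>x. frechet_derivative f (at x) e)" for e
    using f unfolding smooth_on_def by (metis C_k_on.simps(2))
  then have "smooth_on S (\<lambda>x. \<Sum>e\<in>E. (v x \<bullet> e) *\<^sub>R frechet_derivative f (at x) e)"
    by (intro smooth_on_sum smooth_on_scaleR smooth_on_inner smooth_on_const S v)
  then show ?thesis
  proof (rule smooth_on_cong[OF S])
    fix x assume "x \<in> S"
    show "(\<Sum>e\<in>E. (v x \<bullet> e) *\<^sub>R frechet_derivative f (at x) e) = frechet_derivative f (at x) (v x)"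
      by (rule frame_linear[OF E has_derivative_linear[OF smooth_on_has_derivative[OF f \<open>x \<in> S\<close>]], symmetric])
  qed
qed

section \<open>Bump functions and compact balls in the model space\<close>

text \<open>The family is closed under differentiation, and \<open>flat n t / t = flat (n + 1) t\<close>.\<close>

definition flat :: "nat \<Rightarrow> real \<Rightarrow> real" where
  "flat n t = (if t > 0 then inverse t ^ n * exp (- inverse t) else 0)"

text \<open>From the right, 1/t tends to infinity and the exponential beats every power; from the
  left the function is constantly 0.\<close>

lemma flat_tendsto_0: "(flat n \<longlongrightarrow> 0) (at 0)"
proof -
  have "((\<lambda>t. inverse t ^ n / exp (inverse t)) \<longlongrightarrow> (0::real)) (at_right 0)"
    by (rule filterlim_compose[OF tendsto_power_div_exp_0 filterlim_inverse_at_top_right])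
  then have "(flat n \<longlongrightarrow> 0) (at_right 0)"
    by (rule Lim_transform_eventually)
      (auto simp: flat_def exp_minus field_simps eventually_at_right_less intro!: eventually_mono[OF eventually_at_right_less])
  moreover have "(flat n \<longlongrightarrow> 0) (at_left 0)"
    by (rule tendsto_eventually) (auto simp: flat_def eventually_at_filter)
  ultimately show ?thesis
    by (rule filterlim_split_at_real[rotated])
qed

lemma flat_has_derivative:
  "(flat n has_real_derivative flat (n + 2) t - n * flat (n + 1) t) (at t)"
proof -
  consider "t > 0" | "t < 0" | "t = 0" by linarith
  then show ?thesis
  proof cases
    case 1
    have "(inverse has_real_derivative - (inverse t * inverse t)) (at t)"
      using DERIV_inverse[of t UNIV] 1 by (simp add: power2_eq_square)
    note D = DERIV_mult[OF DERIV_power[OF this, of n] DERIV_fun_exp[OF DERIV_minus[OF this]]]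
    have "((\<lambda>t. inverse t ^ n * exp (- inverse t)) has_real_derivative
        real n * (- (inverse t * inverse t) * inverse t ^ (n - Suc 0)) * exp (- inverse t)
        + exp (- inverse t) * - (- (inverse t * inverse t)) * inverse t ^ n) (at t)"
      by (rule D)
    \<comment> \<open>The split on n deals with the truncated exponent \<open>n - Suc 0\<close>,
      whose coefficient vanishes for n = 0.\<close>
    also have "real n * (- (inverse t * inverse t) * inverse t ^ (n - Suc 0)) * exp (- inverse t)
        + exp (- inverse t) * - (- (inverse t * inverse t)) * inverse t ^ n
        = flat (n + 2) t - n * flat (n + 1) t"
      using 1 by (cases n) (simp_all add: flat_def algebra_simps)
    finally show ?thesis
      by (rule has_field_derivative_transform_within_open[of _ _ _ "{0<..}"]) (use 1 in \<open>auto simp: flat_def\<close>)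
  next
    case 2
    have "((\<lambda>t. 0) has_real_derivative 0) (at t)"
      by simp
    then have "(flat n has_real_derivative 0) (at t)"
      by (rule has_field_derivative_transform_within_open[of _ _ _ "{..<0}"]) (use 2 in \<open>auto simp: flat_def\<close>)
    then show ?thesis using 2 by (simp add: flat_def)
  next
    case 3
    have "(\<lambda>h. (flat n (0 + h) - flat n 0) / h) = flat (n + 1)"
      by (auto simp: flat_def fun_eq_iff field_simps)
    then show ?thesis
      using flat_tendsto_0[of "n + 1"] 3 by (simp add: DERIV_def flat_def)
  qed
qed

lemma smooth_on_flat: "smooth_on UNIV (flat n)"
proof -
  have "C_k_on k UNIV (flat n)" for k
  proof (induction k arbitrary: n)
    case 0
    show ?case
      unfolding C_k_on.simps
      by (intro continuous_at_imp_continuous_on ballI DERIV_isCont[OF flat_has_derivative])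
  next
    case (Suc k)
    have D: "(flat n has_derivative (\<lambda>h. (flat (n + 2) t + (- real n) *\<^sub>R flat (n + 1) t) *\<^sub>R h)) (at t)" for t
      using flat_has_derivative[of n t] by (simp add: has_field_derivative_def)
    show ?case
      by (rule C_k_on_Suc_intro[OF open_UNIV D]) (intro C_k_on_scaleR C_k_on_add C_k_on_const open_UNIV Suc.IH)
  qed
  then show ?thesis unfolding smooth_on_def ..
qed

text \<open>The argument of \<open>flat 0\<close> is r^2 minus the squared distance from x0, which
  is positive exactly on the open ball; the square avoids the singularity of the norm at the
  centre.\<close>

lemma smooth_bump:
  fixes x0 :: "'e::real_inner"
  assumes "r > 0"
  obtains g :: "'e \<Rightarrow> real" where "smooth_on UNIV g" "g x0 \<noteq> 0" "\<And>x. r \<le> dist x0 x \<Longrightarrow> g x = 0"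
proof
  let ?g = "\<lambda>x. flat 0 (r\<^sup>2 + - ((x + - x0) \<bullet> (x + - x0)))"
  show "smooth_on UNIV ?g"
    by (intro smooth_on_compose[OF finite_dim_real open_UNIV open_UNIV _ smooth_on_flat] smooth_on_add
        smooth_on_const smooth_on_uminus smooth_on_inner open_UNIV smooth_on_linear bounded_linear_ident UNIV_I)
  show "?g x0 \<noteq> 0"
    using assms by (simp add: flat_def)
  show "?g x = 0" if "r \<le> dist x0 x" for x
  proof -
    have "r\<^sup>2 \<le> (norm (x - x0))\<^sup>2"
      using that assms by (intro power_mono) (auto simp: dist_norm norm_minus_commute)
    then show ?thesis
      by (simp add: flat_def power2_norm_eq_inner)
  qed
qed

text \<open>The ball is a closed part of the set of frame combinations with bounded coefficients,
  and that set is a finite sum of compact segments.\<close>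

lemma compact_cball_finite_dim:
  fixes x0 :: "'e::real_inner"
  assumes "finite_dim TYPE('e)"
  shows "compact (cball x0 r)"
proof -
  obtain E :: "'e set" where E: "frame E"
    using finite_dim_frame[OF assms] .
  \<comment> \<open>A bound for the norm on the ball; by Cauchy-Schwarz \<open>S * norm e\<close>
    then bounds the coefficient at e.\<close>
  define S where "S = norm x0 + \<bar>r\<bar>"
  have compact: "compact {\<Sum>e\<in>F. c e *\<^sub>R e | c. \<forall>e\<in>F. c e \<in> {- (S * norm e)..S * norm e}}"
    if "finite F" for F :: "'e set"
    using that
  proof induction
    case (insert a F)
    let ?T = "\<lambda>F. {\<Sum>e\<in>F. c e *\<^sub>R e | c. \<forall>e\<in>F. c e \<in> {- (S * norm e)..S * norm e}}"
    have "compact ((\<lambda>t. t *\<^sub>R a) ` {- (S * norm a)..S * norm a})"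
      by (intro compact_continuous_image continuous_intros compact_Icc)
    from compact_sums[OF this insert.IH]
    have "compact {x + y |x y. x \<in> (\<lambda>t. t *\<^sub>R a) ` {- (S * norm a)..S * norm a} \<and> y \<in> ?T F}" .
    also have "{x + y |x y. x \<in> (\<lambda>t. t *\<^sub>R a) ` {- (S * norm a)..S * norm a} \<and> y \<in> ?T F} = ?T (insert a F)"
    proof (intro equalityI subsetI)
      fix z assume "z \<in> {x + y |x y. x \<in> (\<lambda>t. t *\<^sub>R a) ` {- (S * norm a)..S * norm a} \<and> y \<in> ?T F}"
      then obtain t c where tc: "t \<in> {- (S * norm a)..S * norm a}"
        "\<forall>e\<in>F. c e \<in> {- (S * norm e)..S * norm e}" "z = t *\<^sub>R a + (\<Sum>e\<in>F. c e *\<^sub>R e)"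
        by blast
      have "z = (\<Sum>e\<in>insert a F. (c(a := t)) e *\<^sub>R e)"
        using insert.hyps tc(3) by (auto intro!: sum.cong)
      moreover have "\<forall>e\<in>insert a F. (c(a := t)) e \<in> {- (S * norm e)..S * norm e}"
        using tc by auto
      ultimately show "z \<in> ?T (insert a F)"
        by blast
    next
      fix z assume "z \<in> ?T (insert a F)"
      then obtain c where c: "\<forall>e\<in>insert a F. c e \<in> {- (S * norm e)..S * norm e}"
        "z = (\<Sum>e\<in>insert a F. c e *\<^sub>R e)"
        by blast
      then have "z = c a *\<^sub>R a + (\<Sum>e\<in>F. c e *\<^sub>R e)"
        using insert.hyps by simp
      then show "z \<in> {x + y |x y. x \<in> (\<lambda>t. t *\<^sub>R a) ` {- (S * norm a)..S * norm a} \<and> y \<in> ?T F}"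
        using c(1) by blast
    qed
    finally show ?case .
  qed simp
  have "cball x0 r \<subseteq> {\<Sum>e\<in>E. c e *\<^sub>R e | c. \<forall>e\<in>E. c e \<in> {- (S * norm e)..S * norm e}}"
  proof
    fix x assume "x \<in> cball x0 r"
    then have "norm x \<le> S"
      using norm_triangle_ineq2[of x x0] unfolding S_def by (auto simp: dist_norm norm_minus_commute)
    then have "\<bar>x \<bullet> e\<bar> \<le> S * norm e" for e
      using Cauchy_Schwarz_ineq2[of x e] mult_right_mono[of "norm x" S "norm e"] by force
    then have "\<forall>e\<in>E. x \<bullet> e \<in> {- (S * norm e)..S * norm e}"
      by (auto simp: abs_le_iff minus_le_iff)
    then show "x \<in> {\<Sum>e\<in>E. c e *\<^sub>R e | c. \<forall>e\<in>E. c e \<in> {- (S * norm e)..S * norm e}}"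
      using frame_sum[OF E, of x, symmetric] by blast
  qed
  then show ?thesis
    using compact_Int_closed[OF compact[OF frame_finite[OF E]] closed_cball[of x0 r]] by (simp add: Int_absorb1)
qed

section \<open>Smooth functions on manifolds\<close>

locale manifold =
  fixes C :: "('m::{t2_space, second_countable_topology}, 'e::real_inner) chart set"
  assumes atlas: "smooth_atlas C"
begin

section \<open>Charts\<close>

lemma finite_dim_model: "finite_dim TYPE('e)"
  using atlas unfolding smooth_atlas_def by auto

lemma chart_exists: obtains k where "k \<in> C" "p \<in> fst k"
  using atlas unfolding smooth_atlas_def by blast

lemma chart_domain_open: "k \<in> C \<Longrightarrow> open (fst k)"
  using atlas unfolding smooth_atlas_def by auto

lemma chart_homeomorphism:
  "k \<in> C \<Longrightarrow> homeomorphism (fst k) (snd k ` fst k) (snd k) (chart_inv k)"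
  using atlas unfolding smooth_atlas_def by auto

lemma chart_inv_chart: "k \<in> C \<Longrightarrow> p \<in> fst k \<Longrightarrow> chart_inv k (snd k p) = p"
  using chart_homeomorphism unfolding homeomorphism_def by auto

lemma chart_inv_mem: "k \<in> C \<Longrightarrow> x \<in> snd k ` (fst k \<inter> U) \<Longrightarrow> chart_inv k x \<in> U"
  by (elim imageE IntE) (simp add: chart_inv_chart)

lemma chart_image_open:
  assumes "k \<in> C" "open U"
  shows "open (snd k ` (fst k \<inter> U))"
proof -
  have "openin (top_of_set (snd k ` fst k)) (snd k ` (fst k \<inter> U))"
    using homeomorphism_imp_open_map[OF chart_homeomorphism[OF assms(1)]] assms(2)
    by (auto simp: openin_open)
  moreover have "open (snd k ` fst k)"
    using atlas assms(1) unfolding smooth_atlas_def by auto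
  ultimately show ?thesis
    using openin_open_trans by blast
qed

lemma smooth_transition:
  "k \<in> C \<Longrightarrow> l \<in> C \<Longrightarrow> smooth_on (snd k ` (fst k \<inter> fst l)) (snd l \<circ> chart_inv k)"
  using atlas unfolding smooth_atlas_def by auto

section \<open>Algebra of smooth functions on open sets\<close>

lemma smooth_fun_on_chart:
  "smooth_fun_on C U f \<Longrightarrow> k \<in> C \<Longrightarrow> smooth_on (snd k ` (fst k \<inter> U)) (\<lambda>x. f (chart_inv k x))"
  unfolding smooth_fun_on_def by (auto simp: o_def)

lemma smooth_fun_onI:
  "(\<And>k. k \<in> C \<Longrightarrow> smooth_on (snd k ` (fst k \<inter> U)) (\<lambda>x. f (chart_inv k x))) \<Longrightarrow> smooth_fun_on C U f"
  unfolding smooth_fun_on_def by (auto simp: o_def)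

lemma smooth_fun_on_cong:
  assumes U: "open U" and f: "smooth_fun_on C U f" and eq: "\<And>p. p \<in> U \<Longrightarrow> f p = g p"
  shows "smooth_fun_on C U g"
proof (rule smooth_fun_onI)
  fix k assume k: "k \<in> C"
  show "smooth_on (snd k ` (fst k \<inter> U)) (\<lambda>x. g (chart_inv k x))"
    by (rule smooth_on_cong[OF chart_image_open[OF k U] smooth_fun_on_chart[OF f k]])
      (auto simp: chart_inv_chart[OF k] eq)
qed

lemma smooth_fun_on_local:
  assumes "\<And>p. p \<in> U \<Longrightarrow> \<exists>V. open V \<and> p \<in> V \<and> smooth_fun_on C V f"
  shows "smooth_fun_on C U f"
proof (rule smooth_fun_onI, rule smooth_on_local)
  fix k x assume k: "k \<in> C" and "x \<in> snd k ` (fst k \<inter> U)"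
  then obtain p where p: "p \<in> fst k" "p \<in> U" "x = snd k p"
    by auto
  then obtain V where V: "open V" "p \<in> V" "smooth_fun_on C V f"
    using assms by blast
  show "\<exists>T. open T \<and> x \<in> T \<and> smooth_on T (\<lambda>x. f (chart_inv k x))"
    using chart_image_open[OF k V(1)] smooth_fun_on_chart[OF V(3) k] p V(2) by blast
qed

lemma smooth_fun_on_subset:
  assumes "smooth_fun_on C V f" "U \<subseteq> V"
  shows "smooth_fun_on C U f"
proof (rule smooth_fun_onI)
  fix k assume "k \<in> C"
  then show "smooth_on (snd k ` (fst k \<inter> U)) (\<lambda>x. f (chart_inv k x))"
    by (rule smooth_on_subset[OF smooth_fun_on_chart[OF assms(1)]]) (use assms(2) in auto)
qed

lemma smooth_fun_on_const: "smooth_fun_on C U (\<lambda>p. c)"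
  by (rule smooth_fun_onI) (rule smooth_on_const)

lemma smooth_fun_on_add:
  "open U \<Longrightarrow> smooth_fun_on C U f \<Longrightarrow> smooth_fun_on C U g \<Longrightarrow> smooth_fun_on C U (\<lambda>p. f p + g p)"
  by (rule smooth_fun_onI, intro smooth_on_add chart_image_open smooth_fun_on_chart)

lemma smooth_fun_on_uminus: "open U \<Longrightarrow> smooth_fun_on C U f \<Longrightarrow> smooth_fun_on C U (\<lambda>p. - f p)"
  by (rule smooth_fun_onI, intro smooth_on_uminus chart_image_open smooth_fun_on_chart)

lemma smooth_fun_on_diff:
  "open U \<Longrightarrow> smooth_fun_on C U f \<Longrightarrow> smooth_fun_on C U g \<Longrightarrow> smooth_fun_on C U (\<lambda>p. f p - g p)"
  using smooth_fun_on_add[of U f "\<lambda>p. - g p"] smooth_fun_on_uminus[of U g] by simp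

lemma smooth_fun_on_scaleR:
  "open U \<Longrightarrow> smooth_fun_on C U f \<Longrightarrow> smooth_fun_on C U g \<Longrightarrow> smooth_fun_on C U (\<lambda>p. f p *\<^sub>R g p)"
  by (rule smooth_fun_onI, intro smooth_on_scaleR chart_image_open smooth_fun_on_chart)

lemma smooth_fun_on_mult:
  fixes f g :: "'m \<Rightarrow> real"
  shows "open U \<Longrightarrow> smooth_fun_on C U f \<Longrightarrow> smooth_fun_on C U g \<Longrightarrow> smooth_fun_on C U (\<lambda>p. f p * g p)"
  using smooth_fun_on_scaleR[of U f g] by simp

lemma smooth_fun_on_inner:
  "open U \<Longrightarrow> smooth_fun_on C U f \<Longrightarrow> smooth_fun_on C U g \<Longrightarrow> smooth_fun_on C U (\<lambda>p. f p \<bullet> g p)"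
  by (rule smooth_fun_onI, intro smooth_on_inner chart_image_open smooth_fun_on_chart)

lemma smooth_fun_on_sum:
  "open U \<Longrightarrow> (\<And>i. i \<in> I \<Longrightarrow> smooth_fun_on C U (f i)) \<Longrightarrow> smooth_fun_on C U (\<lambda>p. \<Sum>i\<in>I. f i p)"
  by (rule smooth_fun_onI, intro smooth_on_sum chart_image_open smooth_fun_on_chart) auto

lemma smooth_fun_on_inverse:
  fixes f :: "'m \<Rightarrow> real"
  assumes U: "open U" and f: "smooth_fun_on C U f" and nz: "\<And>p. p \<in> U \<Longrightarrow> f p \<noteq> 0"
  shows "smooth_fun_on C U (\<lambda>p. inverse (f p))"
  by (rule smooth_fun_onI, intro smooth_on_inverse chart_image_open smooth_fun_on_chart U f, assumption+)
    (rule nz[OF chart_inv_mem])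

lemma smooth_fun_on_linear_inverse:
  fixes G :: "'m \<Rightarrow> 'f::real_inner \<Rightarrow> 'f"
  assumes fd: "finite_dim TYPE('f)" and U: "open U" and G: "\<And>w. smooth_fun_on C U (\<lambda>p. G p w)"
    and lin: "\<And>p. p \<in> U \<Longrightarrow> linear (G p) \<and> bij (G p)"
  shows "smooth_fun_on C U (\<lambda>p. inv (G p) w)"
  by (rule smooth_fun_onI, intro smooth_on_linear_inverse[OF fd] chart_image_open smooth_fun_on_chart U G, assumption+)
    (rule lin[OF chart_inv_mem])

section \<open>Cutting off by bump functions\<close>

text \<open>Compactness of closed balls and the Hausdorff property make the support closed in the manifold.\<close>

lemma smooth_bump_on_manifold:
  assumes U: "open U" and p: "p \<in> U"
  obtains \<beta> :: "'m \<Rightarrow> real" and K where "smooth_fun_on C UNIV \<beta>" "\<beta> p \<noteq> 0" "closed K" "K \<subseteq> U"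
    "\<And>q. q \<notin> K \<Longrightarrow> \<beta> q = 0"
proof -
  obtain k where k: "k \<in> C" "p \<in> fst k"
    by (rule chart_exists)
  have "snd k p \<in> snd k ` (fst k \<inter> U)"
    using k p by auto
  then obtain r where r: "r > 0" "cball (snd k p) r \<subseteq> snd k ` (fst k \<inter> U)"
    using chart_image_open[OF k(1) U] open_contains_cball by blast
  obtain g :: "'e \<Rightarrow> real" where g: "smooth_on UNIV g" "g (snd k p) \<noteq> 0"
    "\<And>x. r \<le> dist (snd k p) x \<Longrightarrow> g x = 0"
    using smooth_bump[OF r(1), of "snd k p"] by metis
  define K where "K = chart_inv k ` cball (snd k p) r"
  define \<beta> where "\<beta> q = (if q \<in> fst k then g (snd k q) else 0)" for q
  have "continuous_on (snd k ` fst k) (chart_inv k)"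
    using chart_homeomorphism[OF k(1)] unfolding homeomorphism_def by simp
  then have "compact K"
    unfolding K_def using r(2)
    by (intro compact_continuous_image compact_cball_finite_dim[OF finite_dim_model])
      (auto intro: continuous_on_subset)
  then have K: "closed K"
    by (rule compact_imp_closed)
  have KU: "K \<subseteq> fst k \<inter> U"
    unfolding K_def using r(2) chart_inv_chart[OF k(1)] by force
  have off: "\<beta> q = 0" if "q \<notin> K" for q
  proof (cases "q \<in> fst k")
    case True
    then have "q = chart_inv k (snd k q)"
      using chart_inv_chart[OF k(1)] by simp
    then have "\<not> dist (snd k p) (snd k q) \<le> r"
      using that unfolding K_def by auto
    then show ?thesis
      using g(3) by (simp add: \<beta>_def)
  qed (simp add: \<beta>_def)
  have on: "smooth_fun_on C (fst k) \<beta>"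
  proof (rule smooth_fun_on_cong[OF chart_domain_open[OF k(1)], of "\<lambda>q. g (snd k q)"])
    show "smooth_fun_on C (fst k) (\<lambda>q. g (snd k q))"
    proof (rule smooth_fun_onI)
      fix l assume l: "l \<in> C"
      show "smooth_on (snd l ` (fst l \<inter> fst k)) (\<lambda>x. g (snd k (chart_inv l x)))"
        using smooth_on_compose[OF finite_dim_model chart_image_open[OF l chart_domain_open[OF k(1)]]
            open_UNIV smooth_transition[OF l k(1)] g(1)] by simp
    qed
  qed (simp add: \<beta>_def)
  have out: "smooth_fun_on C (- K) \<beta>"
    by (rule smooth_fun_on_cong[OF _ smooth_fun_on_const[of _ 0]]) (use K off in auto)
  \<comment> \<open>Smoothness is local, and the open sets \<open>fst k\<close> and
    \<open>- K\<close> cover the manifold because \<open>K\<close> lies in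
    \<open>fst k\<close>.\<close>
  have "smooth_fun_on C UNIV \<beta>"
  proof (rule smooth_fun_on_local)
    fix q
    show "\<exists>V. open V \<and> q \<in> V \<and> smooth_fun_on C V \<beta>"
      using on out K KU chart_domain_open[OF k(1)] by (cases "q \<in> K") (auto simp: open_Compl)
  qed
  then show ?thesis
    using that[of \<beta> K] K KU off g(2) k(2) by (auto simp: \<beta>_def)
qed

text \<open>Extension by zero of a function known only on the overlap of U and V, as needed for the
  coordinates of a cut-off section in another trivialization. The overlap and the complement of K
  are open and cover V.\<close>

lemma smooth_fun_on_extend:
  fixes f :: "'m \<Rightarrow> 'b::real_normed_vector"
  assumes U: "open U" and V: "open V" and K: "closed K" "K \<subseteq> U" and \<beta>: "smooth_fun_on C UNIV \<beta>"
    and off: "\<And>q. q \<notin> K \<Longrightarrow> \<beta> q = 0" and f: "smooth_fun_on C (U \<inter> V) f"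
  shows "smooth_fun_on C V (\<lambda>q. if q \<in> U then \<beta> q *\<^sub>R f q else 0)" (is "smooth_fun_on C V ?g")
proof (rule smooth_fun_on_local)
  fix q assume q: "q \<in> V"
  have on: "smooth_fun_on C (U \<inter> V) ?g"
    by (rule smooth_fun_on_cong[of _ "\<lambda>q. \<beta> q *\<^sub>R f q"])
      (use U V f \<beta> in \<open>auto intro!: smooth_fun_on_scaleR intro: smooth_fun_on_subset\<close>)
  have out: "smooth_fun_on C (- K) ?g"
    by (rule smooth_fun_on_cong[OF _ smooth_fun_on_const[of _ 0]]) (use K off in auto)
  show "\<exists>W. open W \<and> q \<in> W \<and> smooth_fun_on C W ?g"
  proof (cases "q \<in> K")
    case True
    then show ?thesis
      using on U V K q by (intro exI[of _ "U \<inter> V"]) auto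
  next
    case False
    then show ?thesis
      using out K by (intro exI[of _ "- K"]) auto
  qed
qed

lemma smooth_fun_continuous:
  assumes f: "smooth_fun_on C UNIV f"
  shows "continuous_on UNIV f"
proof (rule continuous_at_imp_continuous_on, rule ballI)
  fix p
  obtain k where k: "k \<in> C" "p \<in> fst k"
    by (rule chart_exists)
  have "continuous_on (snd k ` fst k) (\<lambda>x. f (chart_inv k x))"
    using smooth_fun_on_chart[OF f k(1)] unfolding smooth_on_def by (metis C_k_on.simps(1) inf_top_right)
  moreover have "continuous_on (fst k) (snd k)"
    using chart_homeomorphism[OF k(1)] unfolding homeomorphism_def by simp
  ultimately have "continuous_on (fst k) (\<lambda>q. f (chart_inv k (snd k q)))"
    by (rule continuous_on_compose2) simp
  then have "continuous_on (fst k) f"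
    by (simp add: chart_inv_chart[OF k(1)] cong: continuous_on_cong)
  then show "isCont f p"
    using chart_domain_open[OF k(1)] k(2) continuous_on_eq_continuous_at by blast
qed

lemma smooth_fun_has_derivative:
  assumes "smooth_fun_on C UNIV f" "k \<in> C" "p \<in> fst k"
  shows "((f \<circ> chart_inv k) has_derivative frechet_derivative (f \<circ> chart_inv k) (at (snd k p))) (at (snd k p))"
  using smooth_fun_on_chart[OF assms(1,2)] assms(3) by (intro smooth_on_has_derivative[of "snd k ` fst k"]) (auto simp: o_def)

section \<open>Tangent vectors as derivations\<close>

text \<open>One chart serves all X and f at p, so linearity and the Leibniz rule can be read off in
  it without comparing charts.\<close>

lemma tangent_deriv_some_chart:
  obtains k where "k \<in> C" "p \<in> fst k"
    "\<And>X f. tangent_deriv C p X f = frechet_derivative (f \<circ> chart_inv k) (at (snd k p)) (X k)"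
proof
  let ?k = "SOME k. k \<in> C \<and> p \<in> fst k"
  have "?k \<in> C \<and> p \<in> fst ?k"
    by (rule someI_ex) (use chart_exists[of p] in blast)
  then show "?k \<in> C" "p \<in> fst ?k" by auto
  show "tangent_deriv C p X f = frechet_derivative (f \<circ> chart_inv ?k) (at (snd ?k p)) (X ?k)" for X f
    by (simp add: tangent_deriv_def Let_def)
qed

text \<open>The chain rule for the transition map produces exactly the factor by which X passes from
  one chart to the other. Since \<open>tangent_deriv\<close> chooses its chart anew at each point,
  smooth dependence on the point requires this freedom to keep one chart fixed.\<close>

lemma tangent_deriv_chart:
  assumes f: "smooth_fun_on C UNIV f" and X: "X \<in> tangent_space C p" and l: "l \<in> C" "p \<in> fst l"
  shows "tangent_deriv C p X f = frechet_derivative (f \<circ> chart_inv l) (at (snd l p)) (X l)"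
proof -
  obtain k where k: "k \<in> C" "p \<in> fst k"
    "\<And>X f. tangent_deriv C p X f = frechet_derivative (f \<circ> chart_inv k) (at (snd k p)) (X k)"
    using tangent_deriv_some_chart[of p] by metis
  let ?S = "snd k ` (fst k \<inter> fst l)"
  have S: "open ?S" "snd k p \<in> ?S"
    using chart_image_open[OF k(1) chart_domain_open[OF l(1)]] k l by auto
  let ?\<tau> = "snd l \<circ> chart_inv k"
  have "(?\<tau> has_derivative frechet_derivative ?\<tau> (at (snd k p))) (at (snd k p))"
    using smooth_on_has_derivative[OF smooth_transition[OF k(1) l(1)] S(2)] .
  moreover have "?\<tau> (snd k p) = snd l p"
    using chart_inv_chart[OF k(1,2)] by simp
  ultimately have "((f \<circ> chart_inv l) \<circ> ?\<tau> has_derivative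
      frechet_derivative (f \<circ> chart_inv l) (at (snd l p)) \<circ> frechet_derivative ?\<tau> (at (snd k p))) (at (snd k p))"
    using smooth_fun_has_derivative[OF f l] by (intro diff_chain_at) simp_all
  then have "((f \<circ> chart_inv k) has_derivative
      frechet_derivative (f \<circ> chart_inv l) (at (snd l p)) \<circ> frechet_derivative ?\<tau> (at (snd k p))) (at (snd k p))"
    by (rule has_derivative_transform_within_open[OF _ S])
      (auto simp: chart_inv_chart k(1) l(1))
  then have "frechet_derivative (f \<circ> chart_inv k) (at (snd k p)) =
      frechet_derivative (f \<circ> chart_inv l) (at (snd l p)) \<circ> frechet_derivative ?\<tau> (at (snd k p))"
    using frechet_derivative_at by metis
  moreover have "X l = frechet_derivative ?\<tau> (at (snd k p)) (X k)"
    using X k(1,2) l unfolding tangent_space_def by blast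
  ultimately show ?thesis
    using k(3) by simp
qed

lemma smooth_tangent_deriv:
  assumes f: "smooth_fun_on C UNIV f" and X: "\<And>p. X p \<in> tangent_space C p"
    and "\<And>k. k \<in> C \<Longrightarrow> smooth_fun_on C (fst k) (\<lambda>p. X p k)"
  shows "smooth_fun_on C UNIV (\<lambda>p. tangent_deriv C p (X p) f)"
proof (rule smooth_fun_onI)
  fix k assume k: "k \<in> C"
  let ?S = "snd k ` (fst k \<inter> UNIV)"
  have S: "open ?S"
    using chart_image_open[OF k open_UNIV] .
  have "smooth_on ?S (\<lambda>x. frechet_derivative (f \<circ> chart_inv k) (at x) (X (chart_inv k x) k))"
    using smooth_fun_on_chart[OF f k] smooth_fun_on_chart[OF assms(3)[OF k] k]
    by (intro smooth_on_derivative_along[OF finite_dim_model S]) (simp_all add: o_def)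
  then show "smooth_on ?S (\<lambda>x. tangent_deriv C (chart_inv k x) (X (chart_inv k x)) f)"
    by (rule smooth_on_cong[OF S])
      (auto simp: chart_inv_chart[OF k] tangent_deriv_chart[OF f X k])
qed

lemma tangent_deriv_add_vector:
  assumes f: "smooth_fun_on C UNIV f"
  shows "tangent_deriv C p (\<lambda>k. X k + Y k) f = tangent_deriv C p X f + tangent_deriv C p Y f"
proof -
  obtain k where k: "k \<in> C" "p \<in> fst k"
    "\<And>X f. tangent_deriv C p X f = frechet_derivative (f \<circ> chart_inv k) (at (snd k p)) (X k)"
    using tangent_deriv_some_chart[of p] by metis
  show ?thesis
    using linear_add[OF has_derivative_linear[OF smooth_fun_has_derivative[OF f k(1,2)]]] k(3) by simp
qed

lemma tangent_deriv_scale_vector: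
  assumes f: "smooth_fun_on C UNIV f"
  shows "tangent_deriv C p (\<lambda>k. c *\<^sub>R X k) f = c * tangent_deriv C p X f"
proof -
  obtain k where k: "k \<in> C" "p \<in> fst k"
    "\<And>X f. tangent_deriv C p X f = frechet_derivative (f \<circ> chart_inv k) (at (snd k p)) (X k)"
    using tangent_deriv_some_chart[of p] by metis
  show ?thesis
    using linear_cmul[OF has_derivative_linear[OF smooth_fun_has_derivative[OF f k(1,2)]]] k(3) by simp
qed

lemma tangent_deriv_add:
  assumes f: "smooth_fun_on C UNIV f" and g: "smooth_fun_on C UNIV g"
  shows "tangent_deriv C p X (\<lambda>q. f q + g q) = tangent_deriv C p X f + tangent_deriv C p X g"
proof -
  obtain k where k: "k \<in> C" "p \<in> fst k"
    "\<And>X f. tangent_deriv C p X f = frechet_derivative (f \<circ> chart_inv k) (at (snd k p)) (X k)"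
    using tangent_deriv_some_chart[of p] by metis
  have "((\<lambda>q. f q + g q) \<circ> chart_inv k has_derivative
      (\<lambda>v. frechet_derivative (f \<circ> chart_inv k) (at (snd k p)) v + frechet_derivative (g \<circ> chart_inv k) (at (snd k p)) v))
      (at (snd k p))"
    using has_derivative_add[OF smooth_fun_has_derivative[OF f k(1,2)] smooth_fun_has_derivative[OF g k(1,2)]]
    by (simp add: o_def)
  from fun_cong[OF frechet_derivative_at[OF this], of "X k"] show ?thesis
    by (simp only: k(3))
qed

lemma tangent_deriv_mult:
  assumes f: "smooth_fun_on C UNIV f" and g: "smooth_fun_on C UNIV g"
  shows "tangent_deriv C p X (\<lambda>q. f q * g q) = f p * tangent_deriv C p X g + tangent_deriv C p X f * g p"
proof -
  obtain k where k: "k \<in> C" "p \<in> fst k"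
    "\<And>X f. tangent_deriv C p X f = frechet_derivative (f \<circ> chart_inv k) (at (snd k p)) (X k)"
    using tangent_deriv_some_chart[of p] by metis
  have "((\<lambda>q. f q * g q) \<circ> chart_inv k has_derivative
      (\<lambda>v. f p * frechet_derivative (g \<circ> chart_inv k) (at (snd k p)) v
        + frechet_derivative (f \<circ> chart_inv k) (at (snd k p)) v * g p)) (at (snd k p))"
    using has_derivative_mult[OF smooth_fun_has_derivative[OF f k(1,2)] smooth_fun_has_derivative[OF g k(1,2)]]
    by (simp add: o_def chart_inv_chart[OF k(1,2)])
  from fun_cong[OF frechet_derivative_at[OF this], of "X k"] show ?thesis
    by (simp only: k(3))
qed

end

section \<open>Sections of vector bundles\<close>

locale smooth_bundle =
  fixes A :: "('m::{t2_space, second_countable_topology}, 'e::real_inner, 'a::real_vector, 'f::real_inner, 'z)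
    vector_bundle_scheme"
  assumes is_bundle: "vector_bundle A"
begin

sublocale manifold "charts A"
  using is_bundle unfolding vector_bundle_def by unfold_locales auto

section \<open>Local trivializations\<close>

lemma finite_dim_fibre: "finite_dim TYPE('f)"
  using is_bundle unfolding vector_bundle_def by auto

lemma subspace_fib: "subspace (fib A p)"
  using is_bundle unfolding vector_bundle_def by auto

lemma triv_exists: obtains U \<phi> where "(U, \<phi>) \<in> trivs A" "p \<in> U"
proof -
  have "(\<Union>(U, \<phi>)\<in>trivs A. U) = UNIV"
    using is_bundle unfolding vector_bundle_def by simp
  then have "p \<in> (\<Union>(U, \<phi>)\<in>trivs A. U)"
    by (simp only: UNIV_I)
  then show ?thesis
    using that by auto
qed

lemma triv_open: "(U, \<phi>) \<in> trivs A \<Longrightarrow> open U"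
  using is_bundle unfolding vector_bundle_def by auto

lemma triv_linear: "(U, \<phi>) \<in> trivs A \<Longrightarrow> p \<in> U \<Longrightarrow> linear_map_on (fib A p) (\<phi> p)"
  using is_bundle unfolding vector_bundle_def by auto

lemma triv_bij: "(U, \<phi>) \<in> trivs A \<Longrightarrow> p \<in> U \<Longrightarrow> bij_betw (\<phi> p) (fib A p) UNIV"
  using is_bundle unfolding vector_bundle_def by auto

lemma smooth_triv_transition:
  "(U, \<phi>) \<in> trivs A \<Longrightarrow> (V, \<psi>) \<in> trivs A \<Longrightarrow>
    smooth_fun_on (charts A) (U \<inter> V) (\<lambda>p. \<psi> p (lift A \<phi> p w))"
  using is_bundle unfolding vector_bundle_def by blast

lemma lift_in_fib: "(U, \<phi>) \<in> trivs A \<Longrightarrow> p \<in> U \<Longrightarrow> lift A \<phi> p w \<in> fib A p"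
  using triv_bij unfolding bij_betw_def by (metis UNIV_I inv_into_into)

lemma triv_lift: "(U, \<phi>) \<in> trivs A \<Longrightarrow> p \<in> U \<Longrightarrow> \<phi> p (lift A \<phi> p w) = w"
  using triv_bij unfolding bij_betw_def by (metis UNIV_I f_inv_into_f)

lemma lift_triv: "(U, \<phi>) \<in> trivs A \<Longrightarrow> p \<in> U \<Longrightarrow> v \<in> fib A p \<Longrightarrow> lift A \<phi> p (\<phi> p v) = v"
  using triv_bij unfolding bij_betw_def by (metis inv_into_f_f)

lemma lift_eqI: "(U, \<phi>) \<in> trivs A \<Longrightarrow> p \<in> U \<Longrightarrow> v \<in> fib A p \<Longrightarrow> \<phi> p v = w \<Longrightarrow> lift A \<phi> p w = v"
  using lift_triv by blast

lemma linear_lift: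
  assumes "(U, \<phi>) \<in> trivs A" "p \<in> U"
  shows "linear (lift A \<phi> p)"
proof (rule linearI)
  note lin = triv_linear[OF assms, unfolded linear_map_on_def]
  show "lift A \<phi> p (u + w) = lift A \<phi> p u + lift A \<phi> p w" for u w
    by (rule lift_eqI[OF assms]) (use lin lift_in_fib[OF assms] triv_lift[OF assms] subspace_add[OF subspace_fib] in auto)
  show "lift A \<phi> p (c *\<^sub>R w) = c *\<^sub>R lift A \<phi> p w" for c w
    by (rule lift_eqI[OF assms]) (use lin lift_in_fib[OF assms] triv_lift[OF assms] subspace_scale[OF subspace_fib] in auto)
qed

lemma linear_on_lift:
  assumes "(U, \<phi>) \<in> trivs A" "p \<in> U" "linear_map_on (fib A p) g"
  shows "linear (\<lambda>w. g (lift A \<phi> p w))"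
proof (rule linearI)
  note lin = assms(3)[unfolded linear_map_on_def] and mem = lift_in_fib[OF assms(1,2)]
  show "g (lift A \<phi> p (u + w)) = g (lift A \<phi> p u) + g (lift A \<phi> p w)" for u w
    using lin mem linear_add[OF linear_lift[OF assms(1,2)]] by simp
  show "g (lift A \<phi> p (c *\<^sub>R w)) = c *\<^sub>R g (lift A \<phi> p w)" for c w
    using lin mem linear_cmul[OF linear_lift[OF assms(1,2)]] by simp
qed

lemma linear_on_expand:
  assumes "(U, \<phi>) \<in> trivs A" "p \<in> U" "linear_map_on (fib A p) g" "v \<in> fib A p" "frame E"
  shows "g v = (\<Sum>e\<in>E. (\<phi> p v \<bullet> e) *\<^sub>R g (lift A \<phi> p e))"
  using frame_linear[OF assms(5) linear_on_lift[OF assms(1-3)], of "\<phi> p v"] lift_triv[OF assms(1,2,4)] by simp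

section \<open>Smooth sections\<close>

lemma section_in_fib: "x \<in> sections A \<Longrightarrow> x p \<in> fib A p"
  unfolding sections_def by auto

lemma section_smooth:
  "x \<in> sections A \<Longrightarrow> (U, \<phi>) \<in> trivs A \<Longrightarrow> smooth_fun_on (charts A) U (\<lambda>p. \<phi> p (x p))"
  unfolding sections_def by auto

lemma sectionsI:
  assumes "\<And>p. x p \<in> fib A p"
    and "\<And>U \<phi>. (U, \<phi>) \<in> trivs A \<Longrightarrow> smooth_fun_on (charts A) U (\<lambda>p. \<phi> p (x p))"
  shows "x \<in> sections A"
  using assms unfolding sections_def by auto

text \<open>Smoothness of bundle data is postulated along lifts of fixed vectors. Expanding the
  section through a frame of the typical fibre transfers it to all sections; endomorphisms,
  covectors, bilinear forms and the anchor are handled in this way.\<close>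

lemma smooth_apply_section:
  assumes triv: "(U, \<phi>) \<in> trivs A" and V: "open V" "V \<subseteq> U"
    and lin: "\<And>p. p \<in> V \<Longrightarrow> linear_map_on (fib A p) (g p)"
    and g: "\<And>w. smooth_fun_on (charts A) V (\<lambda>p. g p (lift A \<phi> p w))"
    and x: "x \<in> sections A"
  shows "smooth_fun_on (charts A) V (\<lambda>p. g p (x p))"
proof -
  obtain E :: "'f set" where E: "frame E"
    using finite_dim_frame[OF finite_dim_fibre] .
  have "smooth_fun_on (charts A) V (\<lambda>p. \<Sum>e\<in>E. (\<phi> p (x p) \<bullet> e) *\<^sub>R g p (lift A \<phi> p e))"
    by (intro smooth_fun_on_sum smooth_fun_on_scaleR smooth_fun_on_inner smooth_fun_on_const V g
        smooth_fun_on_subset[OF section_smooth[OF x triv]])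
  then show ?thesis
    by (rule smooth_fun_on_cong[OF V(1)])
      (use linear_on_expand[OF triv _ lin section_in_fib[OF x] E, symmetric] V in blast)
qed

lemma sections_add:
  assumes "x \<in> sections A" "y \<in> sections A"
  shows "(\<lambda>p. x p + y p) \<in> sections A"
proof (rule sectionsI)
  show "x p + y p \<in> fib A p" for p
    using assms by (simp add: section_in_fib subspace_add[OF subspace_fib])
  fix U \<phi> assume triv: "(U, \<phi>) \<in> trivs A"
  have "smooth_fun_on (charts A) U (\<lambda>p. \<phi> p (x p) + \<phi> p (y p))"
    by (intro smooth_fun_on_add triv_open[OF triv] section_smooth[OF _ triv] assms)
  then show "smooth_fun_on (charts A) U (\<lambda>p. \<phi> p (x p + y p))"
    by (rule smooth_fun_on_cong[OF triv_open[OF triv]])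
      (use triv_linear[OF triv] assms in \<open>auto simp: linear_map_on_def section_in_fib\<close>)
qed

lemma sections_scale:
  assumes f: "smooth_fun A f" and x: "x \<in> sections A"
  shows "(\<lambda>p. f p *\<^sub>R x p) \<in> sections A"
proof (rule sectionsI)
  show "f p *\<^sub>R x p \<in> fib A p" for p
    using x by (simp add: section_in_fib subspace_scale[OF subspace_fib])
  fix U \<phi> assume triv: "(U, \<phi>) \<in> trivs A"
  have "smooth_fun_on (charts A) U (\<lambda>p. f p *\<^sub>R \<phi> p (x p))"
    by (intro smooth_fun_on_scaleR triv_open[OF triv] section_smooth[OF _ triv] x
        smooth_fun_on_subset[OF f subset_UNIV])
  then show "smooth_fun_on (charts A) U (\<lambda>p. \<phi> p (f p *\<^sub>R x p))"
    by (rule smooth_fun_on_cong[OF triv_open[OF triv]])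
      (use triv_linear[OF triv] x in \<open>auto simp: linear_map_on_def section_in_fib\<close>)
qed

lemma sections_zero: "(\<lambda>p. 0) \<in> sections A"
proof (rule sectionsI)
  show "0 \<in> fib A p" for p
    by (rule subspace_0[OF subspace_fib])
  fix U \<phi> assume triv: "(U, \<phi>) \<in> trivs A"
  show "smooth_fun_on (charts A) U (\<lambda>p. \<phi> p 0)"
  proof (rule smooth_fun_on_cong[OF triv_open[OF triv] smooth_fun_on_const[of U 0]])
    fix p assume "p \<in> U"
    then show "0 = \<phi> p 0"
      using triv_linear[OF triv] subspace_0[OF subspace_fib] unfolding linear_map_on_def
      by (metis scaleR_zero_left)
  qed
qed

lemma sections_sum:
  assumes "\<And>i. i \<in> I \<Longrightarrow> x i \<in> sections A"
  shows "(\<lambda>p. \<Sum>i\<in>I. x i p) \<in> sections A"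
  using assms by (induction I rule: infinite_finite_induct) (auto intro: sections_zero sections_add)

lemma sections_diff:
  assumes "x \<in> sections A" "y \<in> sections A"
  shows "(\<lambda>p. x p - y p) \<in> sections A"
  using sections_add[OF assms(1) sections_scale[OF smooth_fun_on_const[of _ "-1"] assms(2)]] by simp

lemma endo_in_fib: "bundle_endo A N \<Longrightarrow> v \<in> fib A p \<Longrightarrow> N p v \<in> fib A p"
  unfolding bundle_endo_def by blast

lemma endo_linear: "bundle_endo A N \<Longrightarrow> linear_map_on (fib A p) (N p)"
  unfolding bundle_endo_def by blast

lemma app_section:
  assumes N: "bundle_endo A N" and x: "x \<in> sections A"
  shows "app N x \<in> sections A"
proof (rule sectionsI)
  show "app N x p \<in> fib A p" for p
    using endo_in_fib[OF N section_in_fib[OF x]] by (simp add: app_def)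
  fix U \<phi> assume triv: "(U, \<phi>) \<in> trivs A"
  show "smooth_fun_on (charts A) U (\<lambda>p. \<phi> p (app N x p))"
    unfolding app_def
  proof (rule smooth_apply_section[OF triv triv_open[OF triv] order_refl _ _ x, of "\<lambda>p v. \<phi> p (N p v)"])
    show "linear_map_on (fib A p) (\<lambda>v. \<phi> p (N p v))" if "p \<in> U" for p
      using triv_linear[OF triv that] endo_linear[OF N, of p] endo_in_fib[OF N]
      unfolding linear_map_on_def by auto
    show "smooth_fun_on (charts A) U (\<lambda>p. \<phi> p (N p (lift A \<phi> p w)))" for w
      using N triv unfolding bundle_endo_def by fastforce
  qed
qed

section \<open>Dual sections\<close>

lemma dual_section_in_dual_fib: "\<alpha> \<in> dual_sections A \<Longrightarrow> \<alpha> p \<in> dual_fib A p"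
  unfolding dual_sections_def by auto

lemma dual_section_smooth:
  "\<alpha> \<in> dual_sections A \<Longrightarrow> (U, \<phi>) \<in> trivs A \<Longrightarrow> smooth_fun_on (charts A) U (\<lambda>p. \<alpha> p (lift A \<phi> p w))"
  unfolding dual_sections_def by auto

lemma dual_fib_linear: "\<xi> \<in> dual_fib A p \<Longrightarrow> linear_map_on (fib A p) \<xi>"
  and dual_fib_outside: "\<xi> \<in> dual_fib A p \<Longrightarrow> v \<notin> fib A p \<Longrightarrow> \<xi> v = 0"
  unfolding dual_fib_def by auto

lemma dual_fib_add: "\<xi> \<in> dual_fib A p \<Longrightarrow> \<eta> \<in> dual_fib A p \<Longrightarrow> (\<lambda>v. \<xi> v + \<eta> v) \<in> dual_fib A p"
  unfolding dual_fib_def linear_map_on_def by (auto simp: algebra_simps)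

lemma dual_fib_scale: "\<xi> \<in> dual_fib A p \<Longrightarrow> (\<lambda>v. c * \<xi> v) \<in> dual_fib A p"
  unfolding dual_fib_def linear_map_on_def by (auto simp: algebra_simps)

lemma dual_fib_zero: "(\<lambda>v. 0) \<in> dual_fib A p"
  unfolding dual_fib_def linear_map_on_def by auto

lemma dual_fib_sum:
  assumes "\<And>i. i \<in> I \<Longrightarrow> \<xi> i \<in> dual_fib A p"
  shows "(\<lambda>v. \<Sum>i\<in>I. \<xi> i v) \<in> dual_fib A p"
  using assms by (induction I rule: infinite_finite_induct) (auto intro: dual_fib_zero dual_fib_add)

lemma dual_fib_eqI:
  assumes "\<xi> \<in> dual_fib A p" "\<eta> \<in> dual_fib A p" "\<And>v. v \<in> fib A p \<Longrightarrow> \<xi> v = \<eta> v"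
  shows "\<xi> = \<eta>"
  using assms dual_fib_outside by (metis ext)

lemma dual_sectionsI:
  assumes "\<And>p. \<alpha> p \<in> dual_fib A p"
    and "\<And>U \<phi> w. (U, \<phi>) \<in> trivs A \<Longrightarrow> smooth_fun_on (charts A) U (\<lambda>p. \<alpha> p (lift A \<phi> p w))"
  shows "\<alpha> \<in> dual_sections A"
  using assms unfolding dual_sections_def by auto

lemma dual_sections_add:
  assumes "\<alpha> \<in> dual_sections A" "\<beta> \<in> dual_sections A"
  shows "(\<lambda>p v. \<alpha> p v + \<beta> p v) \<in> dual_sections A"
  by (rule dual_sectionsI)
    (intro dual_fib_add dual_section_in_dual_fib assms smooth_fun_on_add triv_open dual_section_smooth; assumption)+

lemma dual_sections_diff:
  assumes "\<alpha> \<in> dual_sections A" "\<beta> \<in> dual_sections A"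
  shows "(\<lambda>p v. \<alpha> p v - \<beta> p v) \<in> dual_sections A"
proof -
  have "(\<lambda>v. \<alpha> p v - \<beta> p v) \<in> dual_fib A p" for p
    using dual_fib_add[OF dual_section_in_dual_fib[OF assms(1)] dual_fib_scale[of _ _ "-1", OF dual_section_in_dual_fib[OF assms(2)]]]
    by simp
  then show ?thesis
    by (rule dual_sectionsI)
      (intro smooth_fun_on_diff triv_open dual_section_smooth assms; assumption)
qed

lemma smooth_pair:
  assumes "\<alpha> \<in> dual_sections A" "x \<in> sections A"
  shows "smooth_fun A (pair \<alpha> x)"
proof (rule smooth_fun_on_local)
  fix p
  obtain U \<phi> where triv: "(U, \<phi>) \<in> trivs A" "p \<in> U"
    by (rule triv_exists)
  have "smooth_fun_on (charts A) U (pair \<alpha> x)"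
    unfolding pair_def
    by (rule smooth_apply_section[OF triv(1) triv_open[OF triv(1)] order_refl _ _ assms(2)])
      (use dual_section_in_dual_fib[OF assms(1)] dual_section_smooth[OF assms(1) triv(1)] dual_fib_linear in blast)+
  then show "\<exists>V. open V \<and> p \<in> V \<and> smooth_fun_on (charts A) V (pair \<alpha> x)"
    using triv triv_open by blast
qed

section \<open>Global sections from local ones\<close>

text \<open>Trivializing sections cut off to global ones. A single b serves every w, and its
  vanishing off a closed K inside U is kept in the statement so that coordinate functions can be cut
  off by the same b.\<close>

lemma local_sections:
  assumes triv: "(U, \<phi>) \<in> trivs A" and p: "p \<in> U"
  shows "\<exists>(b :: 'm \<Rightarrow> real) K. smooth_fun A b \<and> b p \<noteq> 0 \<and> closed K \<and> K \<subseteq> U \<and> (\<forall>q. q \<notin> K \<longrightarrow> b q = 0) \<and>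
    (\<forall>w. (\<lambda>q. if q \<in> U then b q *\<^sub>R lift A \<phi> q w else 0) \<in> sections A)"
proof -
  obtain b :: "'m \<Rightarrow> real" and K where b: "smooth_fun A b" "b p \<noteq> 0" "closed K" "K \<subseteq> U"
    "\<And>q. q \<notin> K \<Longrightarrow> b q = 0"
    using smooth_bump_on_manifold[OF triv_open[OF triv] p] by metis
  have "(\<lambda>q. if q \<in> U then b q *\<^sub>R lift A \<phi> q w else 0) \<in> sections A" for w
  proof (rule sectionsI)
    show "(if q \<in> U then b q *\<^sub>R lift A \<phi> q w else 0) \<in> fib A q" for q
      using lift_in_fib[OF triv] subspace_scale[OF subspace_fib] subspace_0[OF subspace_fib] by auto
    fix V \<psi> assume V: "(V, \<psi>) \<in> trivs A"
    have "smooth_fun_on (charts A) V (\<lambda>q. if q \<in> U then b q *\<^sub>R \<psi> q (lift A \<phi> q w) else 0)"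
      by (rule smooth_fun_on_extend[OF triv_open[OF triv] triv_open[OF V] b(3,4,1,5)
            smooth_triv_transition[OF triv V]])
    then show "smooth_fun_on (charts A) V (\<lambda>q. \<psi> q (if q \<in> U then b q *\<^sub>R lift A \<phi> q w else 0))"
    proof (rule smooth_fun_on_cong[OF triv_open[OF V]])
      fix q assume "q \<in> V"
      note lin = triv_linear[OF V this, unfolded linear_map_on_def]
      have "\<psi> q 0 = 0"
        using lin subspace_0[OF subspace_fib] by (metis scaleR_zero_left)
      then show "(if q \<in> U then b q *\<^sub>R \<psi> q (lift A \<phi> q w) else 0) =
          \<psi> q (if q \<in> U then b q *\<^sub>R lift A \<phi> q w else 0)"
        using lin lift_in_fib[OF triv] by auto
    qed
  qed
  then show ?thesis
    using b by blast
qed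

lemma section_through:
  assumes v: "v \<in> fib A p"
  obtains x where "x \<in> sections A" "x p = v"
proof -
  obtain U \<phi> where triv: "(U, \<phi>) \<in> trivs A" "p \<in> U"
    by (rule triv_exists)
  obtain b :: "'m \<Rightarrow> real" where b: "b p \<noteq> 0"
    "\<forall>w. (\<lambda>q. if q \<in> U then b q *\<^sub>R lift A \<phi> q w else 0) \<in> sections A"
    using local_sections[OF triv] by (elim exE conjE) blast
  \<comment> \<open>The cut-off changes the value at p by the factor b p, so the vector is divided
    by it beforehand.\<close>
  have "b p *\<^sub>R lift A \<phi> p (inverse (b p) *\<^sub>R \<phi> p v) = v"
    using b(1) lift_triv[OF triv v] linear_cmul[OF linear_lift[OF triv]] by simp
  then show ?thesis
    using that[OF b(2)[rule_format, of "inverse (b p) *\<^sub>R \<phi> p v"]] triv(2) by simp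
qed

lemma dual_section_eqI:
  assumes "\<alpha> \<in> dual_sections A" "\<beta> \<in> dual_sections A" "\<And>y. y \<in> sections A \<Longrightarrow> pair \<alpha> y = pair \<beta> y"
  shows "\<alpha> = \<beta>"
proof
  fix p
  show "\<alpha> p = \<beta> p"
  proof (rule dual_fib_eqI[OF dual_section_in_dual_fib[OF assms(1)] dual_section_in_dual_fib[OF assms(2)]])
    fix v assume "v \<in> fib A p"
    then obtain x where "x \<in> sections A" "x p = v"
      by (rule section_through)
    then show "\<alpha> p v = \<beta> p v"
      using fun_cong[OF assms(3)[of x], of p] by (simp add: pair_def)
  qed
qed

section \<open>Tensorial functionals and dual sections\<close>

definition tensorial :: "(('m \<Rightarrow> 'a) \<Rightarrow> 'm \<Rightarrow> real) \<Rightarrow> bool" where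
  "tensorial F \<longleftrightarrow>
     (\<forall>x\<in>sections A. smooth_fun A (F x)) \<and>
     (\<forall>x\<in>sections A. \<forall>y\<in>sections A. F (\<lambda>p. x p + y p) = (\<lambda>p. F x p + F y p)) \<and>
     (\<forall>f. smooth_fun A f \<longrightarrow> (\<forall>x\<in>sections A. F (\<lambda>p. f p *\<^sub>R x p) = (\<lambda>p. f p * F x p)))"

lemma tensorialD:
  assumes "tensorial F"
  shows "x \<in> sections A \<Longrightarrow> smooth_fun A (F x)"
    and "x \<in> sections A \<Longrightarrow> y \<in> sections A \<Longrightarrow> F (\<lambda>p. x p + y p) = (\<lambda>p. F x p + F y p)"
    and "smooth_fun A f \<Longrightarrow> x \<in> sections A \<Longrightarrow> F (\<lambda>p. f p *\<^sub>R x p) = (\<lambda>p. f p * F x p)"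
  using assms unfolding tensorial_def by auto

lemma tensorial_zero: "tensorial F \<Longrightarrow> F (\<lambda>p. 0) = (\<lambda>p. 0)"
  using tensorialD(3)[OF _ smooth_fun_on_const[of _ 0] sections_zero] by simp

lemma tensorial_sum:
  assumes F: "tensorial F" and "\<And>i. i \<in> I \<Longrightarrow> x i \<in> sections A"
  shows "F (\<lambda>p. \<Sum>i\<in>I. x i p) = (\<lambda>p. \<Sum>i\<in>I. F (x i) p)"
  using assms(2)
  by (induction I rule: infinite_finite_induct) (simp_all add: tensorial_zero[OF F] tensorialD(2)[OF F] sections_sum)

text \<open>Multiplication by b^2 makes x a finite combination of global sections with global
  coefficients: one factor b cuts off the coordinate function \<open>c e\<close>, the other the
  frame section \<open>s e\<close>. After applying F and evaluating at p, where all coordinates of x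
  vanish, b(p)^2 F(x)(p) = 0 remains.\<close>

lemma tensorial_local:
  assumes F: "tensorial F" and x: "x \<in> sections A" and xp: "x p = 0"
  shows "F x p = 0"
proof -
  obtain U \<phi> where triv: "(U, \<phi>) \<in> trivs A" "p \<in> U"
    by (rule triv_exists)
  obtain b :: "'m \<Rightarrow> real" and K where b: "smooth_fun A b" "b p \<noteq> 0" "closed K" "K \<subseteq> U"
    "\<forall>q. q \<notin> K \<longrightarrow> b q = 0"
    "\<forall>w. (\<lambda>q. if q \<in> U then b q *\<^sub>R lift A \<phi> q w else 0) \<in> sections A"
    using local_sections[OF triv] by (elim exE conjE) blast
  obtain E :: "'f set" where E: "frame E"
    using finite_dim_frame[OF finite_dim_fibre] .
  define s where "s e = (\<lambda>q. if q \<in> U then b q *\<^sub>R lift A \<phi> q e else 0)" for e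
  define c where "c e = (\<lambda>q. if q \<in> U then b q *\<^sub>R (\<phi> q (x q) \<bullet> e) else 0)" for e
  have s: "s e \<in> sections A" for e
    unfolding s_def by (rule b(6)[rule_format])
  have c: "smooth_fun A (c e)" for e
    unfolding c_def
    by (rule smooth_fun_on_extend[OF triv_open[OF triv(1)] open_UNIV b(3,4,1) b(5)[rule_format]])
      (auto intro!: smooth_fun_on_inner smooth_fun_on_const section_smooth[OF x triv(1)] triv_open[OF triv(1)])
  have bb: "smooth_fun A (\<lambda>q. b q * b q)"
    by (intro smooth_fun_on_mult open_UNIV b(1))
  have "(b q * b q) *\<^sub>R x q = (\<Sum>e\<in>E. c e q *\<^sub>R s e q)" for q
  proof (cases "q \<in> U")
    case True
    have "x q = lift A \<phi> q (\<phi> q (x q))"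
      using lift_triv[OF triv(1) True section_in_fib[OF x]] by simp
    also have "\<dots> = (\<Sum>e\<in>E. (\<phi> q (x q) \<bullet> e) *\<^sub>R lift A \<phi> q e)"
      by (rule frame_linear[OF E linear_lift[OF triv(1) True]])
    finally have "(b q * b q) *\<^sub>R x q = (b q * b q) *\<^sub>R (\<Sum>e\<in>E. (\<phi> q (x q) \<bullet> e) *\<^sub>R lift A \<phi> q e)"
      by (rule arg_cong)
    then show ?thesis
      using True by (simp add: c_def s_def scaleR_sum_right mult_ac)
  next
    case False
    then show ?thesis
      using b(4,5) by (auto simp: c_def s_def)
  qed
  then have "F (\<lambda>q. (b q * b q) *\<^sub>R x q) = F (\<lambda>q. \<Sum>e\<in>E. c e q *\<^sub>R s e q)"
    by simp
  also have "\<dots> = (\<lambda>q. \<Sum>e\<in>E. F (\<lambda>q. c e q *\<^sub>R s e q) q)"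
    by (rule tensorial_sum[OF F sections_scale[OF c s]])
  finally have "(\<lambda>q. b q * b q * F x q) = (\<lambda>q. \<Sum>e\<in>E. c e q * F (s e) q)"
    by (simp only: tensorialD(3)[OF F bb x] tensorialD(3)[OF F c s])
  then have "b p * b p * F x p = (\<Sum>e\<in>E. c e p * F (s e) p)"
    by (rule fun_cong)
  moreover have "\<phi> p 0 = 0"
    using triv_linear[OF triv] subspace_0[OF subspace_fib] unfolding linear_map_on_def
    by (metis scaleR_zero_left)
  then have "c e p = 0" for e
    by (simp add: c_def xp)
  ultimately show ?thesis
    using b(2) by simp
qed

lemma tensorial_pointwise:
  assumes F: "tensorial F" and x: "x \<in> sections A" and y: "y \<in> sections A" and "x p = y p"
  shows "F x p = F y p"
proof -
  have m: "(\<lambda>p. (-1) *\<^sub>R y p) \<in> sections A"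
    by (rule sections_scale[OF smooth_fun_on_const y])
  have "F (\<lambda>p. x p + (-1) *\<^sub>R y p) p = 0"
    by (rule tensorial_local[OF F sections_add[OF x m]]) (simp add: assms(4))
  then show ?thesis
    by (simp only: tensorialD(2)[OF F x m] tensorialD(3)[OF F smooth_fun_on_const y])
qed

lemma dual_section_exists:
  assumes F: "tensorial F"
  shows "\<exists>\<alpha>\<in>dual_sections A. \<forall>y\<in>sections A. pair \<alpha> y = F y"
proof -
  \<comment> \<open>By \<open>tensorial_pointwise\<close> the choice of the section through v is
    immaterial; the value 0 outside of the fibre is the convention of
    \<open>dual_fib\<close>.\<close>
  define \<alpha> where "\<alpha> p v = (if v \<in> fib A p then F (SOME x. x \<in> sections A \<and> x p = v) p else 0)" for p v
  have eq: "\<alpha> p (x p) = F x p" if x: "x \<in> sections A" for x p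
  proof -
    let ?y = "SOME y. y \<in> sections A \<and> y p = x p"
    have "?y \<in> sections A \<and> ?y p = x p"
      by (rule someI[of "\<lambda>y. y \<in> sections A \<and> y p = x p" x]) (use x in simp)
    then have "F ?y p = F x p"
      using tensorial_pointwise[OF F _ x] by blast
    then show ?thesis
      using section_in_fib[OF x] by (simp add: \<alpha>_def)
  qed
  have "linear_map_on (fib A p) (\<alpha> p)" for p
    unfolding linear_map_on_def
  proof (intro conjI ballI allI)
    fix v w assume "v \<in> fib A p" "w \<in> fib A p"
    then obtain x y where xy: "x \<in> sections A" "x p = v" "y \<in> sections A" "y p = w"
      using section_through by metis
    show "\<alpha> p (v + w) = \<alpha> p v + \<alpha> p w"
      using eq[OF sections_add[OF xy(1,3)], of p] eq[OF xy(1), of p] eq[OF xy(3), of p]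
        tensorialD(2)[OF F xy(1,3)] xy by simp
  next
    fix c v assume "v \<in> fib A p"
    then obtain x where x: "x \<in> sections A" "x p = v"
      by (rule section_through)
    show "\<alpha> p (c *\<^sub>R v) = c *\<^sub>R \<alpha> p v"
      using eq[OF sections_scale[OF smooth_fun_on_const[of _ c] x(1)], of p] eq[OF x(1), of p]
        tensorialD(3)[OF F smooth_fun_on_const[of _ c] x(1)] x by simp
  qed
  then have fib: "\<alpha> p \<in> dual_fib A p" for p
    unfolding dual_fib_def \<alpha>_def by simp
  have "smooth_fun_on (charts A) U (\<lambda>p. \<alpha> p (lift A \<phi> p w))" if triv: "(U, \<phi>) \<in> trivs A" for U \<phi> w
  proof (rule smooth_fun_on_local)
    fix p assume p: "p \<in> U"
    obtain b :: "'m \<Rightarrow> real" where b: "smooth_fun A b" "b p \<noteq> 0"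
      "\<forall>w. (\<lambda>q. if q \<in> U then b q *\<^sub>R lift A \<phi> q w else 0) \<in> sections A"
      using local_sections[OF triv p] by (elim exE conjE) blast
    note s = b(3)[rule_format, of w]
    let ?s = "\<lambda>q. if q \<in> U then b q *\<^sub>R lift A \<phi> q w else 0"
    \<comment> \<open>Where b does not vanish, the value on the lift of w is the quotient of the
      global smooth function F(s) by b; continuity of b makes this region open.\<close>
    have W: "open {q. b q \<noteq> 0}"
      using open_Collect_neq[OF smooth_fun_continuous[OF b(1)] continuous_on_const[of UNIV 0]] .
    show "\<exists>V. open V \<and> p \<in> V \<and> smooth_fun_on (charts A) V (\<lambda>p. \<alpha> p (lift A \<phi> p w))"
    proof (intro exI conjI)
      let ?V = "U \<inter> {q. b q \<noteq> 0}"
      show V: "open ?V" "p \<in> ?V"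
        using W triv_open[OF triv] p b(2) by auto
      have "smooth_fun_on (charts A) ?V (\<lambda>q. inverse (b q) * F ?s q)"
        by (intro smooth_fun_on_mult smooth_fun_on_inverse V
            smooth_fun_on_subset[OF b(1)] smooth_fun_on_subset[OF tensorialD(1)[OF F s]]) auto
      then show "smooth_fun_on (charts A) ?V (\<lambda>p. \<alpha> p (lift A \<phi> p w))"
      proof (rule smooth_fun_on_cong[OF V(1)])
        fix q assume q: "q \<in> ?V"
        have "F ?s q = \<alpha> q (b q *\<^sub>R lift A \<phi> q w)"
          using eq[OF s, of q] q by simp
        also have "\<dots> = b q * \<alpha> q (lift A \<phi> q w)"
          using dual_fib_linear[OF fib] lift_in_fib[OF triv] q unfolding linear_map_on_def by simp
        finally show "inverse (b q) * F ?s q = \<alpha> q (lift A \<phi> q w)"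
          using q by simp
      qed
    qed
  qed
  then have "\<alpha> \<in> dual_sections A"
    by (rule dual_sectionsI[OF fib])
  then show ?thesis
    using eq by (auto simp: pair_def fun_eq_iff)
qed

text \<open>Turns the definite description into a computation rule. \<open>lie_deriv\<close>,
  \<open>Rmul\<close> and \<open>alg_diff\<close> become usable once their functionals are seen to
  be tensorial.\<close>

lemma dual_section_of:
  assumes F: "tensorial F"
  shows "dual_section_of A F \<in> dual_sections A"
    and "y \<in> sections A \<Longrightarrow> pair (dual_section_of A F) y = F y"
proof -
  have "\<exists>!\<alpha>. \<alpha> \<in> dual_sections A \<and> (\<forall>y\<in>sections A. pair \<alpha> y = F y)"
    using dual_section_exists[OF F] dual_section_eqI by (metis (full_types))
  from theI'[OF this]
  show "dual_section_of A F \<in> dual_sections A" "y \<in> sections A \<Longrightarrow> pair (dual_section_of A F) y = F y"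
    unfolding dual_section_of_def by auto
qed

end

section \<open>Algebroids and the products on dual sections\<close>

text \<open>Left symmetry is dropped, so that the locale applies to the algebroid and to its deformation
  without proving left symmetry of the latter.\<close>

locale anchored_bundle = smooth_bundle A
  for A :: "('m::{t2_space, second_countable_topology}, 'e::real_inner, 'a::real_vector, 'f::real_inner, 'z)
    algebroid_scheme" +
  assumes mul_section: "\<lbrakk>x \<in> sections A; y \<in> sections A\<rbrakk> \<Longrightarrow> mul A x y \<in> sections A"
    and mul_add_left: "\<lbrakk>x \<in> sections A; y \<in> sections A; z \<in> sections A\<rbrakk> \<Longrightarrow>
      mul A (\<lambda>p. x p + y p) z = (\<lambda>p. mul A x z p + mul A y z p)"
    and mul_add_right: "\<lbrakk>x \<in> sections A; y \<in> sections A; z \<in> sections A\<rbrakk> \<Longrightarrow>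
      mul A x (\<lambda>p. y p + z p) = (\<lambda>p. mul A x y p + mul A x z p)"
    and mul_scale_left: "\<lbrakk>smooth_fun A f; x \<in> sections A; y \<in> sections A\<rbrakk> \<Longrightarrow>
      mul A (\<lambda>p. f p *\<^sub>R x p) y = (\<lambda>p. f p *\<^sub>R mul A x y p)"
    and mul_scale_right: "\<lbrakk>smooth_fun A f; x \<in> sections A; y \<in> sections A\<rbrakk> \<Longrightarrow>
      mul A x (\<lambda>p. f p *\<^sub>R y p) = (\<lambda>p. f p *\<^sub>R mul A x y p + act A x f p *\<^sub>R y p)"
    and act_smooth: "\<lbrakk>x \<in> sections A; smooth_fun A f\<rbrakk> \<Longrightarrow> smooth_fun A (act A x f)"
    and act_add_section: "\<lbrakk>x \<in> sections A; y \<in> sections A; smooth_fun A f\<rbrakk> \<Longrightarrow>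
      act A (\<lambda>p. x p + y p) f = (\<lambda>p. act A x f p + act A y f p)"
    and act_scale_section: "\<lbrakk>x \<in> sections A; smooth_fun A f\<rbrakk> \<Longrightarrow>
      act A (\<lambda>p. g p *\<^sub>R x p) f = (\<lambda>p. g p * act A x f p)"
    and act_add: "\<lbrakk>smooth_fun A f; smooth_fun A g\<rbrakk> \<Longrightarrow>
      act A x (\<lambda>p. f p + g p) = (\<lambda>p. act A x f p + act A x g p)"
    and act_mult: "\<lbrakk>smooth_fun A f; smooth_fun A g\<rbrakk> \<Longrightarrow>
      act A x (\<lambda>p. f p * g p) = (\<lambda>p. f p * act A x g p + act A x f p * g p)"
begin

lemma bracket_section: "x \<in> sections A \<Longrightarrow> y \<in> sections A \<Longrightarrow> bracket A x y \<in> sections A"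
  unfolding bracket_def by (intro sections_diff mul_section)

lemma dual_add: "\<alpha> \<in> dual_sections A \<Longrightarrow> v \<in> fib A p \<Longrightarrow> w \<in> fib A p \<Longrightarrow> \<alpha> p (v + w) = \<alpha> p v + \<alpha> p w"
  and dual_scale: "\<alpha> \<in> dual_sections A \<Longrightarrow> v \<in> fib A p \<Longrightarrow> \<alpha> p (c *\<^sub>R v) = c * \<alpha> p v"
  using dual_fib_linear[OF dual_section_in_dual_fib] unfolding linear_map_on_def by auto

lemma dual_diff:
  assumes "\<alpha> \<in> dual_sections A" "v \<in> fib A p" "w \<in> fib A p"
  shows "\<alpha> p (v - w) = \<alpha> p v - \<alpha> p w"
  using dual_add[OF assms(1,2) subspace_scale[OF subspace_fib assms(3), of "-1"]] dual_scale[OF assms(1,3), of "-1"]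
  by simp

lemma pair_add: "\<alpha> \<in> dual_sections A \<Longrightarrow> x \<in> sections A \<Longrightarrow> y \<in> sections A \<Longrightarrow>
    pair \<alpha> (\<lambda>p. x p + y p) = (\<lambda>p. pair \<alpha> x p + pair \<alpha> y p)"
  unfolding pair_def by (simp add: dual_add section_in_fib)

lemma pair_scale: "\<alpha> \<in> dual_sections A \<Longrightarrow> x \<in> sections A \<Longrightarrow>
    pair \<alpha> (\<lambda>p. f p *\<^sub>R x p) = (\<lambda>p. f p * pair \<alpha> x p)"
  unfolding pair_def by (simp add: dual_scale section_in_fib)

lemma pair_bracket: "\<alpha> \<in> dual_sections A \<Longrightarrow> x \<in> sections A \<Longrightarrow> y \<in> sections A \<Longrightarrow>
    pair \<alpha> (bracket A x y) = (\<lambda>p. pair \<alpha> (mul A x y) p - pair \<alpha> (mul A y x) p)"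
  unfolding pair_def bracket_def by (simp add: dual_diff section_in_fib mul_section)

section \<open>Tensoriality of the operators behind the products\<close>

lemma tensorial_alg_diff:
  assumes f: "smooth_fun A f"
  shows "tensorial (\<lambda>x. act A x f)"
  unfolding tensorial_def by (simp add: act_smooth act_add_section act_scale_section f)

text \<open>The argument y is the left factor of the product, in which \<open>mul\<close> is linear
  over smooth functions.\<close>

lemma tensorial_Rmul:
  assumes \<alpha>: "\<alpha> \<in> dual_sections A" and x: "x \<in> sections A"
  shows "tensorial (\<lambda>y p. - pair \<alpha> (mul A y x) p)"
  unfolding tensorial_def
  by (simp add: mul_add_left mul_scale_left pair_add[OF \<alpha>] pair_scale[OF \<alpha>] mul_section x
      smooth_fun_on_uminus smooth_pair[OF \<alpha>])

text \<open>Scaling y by f produces the term a(x)(f) <alpha, y> twice, from differentiating the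
  pairing and from the Leibniz rule inside the bracket, and the two cancel.\<close>

lemma tensorial_lie_deriv:
  assumes \<alpha>: "\<alpha> \<in> dual_sections A" and x: "x \<in> sections A"
  shows "tensorial (\<lambda>y p. act A x (pair \<alpha> y) p - pair \<alpha> (bracket A x y) p)"
  unfolding tensorial_def
proof (intro conjI ballI allI impI)
  fix y assume y: "y \<in> sections A"
  show "smooth_fun A (\<lambda>p. act A x (pair \<alpha> y) p - pair \<alpha> (bracket A x y) p)"
    by (intro smooth_fun_on_diff open_UNIV act_smooth smooth_pair bracket_section \<alpha> x y)
next
  fix y z assume yz: "y \<in> sections A" "z \<in> sections A"
  note s = yz x \<alpha> mul_section sections_add
  show "(\<lambda>p. act A x (pair \<alpha> (\<lambda>p. y p + z p)) p - pair \<alpha> (bracket A x (\<lambda>p. y p + z p)) p) =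
      (\<lambda>p. act A x (pair \<alpha> y) p - pair \<alpha> (bracket A x y) p + (act A x (pair \<alpha> z) p - pair \<alpha> (bracket A x z) p))"
    by (simp add: pair_bracket pair_add s act_add smooth_pair mul_add_left mul_add_right fun_eq_iff)
next
  fix f y assume f: "smooth_fun A f" and y: "y \<in> sections A"
  have sc: "(\<lambda>p. act A x f p *\<^sub>R y p) \<in> sections A" "(\<lambda>p. f p *\<^sub>R mul A x y p) \<in> sections A"
    by (intro sections_scale act_smooth mul_section x y f)+
  note s = y x \<alpha> mul_section sections_scale[OF f] f sc
  show "(\<lambda>p. act A x (pair \<alpha> (\<lambda>p. f p *\<^sub>R y p)) p - pair \<alpha> (bracket A x (\<lambda>p. f p *\<^sub>R y p)) p) =
      (\<lambda>p. f p * (act A x (pair \<alpha> y) p - pair \<alpha> (bracket A x y) p))"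
    by (simp add: pair_bracket pair_scale pair_add s act_mult smooth_pair mul_scale_left mul_scale_right
        fun_eq_iff algebra_simps)
qed

text \<open>Evaluates three definite descriptions at once; the assumptions on H are what makes their
  functionals tensorial.\<close>

lemma sharp_prod_eval:
  assumes \<alpha>: "\<alpha> \<in> dual_sections A" and \<beta>: "\<beta> \<in> dual_sections A"
    and a: "sharp_sec A H \<alpha> \<in> sections A" and b: "sharp_sec A H \<beta> \<in> sections A"
    and f: "smooth_fun A (\<lambda>q. H q (\<alpha> q) (\<beta> q))"
  shows "sharp_prod A H \<alpha> \<beta> \<in> dual_sections A"
    and "z \<in> sections A \<Longrightarrow> pair (sharp_prod A H \<alpha> \<beta>) z p =
      act A (sharp_sec A H \<alpha>) (pair \<beta> z) p - pair \<beta> (bracket A (sharp_sec A H \<alpha>) z) p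
      + pair \<alpha> (mul A z (sharp_sec A H \<beta>)) p - act A z (\<lambda>q. H q (\<alpha> q) (\<beta> q)) p"
proof -
  note L = dual_section_of[OF tensorial_lie_deriv[OF \<beta> a], folded lie_deriv_def]
  note R = dual_section_of[OF tensorial_Rmul[OF \<alpha> b], folded Rmul_def]
  note D = dual_section_of[OF tensorial_alg_diff[OF f], folded alg_diff_def]
  show "sharp_prod A H \<alpha> \<beta> \<in> dual_sections A"
    unfolding sharp_prod_def by (intro dual_sections_diff L(1) R(1) D(1))
  assume z: "z \<in> sections A"
  have "pair (sharp_prod A H \<alpha> \<beta>) z p = pair (lie_deriv A (sharp_sec A H \<alpha>) \<beta>) z p
      - pair (Rmul A (sharp_sec A H \<beta>) \<alpha>) z p - pair (alg_diff A (\<lambda>q. H q (\<alpha> q) (\<beta> q))) z p"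
    by (simp add: pair_def sharp_prod_def)
  then show "pair (sharp_prod A H \<alpha> \<beta>) z p =
      act A (sharp_sec A H \<alpha>) (pair \<beta> z) p - pair \<beta> (bracket A (sharp_sec A H \<alpha>) z) p
      + pair \<alpha> (mul A z (sharp_sec A H \<beta>)) p - act A z (\<lambda>q. H q (\<alpha> q) (\<beta> q)) p"
    by (simp add: L(2)[OF z] R(2)[OF z] D(2)[OF z])
qed

end

text \<open>The analytic content is that \<open>act A x f\<close> is smooth. For
  \<open>smooth_tangent_deriv\<close> the chart components of the anchor along x must be smooth, and
  trivializations reduce this to the coefficients of the anchor.\<close>

lemma left_symmetric_algebroid_anchored:
  fixes A :: "('m::{t2_space, second_countable_topology}, 'e::real_inner, 'a::real_vector, 'f::real_inner, 'z)
    algebroid_scheme"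
  assumes "left_symmetric_algebroid A"
  shows "anchored_bundle A"
proof -
  note A = assms[unfolded left_symmetric_algebroid_def]
  interpret smooth_bundle A
    using A by unfold_locales simp
  have anchor: "bundle_map_to_tangent A (anchor A)"
    using A by simp
  have tangent: "anchor A p (x p) \<in> tangent_space (charts A) p" if "x \<in> sections A" for x p
    using anchor section_in_fib[OF that] unfolding bundle_map_to_tangent_def by blast
  have lin: "linear_map_on (fib A p) (\<lambda>v. anchor A p v k)" for p k
    using anchor unfolding bundle_map_to_tangent_def by blast
  have smooth: "smooth_fun_on (charts A) (fst k) (\<lambda>p. anchor A p (x p) k)"
    if x: "x \<in> sections A" and k: "k \<in> charts A" for x k
  proof (rule smooth_fun_on_local)
    fix p assume p: "p \<in> fst k"
    obtain U \<phi> where triv: "(U, \<phi>) \<in> trivs A" "p \<in> U"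
      by (rule triv_exists)
    have V: "open (U \<inter> fst k)"
      by (rule open_Int[OF triv_open[OF triv(1)] chart_domain_open[OF k]])
    have "smooth_fun_on (charts A) (U \<inter> fst k) (\<lambda>p. anchor A p (lift A \<phi> p w) k)" for w
      using anchor triv(1) k unfolding bundle_map_to_tangent_def by blast
    then have "smooth_fun_on (charts A) (U \<inter> fst k) (\<lambda>p. anchor A p (x p) k)"
      by (intro smooth_apply_section[OF triv(1) V _ lin _ x, of "\<lambda>_. k"]) auto
    then show "\<exists>V. open V \<and> p \<in> V \<and> smooth_fun_on (charts A) V (\<lambda>p. anchor A p (x p) k)"
      using V p triv(2) by blast
  qed
  show ?thesis
  proof unfold_locales
    show "smooth_fun A (act A x f)" if "x \<in> sections A" "smooth_fun A f" for x f
      unfolding act_def by (rule smooth_tangent_deriv[OF that(2) tangent[OF that(1)] smooth[OF that(1)]])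
    show "act A (\<lambda>p. x p + y p) f = (\<lambda>p. act A x f p + act A y f p)"
      if "x \<in> sections A" "y \<in> sections A" "smooth_fun A f" for x y f
    proof
      fix p
      have "anchor A p (x p + y p) = (\<lambda>k. anchor A p (x p) k + anchor A p (y p) k)"
        using lin section_in_fib that unfolding linear_map_on_def by blast
      then show "act A (\<lambda>p. x p + y p) f p = act A x f p + act A y f p"
        unfolding act_def by (simp only: tangent_deriv_add_vector[OF that(3)])
    qed
    show "act A (\<lambda>p. g p *\<^sub>R x p) f = (\<lambda>p. g p * act A x f p)"
      if "x \<in> sections A" "smooth_fun A f" for x f g
    proof
      fix p
      have "anchor A p (g p *\<^sub>R x p) = (\<lambda>k. g p *\<^sub>R anchor A p (x p) k)"
        using lin section_in_fib that unfolding linear_map_on_def by blast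
      then show "act A (\<lambda>p. g p *\<^sub>R x p) f p = g p * act A x f p"
        unfolding act_def by (simp only: tangent_deriv_scale_vector[OF that(2)])
    qed
    show "act A x (\<lambda>p. f p + g p) = (\<lambda>p. act A x f p + act A x g p)"
      if "smooth_fun A f" "smooth_fun A g" for x f g
      unfolding act_def by (simp only: tangent_deriv_add[OF that])
    show "act A x (\<lambda>p. f p * g p) = (\<lambda>p. f p * act A x g p + act A x f p * g p)"
      if "smooth_fun A f" "smooth_fun A g" for x f g
      unfolding act_def by (simp only: tangent_deriv_mult[OF that])
  qed (use A in blast)+
qed

section \<open>Deformation of the algebroid by an endomorphism\<close>

lemma deformation_simps [simp]:
  "charts (deformation A N) = charts A" "fib (deformation A N) = fib A" "trivs (deformation A N) = trivs A"
  "mul (deformation A N) = deformed_mul A N" "act (deformation A N) x f = act A (app N x) f"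
  by (simp_all add: deformation_def act_def app_def)

text \<open>These notions see only the underlying bundle. The rules carry locale facts about
  \<open>deformation A N\<close> back to \<open>A\<close>.\<close>

lemma deformation_transfer [simp]:
  "sections (deformation A N) = sections A" "dual_sections (deformation A N) = dual_sections A"
  "dual_fib (deformation A N) = dual_fib A" "Sym2 (deformation A N) = Sym2 A"
  "Sym2_dual (deformation A N) = Sym2_dual A" "sharp (deformation A N) H = sharp A H"
  "natural (deformation A N) B = natural A B" "sharp_sec (deformation A N) H = sharp_sec A H"
  by (simp_all add: sections_def dual_sections_def dual_fib_def Sym2_def Sym2_dual_def sharp_def
      natural_def sharp_sec_def app_def fun_eq_iff)

context anchored_bundle
begin

lemma app_add: "bundle_endo A N \<Longrightarrow> x \<in> sections A \<Longrightarrow> y \<in> sections A \<Longrightarrow>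
    app N (\<lambda>p. x p + y p) = (\<lambda>p. app N x p + app N y p)"
  using endo_linear section_in_fib unfolding linear_map_on_def app_def by fast

lemma app_scale: "bundle_endo A N \<Longrightarrow> x \<in> sections A \<Longrightarrow>
    app N (\<lambda>p. f p *\<^sub>R x p) = (\<lambda>p. f p *\<^sub>R app N x p)"
  using endo_linear section_in_fib unfolding linear_map_on_def app_def by fast

lemma deformed_mul_section:
  assumes "bundle_endo A N" "x \<in> sections A" "y \<in> sections A"
  shows "deformed_mul A N x y \<in> sections A"
  unfolding deformed_mul_def by (intro sections_diff sections_add mul_section app_section assms)

lemma anchored_bundle_deformation:
  assumes N: "bundle_endo A N"
  shows "anchored_bundle (deformation A N)"
proof unfold_locales
  note s = N app_section[OF N] mul_section app_add[OF N] app_scale[OF N]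
  show "vector_bundle (deformation A N)"
    using is_bundle unfolding vector_bundle_def by simp
  show "mul (deformation A N) x y \<in> sections (deformation A N)"
    if "x \<in> sections (deformation A N)" "y \<in> sections (deformation A N)" for x y
    using that by (simp add: deformed_mul_section N)
  show "mul (deformation A N) (\<lambda>p. x p + y p) z =
      (\<lambda>p. mul (deformation A N) x z p + mul (deformation A N) y z p)"
    if "x \<in> sections (deformation A N)" "y \<in> sections (deformation A N)" "z \<in> sections (deformation A N)" for x y z
    using that by (simp add: deformed_mul_def s mul_add_left fun_eq_iff)
  show "mul (deformation A N) x (\<lambda>p. y p + z p) =
      (\<lambda>p. mul (deformation A N) x y p + mul (deformation A N) x z p)"
    if "x \<in> sections (deformation A N)" "y \<in> sections (deformation A N)" "z \<in> sections (deformation A N)" for x y z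
    using that by (simp add: deformed_mul_def s mul_add_right fun_eq_iff)
  show "mul (deformation A N) (\<lambda>p. f p *\<^sub>R x p) y = (\<lambda>p. f p *\<^sub>R mul (deformation A N) x y p)"
    if "smooth_fun (deformation A N) f" "x \<in> sections (deformation A N)" "y \<in> sections (deformation A N)" for f x y
    using that by (simp add: deformed_mul_def s mul_scale_left fun_eq_iff algebra_simps)
  \<comment> \<open>The term a(x)(f) N(y) arises in the product of x with N(f y) and again under N
    in the product of x with f y, and cancels. What is left, a(N x)(f) y, is the action through the
    deformed anchor.\<close>
  show "mul (deformation A N) x (\<lambda>p. f p *\<^sub>R y p) =
      (\<lambda>p. f p *\<^sub>R mul (deformation A N) x y p + act (deformation A N) x f p *\<^sub>R y p)"
    if "smooth_fun (deformation A N) f" "x \<in> sections (deformation A N)" "y \<in> sections (deformation A N)" for f x y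
  proof -
    have f: "smooth_fun A f" and x: "x \<in> sections A" and y: "y \<in> sections A"
      using that by simp_all
    have sc: "(\<lambda>p. act A x f p *\<^sub>R y p) \<in> sections A" "(\<lambda>p. f p *\<^sub>R mul A x y p) \<in> sections A"
      by (intro sections_scale act_smooth mul_section x y f)+
    show ?thesis
      by (simp add: deformed_mul_def s mul_scale_right f x y sc fun_eq_iff algebra_simps)
  qed
  show "smooth_fun (deformation A N) (act (deformation A N) x f)"
    if "x \<in> sections (deformation A N)" "smooth_fun (deformation A N) f" for x f
    using that by (simp add: act_smooth s)
  show "act (deformation A N) (\<lambda>p. x p + y p) f =
      (\<lambda>p. act (deformation A N) x f p + act (deformation A N) y f p)"
    if "x \<in> sections (deformation A N)" "y \<in> sections (deformation A N)" "smooth_fun (deformation A N) f" for x y f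
    using that by (simp add: s act_add_section)
  show "act (deformation A N) (\<lambda>p. g p *\<^sub>R x p) f = (\<lambda>p. g p * act (deformation A N) x f p)"
    if "x \<in> sections (deformation A N)" "smooth_fun (deformation A N) f" for x f g
    using that by (simp add: s act_scale_section)
  show "act (deformation A N) x (\<lambda>p. f p + g p) = (\<lambda>p. act (deformation A N) x f p + act (deformation A N) x g p)"
    if "smooth_fun (deformation A N) f" "smooth_fun (deformation A N) g" for x f g
    using that by (simp add: act_add)
  show "act (deformation A N) x (\<lambda>p. f p * g p) =
      (\<lambda>p. f p * act (deformation A N) x g p + act (deformation A N) x f p * g p)"
    if "smooth_fun (deformation A N) f" "smooth_fun (deformation A N) g" for x f g
    using that by (simp add: act_mult)
qed

end

section \<open>Mutually inverse symmetric tensors\<close>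

context smooth_bundle
begin

section \<open>Covectors and symmetric tensors in a trivialization\<close>

lemma colift_mem: "(U, \<phi>) \<in> trivs A \<Longrightarrow> p \<in> U \<Longrightarrow> colift A \<phi> p u \<in> dual_fib A p"
  by (rule colift_in_dual_fib[OF is_bundle])

lemma colift_lift: "(U, \<phi>) \<in> trivs A \<Longrightarrow> p \<in> U \<Longrightarrow> colift A \<phi> p u (lift A \<phi> p w) = w \<bullet> u"
  by (simp add: lift_in_fib triv_lift)

text \<open>Riesz representation in the fibre: over a trivialization every covector is a
  \<open>colift\<close>, with an explicit representing vector.\<close>

lemma colift_expand:
  assumes triv: "(U, \<phi>) \<in> trivs A" "p \<in> U" and E: "frame E" and \<xi>: "\<xi> \<in> dual_fib A p"
  shows "\<xi> = colift A \<phi> p (\<Sum>e\<in>E. \<xi> (lift A \<phi> p e) *\<^sub>R e)"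
proof (rule dual_fib_eqI[OF \<xi> colift_mem[OF triv]])
  fix v assume v: "v \<in> fib A p"
  have "\<xi> v = (\<Sum>e\<in>E. (\<phi> p v \<bullet> e) *\<^sub>R \<xi> (lift A \<phi> p e))"
    by (rule linear_on_expand[OF triv dual_fib_linear[OF \<xi>] v E])
  then show "\<xi> v = colift A \<phi> p (\<Sum>e\<in>E. \<xi> (lift A \<phi> p e) *\<^sub>R e) v"
    using v by (simp add: inner_sum_right mult.commute)
qed

lemma colift_inj:
  assumes "(U, \<phi>) \<in> trivs A" "p \<in> U" "colift A \<phi> p u = colift A \<phi> p w"
  shows "u = w"
proof -
  have "(u - w) \<bullet> u = (u - w) \<bullet> w"
    using fun_cong[OF assms(3), of "lift A \<phi> p (u - w)"] assms(1,2) by (simp add: lift_in_fib triv_lift)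
  then have "(u - w) \<bullet> (u - w) = 0"
    by (simp only: inner_diff_right)
  then show ?thesis by simp
qed

lemma colift_as_sum:
  assumes "frame E"
  shows "colift A \<phi> p u = (\<lambda>v. \<Sum>e\<in>E. (u \<bullet> e) * colift A \<phi> p e v)"
proof
  fix v
  have "\<phi> p v \<bullet> u = (\<Sum>e\<in>E. (u \<bullet> e) * (\<phi> p v \<bullet> e))"
    by (subst (1) frame_sum[OF assms, of u, symmetric]) (simp add: inner_sum_right)
  then show "colift A \<phi> p u v = (\<Sum>e\<in>E. (u \<bullet> e) * colift A \<phi> p e v)"
    by simp
qed

lemma Sym2D:
  assumes "H \<in> Sym2 A" "\<xi> \<in> dual_fib A p" "\<eta> \<in> dual_fib A p"
  shows "H p \<xi> \<eta> = H p \<eta> \<xi>"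
    and "\<zeta> \<in> dual_fib A p \<Longrightarrow> H p \<xi> (\<lambda>v. \<eta> v + \<zeta> v) = H p \<xi> \<eta> + H p \<xi> \<zeta>"
    and "H p \<xi> (\<lambda>v. c * \<eta> v) = c * H p \<xi> \<eta>"
  using assms unfolding Sym2_def by blast+

lemma Sym2_smooth:
  "H \<in> Sym2 A \<Longrightarrow> (U, \<phi>) \<in> trivs A \<Longrightarrow>
    smooth_fun_on (charts A) U (\<lambda>p. H p (colift A \<phi> p u) (colift A \<phi> p w))"
  unfolding Sym2_def by blast

lemma Sym2_sum:
  assumes H: "H \<in> Sym2 A" and \<xi>: "\<xi> \<in> dual_fib A p" and "\<And>i. i \<in> I \<Longrightarrow> \<eta> i \<in> dual_fib A p"
  shows "H p \<xi> (\<lambda>v. \<Sum>i\<in>I. c i * \<eta> i v) = (\<Sum>i\<in>I. c i * H p \<xi> (\<eta> i))"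
proof -
  have zero: "H p \<xi> (\<lambda>v. 0) = 0"
    using Sym2D(3)[OF H \<xi> \<xi>, of 0] by simp
  show ?thesis
    using assms(3)
    by (induction I rule: infinite_finite_induct)
      (simp_all add: zero Sym2D(2,3)[OF H \<xi>] dual_fib_scale dual_fib_sum)
qed

lemma Sym2_dualD:
  assumes "B \<in> Sym2_dual A" "v \<in> fib A p"
  shows "linear_map_on (fib A p) (B p v)" and "w \<in> fib A p \<Longrightarrow> B p v w = B p w v"
  using assms unfolding Sym2_dual_def by blast+

lemma Sym2_dual_smooth:
  "B \<in> Sym2_dual A \<Longrightarrow> (U, \<phi>) \<in> trivs A \<Longrightarrow>
    smooth_fun_on (charts A) U (\<lambda>p. B p (lift A \<phi> p u) (lift A \<phi> p w))"
  unfolding Sym2_dual_def by blast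

lemma natural_in_dual_fib: "B \<in> Sym2_dual A \<Longrightarrow> v \<in> fib A p \<Longrightarrow> natural A B p v \<in> dual_fib A p"
  using Sym2_dualD(1) subspace_add[OF subspace_fib] subspace_scale[OF subspace_fib]
  unfolding dual_fib_def natural_def linear_map_on_def by auto

lemma natural_section:
  assumes B: "B \<in> Sym2_dual A" and x: "x \<in> sections A"
  shows "app (natural A B) x \<in> dual_sections A"
proof (rule dual_sectionsI)
  show "app (natural A B) x p \<in> dual_fib A p" for p
    unfolding app_def by (rule natural_in_dual_fib[OF B section_in_fib[OF x]])
  fix U \<phi> w assume triv: "(U, \<phi>) \<in> trivs A"
  have "smooth_fun_on (charts A) U (\<lambda>p. B p (lift A \<phi> p w) (x p))"
    by (rule smooth_apply_section[OF triv triv_open[OF triv] order_refl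
          Sym2_dualD(1)[OF B lift_in_fib[OF triv]] Sym2_dual_smooth[OF B triv] x])
  then show "smooth_fun_on (charts A) U (\<lambda>p. app (natural A B) x p (lift A \<phi> p w))"
    by (rule smooth_fun_on_cong[OF triv_open[OF triv]])
      (simp add: app_def natural_def lift_in_fib[OF triv] Sym2_dualD(2)[OF B _ section_in_fib[OF x]])
qed

end

section \<open>Consequences of mutual inversion\<close>

text \<open>Puts \<open>B\<close> and \<open>H\<close> on the same footing, so that one equivalence
  serves both halves of the theorem. \<open>H_sharp\<close> is among the axioms because
  \<open>sharp\<close> is a definite description, whose defining property has to be
  supplied.\<close>

locale inverse_tensors = smooth_bundle A
  for A :: "('m::{t2_space, second_countable_topology}, 'e::real_inner, 'a::real_vector, 'f::real_inner, 'z)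
    vector_bundle_scheme" +
  fixes B :: "'m \<Rightarrow> 'a \<Rightarrow> 'a \<Rightarrow> real" and H :: "'m \<Rightarrow> ('a \<Rightarrow> real) \<Rightarrow> ('a \<Rightarrow> real) \<Rightarrow> real"
  assumes B: "B \<in> Sym2_dual A" and H: "H \<in> Sym2 A"
    and sharp_mem: "\<xi> \<in> dual_fib A p \<Longrightarrow> sharp A H p \<xi> \<in> fib A p"
    and natural_sharp: "\<xi> \<in> dual_fib A p \<Longrightarrow> natural A B p (sharp A H p \<xi>) = \<xi>"
    and sharp_natural: "v \<in> fib A p \<Longrightarrow> sharp A H p (natural A B p v) = v"
    and H_sharp: "\<xi> \<in> dual_fib A p \<Longrightarrow> \<eta> \<in> dual_fib A p \<Longrightarrow> H p \<xi> \<eta> = \<eta> (sharp A H p \<xi>)"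
begin

text \<open>The coordinate of the sharp of alpha along e is H evaluated at alpha and the colift of
  e, a sum of coefficients of H times components of alpha, all of them smooth.\<close>

lemma sharp_sec_section:
  assumes \<alpha>: "\<alpha> \<in> dual_sections A"
  shows "sharp_sec A H \<alpha> \<in> sections A"
proof (rule sectionsI)
  show "sharp_sec A H \<alpha> p \<in> fib A p" for p
    unfolding sharp_sec_def app_def by (rule sharp_mem[OF dual_section_in_dual_fib[OF \<alpha>]])
  fix U \<phi> assume triv: "(U, \<phi>) \<in> trivs A"
  obtain E :: "'f set" where E: "frame E"
    using finite_dim_frame[OF finite_dim_fibre] .
  have "smooth_fun_on (charts A) U (\<lambda>p. \<Sum>e\<in>E.
      (\<Sum>e'\<in>E. \<alpha> p (lift A \<phi> p e') * H p (colift A \<phi> p e) (colift A \<phi> p e')) *\<^sub>R e)"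
    by (intro smooth_fun_on_sum smooth_fun_on_scaleR smooth_fun_on_mult smooth_fun_on_const
        triv_open[OF triv] Sym2_smooth[OF H triv] dual_section_smooth[OF \<alpha> triv])
  then show "smooth_fun_on (charts A) U (\<lambda>p. \<phi> p (sharp_sec A H \<alpha> p))"
  proof (rule smooth_fun_on_cong[OF triv_open[OF triv]])
    fix p assume p: "p \<in> U"
    note co = colift_mem[OF triv p] and \<alpha>p = dual_section_in_dual_fib[OF \<alpha>, of p]
    have "(\<Sum>e'\<in>E. \<alpha> p (lift A \<phi> p e') * H p (colift A \<phi> p e) (colift A \<phi> p e'))
        = \<phi> p (sharp A H p (\<alpha> p)) \<bullet> e" for e
    proof -
      have "\<alpha> p v = (\<Sum>e'\<in>E. \<alpha> p (lift A \<phi> p e') * colift A \<phi> p e' v)" for v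
        by (subst (1) colift_expand[OF triv p E \<alpha>p]) (simp add: inner_sum_right)
      then have \<alpha>_eq: "\<alpha> p = (\<lambda>v. \<Sum>e'\<in>E. \<alpha> p (lift A \<phi> p e') * colift A \<phi> p e' v)"
        by (rule ext)
      have "(\<Sum>e'\<in>E. \<alpha> p (lift A \<phi> p e') * H p (colift A \<phi> p e) (colift A \<phi> p e'))
          = H p (colift A \<phi> p e) (\<lambda>v. \<Sum>e'\<in>E. \<alpha> p (lift A \<phi> p e') * colift A \<phi> p e' v)"
        by (rule Sym2_sum[OF H co co, symmetric])
      also have "\<dots> = H p (colift A \<phi> p e) (\<alpha> p)"
        by (rule arg_cong[OF \<alpha>_eq[symmetric]])
      also have "\<dots> = H p (\<alpha> p) (colift A \<phi> p e)"
        by (rule Sym2D(1)[OF H co \<alpha>p])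
      also have "\<dots> = colift A \<phi> p e (sharp A H p (\<alpha> p))"
        by (rule H_sharp[OF \<alpha>p co])
      finally show ?thesis
        using sharp_mem[OF \<alpha>p] by simp
    qed
    then show "(\<Sum>e\<in>E. (\<Sum>e'\<in>E. \<alpha> p (lift A \<phi> p e') * H p (colift A \<phi> p e) (colift A \<phi> p e')) *\<^sub>R e)
        = \<phi> p (sharp_sec A H \<alpha> p)"
      by (simp only: sharp_sec_def app_def frame_sum[OF E])
  qed
qed

text \<open>The musical flat given by \<open>B\<close>, inverse to \<open>sharp_sec A H\<close>; it
  has nothing to do with the real function \<open>flat\<close> behind the bump functions.\<close>

abbreviation flat_sec :: "('m \<Rightarrow> 'a) \<Rightarrow> 'm \<Rightarrow> 'a \<Rightarrow> real" where
  "flat_sec x \<equiv> app (natural A B) x"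

lemma flat_sec_dual_section: "x \<in> sections A \<Longrightarrow> flat_sec x \<in> dual_sections A"
  by (rule natural_section[OF B])

lemma sharp_flat: "x \<in> sections A \<Longrightarrow> sharp_sec A H (flat_sec x) = x"
  by (simp add: sharp_sec_def app_def sharp_natural section_in_fib)

lemma flat_sharp: "\<alpha> \<in> dual_sections A \<Longrightarrow> flat_sec (sharp_sec A H \<alpha>) = \<alpha>"
  by (simp add: sharp_sec_def app_def natural_sharp dual_section_in_dual_fib)

text \<open>Turns quantifiers over dual sections into quantifiers over sections, by substituting
  \<open>flat_sec x\<close>.\<close>

lemma dual_sections_eq: "dual_sections A = flat_sec ` sections A"
  using flat_sharp sharp_sec_section flat_sec_dual_section by (auto intro!: image_eqI[where x = "sharp_sec A H _"])

lemma pair_flat: "x \<in> sections A \<Longrightarrow> y \<in> sections A \<Longrightarrow> pair (flat_sec x) y = eval2 B x y"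
  by (simp add: pair_def app_def natural_def eval2_def section_in_fib)

lemma eval2_sym: "x \<in> sections A \<Longrightarrow> y \<in> sections A \<Longrightarrow> eval2 B x y = eval2 B y x"
  by (simp add: eval2_def fun_eq_iff Sym2_dualD(2)[OF B] section_in_fib)

lemma H_flat:
  assumes "x \<in> sections A" "y \<in> sections A"
  shows "(\<lambda>q. H q (flat_sec x q) (flat_sec y q)) = eval2 B x y"
proof -
  have "H q (flat_sec x q) (flat_sec y q) = eval2 B y x q" for q
    using H_sharp[OF dual_section_in_dual_fib dual_section_in_dual_fib, OF flat_sec_dual_section flat_sec_dual_section, OF assms]
      sharp_natural[OF section_in_fib[OF assms(1)]] section_in_fib[OF assms(1)]
    by (simp add: app_def eval2_def natural_def)
  then show ?thesis
    using eval2_sym[OF assms] by auto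
qed

lemma smooth_eval2: "x \<in> sections A \<Longrightarrow> y \<in> sections A \<Longrightarrow> smooth_fun A (eval2 B x y)"
  using smooth_pair[OF flat_sec_dual_section] pair_flat by metis

lemma B_add: "u \<in> fib A p \<Longrightarrow> v \<in> fib A p \<Longrightarrow> w \<in> fib A p \<Longrightarrow> B p u (v + w) = B p u v + B p u w"
  and B_scale: "u \<in> fib A p \<Longrightarrow> v \<in> fib A p \<Longrightarrow> B p u (c *\<^sub>R v) = c * B p u v"
  using Sym2_dualD(1)[OF B] unfolding linear_map_on_def by auto

lemma B_diff: "u \<in> fib A p \<Longrightarrow> v \<in> fib A p \<Longrightarrow> w \<in> fib A p \<Longrightarrow> B p u (v - w) = B p u v - B p u w"
  using B_add[of u p v "(-1) *\<^sub>R w"] B_scale[of u p w "-1"] subspace_scale[OF subspace_fib, of w p "-1"] by simp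

lemma eval2_add: "x \<in> sections A \<Longrightarrow> y \<in> sections A \<Longrightarrow> z \<in> sections A \<Longrightarrow>
    eval2 B x (\<lambda>p. y p + z p) = (\<lambda>p. eval2 B x y p + eval2 B x z p)"
  and eval2_diff: "x \<in> sections A \<Longrightarrow> y \<in> sections A \<Longrightarrow> z \<in> sections A \<Longrightarrow>
    eval2 B x (\<lambda>p. y p - z p) = (\<lambda>p. eval2 B x y p - eval2 B x z p)"
  by (simp_all add: eval2_def B_add B_diff section_in_fib)

text \<open>With \<xi> = \<open>natural A B p v\<close> both conditions say B(N v, w) = B(v, N w) on
  fibres; \<open>section_through\<close> passes between sections and fibres.\<close>

lemma self_adjoint_iff:
  assumes N: "bundle_endo A N"
  shows "(\<forall>x\<in>sections A. \<forall>y\<in>sections A. eval2 B (app N x) y = eval2 B x (app N y)) \<longleftrightarrow>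
    (\<forall>p. \<forall>\<xi>\<in>dual_fib A p. N p (sharp A H p \<xi>) = sharp A H p (dual_map A N p \<xi>))"
proof -
  have dual: "dual_map A N p (natural A B p v) = (\<lambda>w. if w \<in> fib A p then B p v (N p w) else 0)" for p v
    using endo_in_fib[OF N] by (auto simp: dual_map_def natural_def)
  show ?thesis
  proof
    assume L: "\<forall>x\<in>sections A. \<forall>y\<in>sections A. eval2 B (app N x) y = eval2 B x (app N y)"
    have pt: "B p (N p v) w = B p v (N p w)" if vw: "v \<in> fib A p" "w \<in> fib A p" for p v w
    proof -
      obtain x where x: "x \<in> sections A" "x p = v"
        by (rule section_through[OF vw(1)])
      obtain y where y: "y \<in> sections A" "y p = w"
        by (rule section_through[OF vw(2)])
      have "eval2 B (app N x) y = eval2 B x (app N y)"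
        using L x(1) y(1) by blast
      from fun_cong[OF this, of p] show ?thesis
        by (simp add: eval2_def app_def x y)
    qed
    show "\<forall>p. \<forall>\<xi>\<in>dual_fib A p. N p (sharp A H p \<xi>) = sharp A H p (dual_map A N p \<xi>)"
    proof (intro allI ballI)
      fix p \<xi> assume \<xi>: "\<xi> \<in> dual_fib A p"
      let ?v = "sharp A H p \<xi>"
      have v: "?v \<in> fib A p" by (rule sharp_mem[OF \<xi>])
      have "dual_map A N p \<xi> = natural A B p (N p ?v)"
        unfolding dual[of p ?v, unfolded natural_sharp[OF \<xi>]] natural_def using pt[OF v] by auto
      then show "N p ?v = sharp A H p (dual_map A N p \<xi>)"
        by (simp add: sharp_natural endo_in_fib[OF N v])
    qed
  next
    assume R: "\<forall>p. \<forall>\<xi>\<in>dual_fib A p. N p (sharp A H p \<xi>) = sharp A H p (dual_map A N p \<xi>)"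
    have "B p (N p v) w = B p v (N p w)" if v: "v \<in> fib A p" and w: "w \<in> fib A p" for p v w
    proof -
      let ?\<xi> = "natural A B p v"
      have \<xi>: "?\<xi> \<in> dual_fib A p" by (rule natural_in_dual_fib[OF B v])
      have "dual_map A N p ?\<xi> \<in> dual_fib A p"
        using Sym2_dualD(1)[OF B v] endo_linear[OF N, of p] endo_in_fib[OF N]
          subspace_add[OF subspace_fib] subspace_scale[OF subspace_fib]
        unfolding dual dual_fib_def linear_map_on_def by auto
      then have "natural A B p (N p v) = dual_map A N p ?\<xi>"
        using R \<xi> sharp_natural[OF v] natural_sharp by metis
      then have "natural A B p (N p v) w = dual_map A N p ?\<xi> w" by simp
      then show ?thesis
        using w by (simp add: dual) (simp add: natural_def)
    qed
    then show "\<forall>x\<in>sections A. \<forall>y\<in>sections A. eval2 B (app N x) y = eval2 B x (app N y)"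
      by (simp add: eval2_def app_def section_in_fib)
  qed
qed

lemma dual_map_flat:
  assumes N: "bundle_endo A N"
    and adj: "\<And>x y. x \<in> sections A \<Longrightarrow> y \<in> sections A \<Longrightarrow> eval2 B (app N x) y = eval2 B x (app N y)"
    and x: "x \<in> sections A"
  shows "app (dual_map A N) (flat_sec x) = flat_sec (app N x)"
proof (intro ext)
  fix p v
  show "app (dual_map A N) (flat_sec x) p v = flat_sec (app N x) p v"
  proof (cases "v \<in> fib A p")
    case True
    then obtain y where "y \<in> sections A" "y p = v"
      by (rule section_through)
    then show ?thesis
      using fun_cong[OF adj[OF x, of y], of p] True endo_in_fib[OF N True]
      by (simp add: app_def dual_map_def natural_def eval2_def)
  qed (simp add: app_def dual_map_def natural_def)
qed

end

section \<open>Existence of the inverse tensor in both directions\<close>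

context smooth_bundle
begin

text \<open>Over a trivialization H has the coefficients of the inverse of the Gram map of B, which
  are smooth by \<open>smooth_fun_on_linear_inverse\<close>. The symmetry of H is that of B at the
  sharps of the two covectors.\<close>

lemma inverse_tensors_of_dual:
  assumes B: "B \<in> Sym2_dual A" and nd: "nondegenerate_dual A B"
  shows "inverse_tensors A B (inverse_of_dual A B)"
proof -
  let ?H = "inverse_of_dual A B"
  have bij: "bij_betw (natural A B p) (fib A p) (dual_fib A p)" for p
    using nd unfolding nondegenerate_dual_def by simp
  note sharp = sharp_inverse_of_dual[OF is_bundle nd]
  have mem: "sharp A ?H p \<xi> \<in> fib A p" if "\<xi> \<in> dual_fib A p" for p \<xi>
    using sharp[OF that] bij[of p] that unfolding bij_betw_def by (metis inv_into_into)
  have ns: "natural A B p (sharp A ?H p \<xi>) = \<xi>" if "\<xi> \<in> dual_fib A p" for p \<xi>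
    using sharp[OF that] bij[of p] that unfolding bij_betw_def by (metis f_inv_into_f)
  have sn: "sharp A ?H p (natural A B p v) = v" if "v \<in> fib A p" for p v
    using sharp[OF natural_in_dual_fib[OF B that]] bij[of p] that unfolding bij_betw_def by (metis inv_into_f_f)
  have Hs: "?H p \<xi> \<eta> = \<eta> (sharp A ?H p \<xi>)" if "\<xi> \<in> dual_fib A p" for p \<xi> \<eta>
    by (simp add: sharp[OF that] inverse_of_dual_def)
  have sym: "?H p \<xi> \<eta> = ?H p \<eta> \<xi>" if \<xi>: "\<xi> \<in> dual_fib A p" and \<eta>: "\<eta> \<in> dual_fib A p" for p \<xi> \<eta>
  proof -
    have "?H p \<xi> \<eta> = natural A B p (sharp A ?H p \<eta>) (sharp A ?H p \<xi>)"
      by (simp only: Hs[OF \<xi>] ns[OF \<eta>])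
    also have "\<dots> = natural A B p (sharp A ?H p \<xi>) (sharp A ?H p \<eta>)"
      using mem[OF \<xi>] mem[OF \<eta>] Sym2_dualD(2)[OF B] by (simp add: natural_def)
    also have "\<dots> = ?H p \<eta> \<xi>"
      by (simp only: Hs[OF \<eta>] ns[OF \<xi>])
    finally show ?thesis .
  qed
  have smooth: "smooth_fun_on (charts A) U (\<lambda>p. ?H p (colift A \<phi> p u) (colift A \<phi> p w))"
    if triv: "(U, \<phi>) \<in> trivs A" for U \<phi> u w
  proof -
    obtain E :: "'f set" where E: "frame E"
      using finite_dim_frame[OF finite_dim_fibre] .
    \<comment> \<open>The Gram map of B: \<open>lift\<close> on one side and \<open>colift\<close>
      on the other turn \<open>natural\<close> into an endomorphism of the typical fibre.\<close>
    define G where "G p u = (\<Sum>e\<in>E. B p (lift A \<phi> p u) (lift A \<phi> p e) *\<^sub>R e)" for p u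
    have G: "natural A B p (lift A \<phi> p u) = colift A \<phi> p (G p u)" if p: "p \<in> U" for p u
    proof -
      have \<xi>: "natural A B p (lift A \<phi> p u) \<in> dual_fib A p"
        by (rule natural_in_dual_fib[OF B lift_in_fib[OF triv p]])
      have eq: "(\<Sum>e\<in>E. natural A B p (lift A \<phi> p u) (lift A \<phi> p e) *\<^sub>R e) = G p u"
        by (simp add: G_def natural_def lift_in_fib[OF triv p])
      show ?thesis
        by (rule colift_expand[OF triv p E \<xi>, unfolded eq])
    qed
    have lin: "linear (G p) \<and> bij (G p)" if p: "p \<in> U" for p
    proof
      have B_lin: "linear (\<lambda>u. B p (lift A \<phi> p u) (lift A \<phi> p e))" for e
        using linear_on_lift[OF triv p Sym2_dualD(1)[OF B lift_in_fib[OF triv p, of e]]]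
          Sym2_dualD(2)[OF B lift_in_fib[OF triv p] lift_in_fib[OF triv p]] by simp
      show "linear (G p)"
        unfolding G_def by (intro linear_compose_sum ballI linear_compose[OF B_lin linear_scaleR_left, unfolded o_def])
      show "bij (G p)"
      proof (rule bijI)
        show "inj (G p)"
        proof (rule injI)
          fix u u' assume "G p u = G p u'"
          then have "natural A B p (lift A \<phi> p u) = natural A B p (lift A \<phi> p u')"
            by (simp only: G[OF p])
          then have "lift A \<phi> p u = lift A \<phi> p u'"
            using sn[OF lift_in_fib[OF triv p]] by metis
          then show "u = u'"
            using triv_lift[OF triv p] by metis
        qed
        show "surj (G p)"
        proof (rule surjI)
          fix w
          let ?v = "sharp A ?H p (colift A \<phi> p w)"
          have v: "?v \<in> fib A p"
            by (rule mem[OF colift_mem[OF triv p]])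
          have "colift A \<phi> p (G p (\<phi> p ?v)) = colift A \<phi> p w"
            by (simp only: G[OF p, symmetric] lift_triv[OF triv p v] ns[OF colift_mem[OF triv p]])
          then show "G p (\<phi> p ?v) = w"
            by (rule colift_inj[OF triv p])
        qed
      qed
    qed
    have "smooth_fun_on (charts A) U (\<lambda>p. inv (G p) u \<bullet> w)"
    proof (intro smooth_fun_on_inner smooth_fun_on_const smooth_fun_on_linear_inverse[OF finite_dim_fibre] triv_open[OF triv])
      show "smooth_fun_on (charts A) U (\<lambda>p. G p w)" for w
        unfolding G_def
        by (intro smooth_fun_on_sum smooth_fun_on_scaleR smooth_fun_on_const triv_open[OF triv] Sym2_dual_smooth[OF B triv])
    qed (rule lin)
    then show ?thesis
    proof (rule smooth_fun_on_cong[OF triv_open[OF triv]])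
      fix p assume p: "p \<in> U"
      have "G p (inv (G p) u) = u"
        using lin[OF p] by (simp add: bij_is_surj surj_f_inv_f)
      then have "natural A B p (lift A \<phi> p (inv (G p) u)) = colift A \<phi> p u"
        by (simp only: G[OF p])
      then have "sharp A ?H p (colift A \<phi> p u) = lift A \<phi> p (inv (G p) u)"
        using sn[OF lift_in_fib[OF triv p]] by metis
      then show "inv (G p) u \<bullet> w = ?H p (colift A \<phi> p u) (colift A \<phi> p w)"
        by (simp only: Hs[OF colift_mem[OF triv p]] colift_lift[OF triv p])
    qed
  qed
  have H: "?H \<in> Sym2 A"
    unfolding Sym2_def using sym smooth by (auto simp: inverse_of_dual_def)
  show ?thesis
    by unfold_locales (use B H mem ns sn Hs in auto)
qed

text \<open>A linear functional on the dual of a finite-dimensional fibre is evaluation at a vector,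
  and the frame exhibits that vector. Hence the definite description in \<open>sharp\<close> has a
  value even where H is degenerate.\<close>

lemma Sym2_sharp:
  assumes H: "H \<in> Sym2 A" and \<xi>: "\<xi> \<in> dual_fib A p"
  shows "sharp A H p \<xi> \<in> fib A p" and "\<eta> \<in> dual_fib A p \<Longrightarrow> H p \<xi> \<eta> = \<eta> (sharp A H p \<xi>)"
    and "\<lbrakk>(U, \<phi>) \<in> trivs A; p \<in> U; frame E\<rbrakk> \<Longrightarrow>
      sharp A H p \<xi> = lift A \<phi> p (\<Sum>e\<in>E. H p \<xi> (colift A \<phi> p e) *\<^sub>R e)"
proof -
  have *: "sharp A H p \<xi> = lift A \<phi> p (\<Sum>e\<in>E. H p \<xi> (colift A \<phi> p e) *\<^sub>R e) \<and>
      (\<forall>\<eta>\<in>dual_fib A p. \<eta> (lift A \<phi> p (\<Sum>e\<in>E. H p \<xi> (colift A \<phi> p e) *\<^sub>R e)) = H p \<xi> \<eta>)"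
    if triv: "(U, \<phi>) \<in> trivs A" "p \<in> U" and E: "frame E" for U \<phi> and E :: "'f set"
  proof -
    let ?v = "lift A \<phi> p (\<Sum>e\<in>E. H p \<xi> (colift A \<phi> p e) *\<^sub>R e)"
    have eval: "\<eta> ?v = H p \<xi> \<eta>" if \<eta>: "\<eta> \<in> dual_fib A p" for \<eta>
    proof -
      obtain w where w: "\<eta> = colift A \<phi> p w"
        using colift_expand[OF triv E \<eta>] by blast
      have "\<eta> ?v = (\<Sum>e\<in>E. (w \<bullet> e) * H p \<xi> (colift A \<phi> p e))"
        unfolding w colift_lift[OF triv] inner_sum_left by (simp add: inner_commute mult.commute)
      also have "\<dots> = H p \<xi> (\<lambda>v. \<Sum>e\<in>E. (w \<bullet> e) * colift A \<phi> p e v)"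
        by (rule Sym2_sum[OF H \<xi> colift_mem[OF triv], symmetric])
      also have "(\<lambda>v. \<Sum>e\<in>E. (w \<bullet> e) * colift A \<phi> p e v) = \<eta>"
        unfolding w by (rule colift_as_sum[OF E, symmetric])
      finally show ?thesis .
    qed
    moreover have "sharp A H p \<xi> = ?v"
      unfolding sharp_def
    proof (rule the_equality)
      show "?v \<in> fib A p \<and> (\<forall>\<eta>\<in>dual_fib A p. \<eta> ?v = H p \<xi> \<eta>)"
        using eval lift_in_fib[OF triv] by blast
      show "v = ?v" if "v \<in> fib A p \<and> (\<forall>\<eta>\<in>dual_fib A p. \<eta> v = H p \<xi> \<eta>)" for v
        by (rule dual_fib_separates[OF is_bundle _ lift_in_fib[OF triv]]) (use that eval in auto)
    qed
    ultimately show ?thesis by blast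
  qed
  obtain U \<phi> where triv: "(U, \<phi>) \<in> trivs A" "p \<in> U"
    by (rule triv_exists)
  obtain E :: "'f set" where E: "frame E"
    using finite_dim_frame[OF finite_dim_fibre] .
  show "sharp A H p \<xi> \<in> fib A p"
    using *[OF triv E] lift_in_fib[OF triv] by simp
  show "H p \<xi> \<eta> = \<eta> (sharp A H p \<xi>)" if "\<eta> \<in> dual_fib A p"
    using *[OF triv E] that by simp
  show "sharp A H p \<xi> = lift A \<phi> p (\<Sum>e\<in>E. H p \<xi> (colift A \<phi> p e) *\<^sub>R e)"
    if "(U, \<phi>) \<in> trivs A" "p \<in> U" "frame E" for U \<phi> and E :: "'f set"
    using *[OF that] by simp
qed

text \<open>Mirror image of \<open>inverse_tensors_of_dual\<close>: here G is the Gram map of H on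
  colifts, and B has the coefficients of its inverse.\<close>

lemma inverse_tensors_of:
  assumes H: "H \<in> Sym2 A" and nd: "nondegenerate A H"
  shows "inverse_tensors A (inverse_of A H) H"
proof -
  let ?B = "inverse_of A H"
  have bij: "bij_betw (sharp A H p) (dual_fib A p) (fib A p)" for p
    using nd unfolding nondegenerate_def by simp
  define s where "s p = inv_into (dual_fib A p) (sharp A H p)" for p
  have s_mem: "s p v \<in> dual_fib A p" if "v \<in> fib A p" for p v
    using bij[of p] that unfolding bij_betw_def s_def by (metis inv_into_into)
  have sharp_s: "sharp A H p (s p v) = v" if "v \<in> fib A p" for p v
    using bij[of p] that unfolding bij_betw_def s_def by (metis f_inv_into_f)
  have s_sharp: "s p (sharp A H p \<xi>) = \<xi>" if "\<xi> \<in> dual_fib A p" for p \<xi>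
    using bij[of p] that unfolding bij_betw_def s_def by (metis inv_into_f_f)
  have B_eq: "?B p v = s p v" for p v
    by (simp add: inverse_of_def s_def fun_eq_iff)
  have natural_s: "natural A ?B p v = s p v" if "v \<in> fib A p" for p v
    unfolding s_def by (rule natural_inverse_of[OF nd that])
  have sym: "?B p v w = ?B p w v" if v: "v \<in> fib A p" and w: "w \<in> fib A p" for p v w
  proof -
    \<comment> \<open>As w is the sharp of \<open>s p w\<close>, the value B(v, w) is a value of H,
      whose symmetry it inherits.\<close>
    have "s p v w = H p (s p w) (s p v)"
      using Sym2_sharp(2)[OF H s_mem[OF w] s_mem[OF v]] sharp_s[OF w] by simp
    also have "\<dots> = H p (s p v) (s p w)"
      by (rule Sym2D(1)[OF H s_mem[OF w] s_mem[OF v]])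
    also have "\<dots> = s p w v"
      using Sym2_sharp(2)[OF H s_mem[OF v] s_mem[OF w]] sharp_s[OF v] by simp
    finally show ?thesis by (simp add: B_eq)
  qed
  have smooth: "smooth_fun_on (charts A) U (\<lambda>p. ?B p (lift A \<phi> p u) (lift A \<phi> p w))"
    if triv: "(U, \<phi>) \<in> trivs A" for U \<phi> u w
  proof -
    obtain E :: "'f set" where E: "frame E"
      using finite_dim_frame[OF finite_dim_fibre] .
    define G where "G p u = (\<Sum>e\<in>E. H p (colift A \<phi> p u) (colift A \<phi> p e) *\<^sub>R e)" for p u
    have G: "sharp A H p (colift A \<phi> p u) = lift A \<phi> p (G p u)" if p: "p \<in> U" for p u
      unfolding G_def by (rule Sym2_sharp(3)[OF H colift_mem[OF triv p] triv p E])
    have lin: "linear (G p) \<and> bij (G p)" if p: "p \<in> U" for p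
    proof
      note co = colift_mem[OF triv p]
      have H_lin: "linear (\<lambda>u. H p (colift A \<phi> p u) (colift A \<phi> p e))" for e
      proof (rule linearI)
        \<comment> \<open>\<open>Sym2\<close> states linearity in the second argument; symmetry
          moves u there.\<close>
        note sym = Sym2D(1)[OF H co co]
        have add: "colift A \<phi> p (u + w) = (\<lambda>v. colift A \<phi> p u v + colift A \<phi> p w v)" for u w
          by (auto simp: inner_add_right)
        show "H p (colift A \<phi> p (u + w)) (colift A \<phi> p e)
            = H p (colift A \<phi> p u) (colift A \<phi> p e) + H p (colift A \<phi> p w) (colift A \<phi> p e)" for u w
          unfolding sym[of _ e] unfolding add by (rule Sym2D(2)[OF H co co co])
        have scale: "colift A \<phi> p (c *\<^sub>R u) = (\<lambda>v. c * colift A \<phi> p u v)" for c u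
          by auto
        show "H p (colift A \<phi> p (c *\<^sub>R u)) (colift A \<phi> p e)
            = c *\<^sub>R H p (colift A \<phi> p u) (colift A \<phi> p e)" for c u
          unfolding sym[of _ e] real_scaleR_def unfolding scale by (rule Sym2D(3)[OF H co co])
      qed
      show "linear (G p)"
        unfolding G_def by (intro linear_compose_sum ballI linear_compose[OF H_lin linear_scaleR_left, unfolded o_def])
      show "bij (G p)"
      proof (rule bijI)
        show "inj (G p)"
        proof (rule injI)
          fix u u' assume "G p u = G p u'"
          then have "sharp A H p (colift A \<phi> p u) = sharp A H p (colift A \<phi> p u')"
            by (simp only: G[OF p])
          from arg_cong[OF this, of "s p"] have "colift A \<phi> p u = colift A \<phi> p u'"
            by (simp only: s_sharp[OF co])
          then show "u = u'"
            by (rule colift_inj[OF triv p])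
        qed
        show "surj (G p)"
          unfolding surj_def
        proof
          fix w
          have "s p (lift A \<phi> p w) \<in> dual_fib A p"
            by (rule s_mem[OF lift_in_fib[OF triv p]])
          then obtain u where u: "s p (lift A \<phi> p w) = colift A \<phi> p u"
            using colift_expand[OF triv p E] by blast
          have "lift A \<phi> p (G p u) = lift A \<phi> p w"
            by (simp only: G[OF p, symmetric] u[symmetric] sharp_s[OF lift_in_fib[OF triv p]])
          then have "w = G p u"
            using triv_lift[OF triv p] by metis
          then show "\<exists>u. w = G p u" ..
        qed
      qed
    qed
    have "smooth_fun_on (charts A) U (\<lambda>p. w \<bullet> inv (G p) u)"
    proof (intro smooth_fun_on_inner smooth_fun_on_const smooth_fun_on_linear_inverse[OF finite_dim_fibre] triv_open[OF triv])
      show "smooth_fun_on (charts A) U (\<lambda>p. G p w)" for w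
        unfolding G_def
        by (intro smooth_fun_on_sum smooth_fun_on_scaleR smooth_fun_on_const triv_open[OF triv] Sym2_smooth[OF H triv])
    qed (rule lin)
    then show ?thesis
    proof (rule smooth_fun_on_cong[OF triv_open[OF triv]])
      fix p assume p: "p \<in> U"
      have "G p (inv (G p) u) = u"
        using lin[OF p] by (simp add: bij_is_surj surj_f_inv_f)
      then have "sharp A H p (colift A \<phi> p (inv (G p) u)) = lift A \<phi> p u"
        by (simp only: G[OF p])
      from arg_cong[OF this, of "s p"] have "s p (lift A \<phi> p u) = colift A \<phi> p (inv (G p) u)"
        by (simp only: s_sharp[OF colift_mem[OF triv p]])
      then show "w \<bullet> inv (G p) u = ?B p (lift A \<phi> p u) (lift A \<phi> p w)"
        by (simp only: B_eq colift_lift[OF triv p])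
    qed
  qed
  have B: "?B \<in> Sym2_dual A"
    unfolding Sym2_dual_def using sym smooth dual_fib_linear[OF s_mem] by (auto simp: B_eq)
  show ?thesis
  proof unfold_locales
    show "natural A ?B p (sharp A H p \<xi>) = \<xi>" if "\<xi> \<in> dual_fib A p" for p \<xi>
      using natural_s[OF Sym2_sharp(1)[OF H that]] s_sharp[OF that] by simp
    show "sharp A H p (natural A ?B p v) = v" if "v \<in> fib A p" for p v
      using natural_s[OF that] sharp_s[OF that] by simp
  qed (use B H Sym2_sharp(1,2)[OF H] in auto)
qed

end

section \<open>Koszul-Vinberg and pseudo-Hessian structures\<close>

text \<open>Closedness is not built in, because the locale is also instantiated at the deformation,
  where \<open>delta\<close> of \<open>B\<close> measures the defect to be computed.\<close>

locale hessian_pair = anchored_bundle A + inverse_tensors A B H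
  for A :: "('m::{t2_space, second_countable_topology}, 'e::real_inner, 'a::real_vector, 'f::real_inner, 'z)
    algebroid_scheme" and B H
begin

lemma eval2_bracket: "x \<in> sections A \<Longrightarrow> y \<in> sections A \<Longrightarrow> z \<in> sections A \<Longrightarrow>
    eval2 B z (bracket A x y) = (\<lambda>p. eval2 B z (mul A x y) p - eval2 B z (mul A y x) p)"
  unfolding bracket_def by (simp add: eval2_diff mul_section)

text \<open>The five terms correspond one to one, up to the symmetry of \<open>B\<close>.\<close>

lemma KV_bracket_flat:
  assumes s: "x \<in> sections A" "y \<in> sections A" "z \<in> sections A"
  shows "KV_bracket A H (flat_sec x) (flat_sec y) (flat_sec z) = delta A B x y z"
  unfolding KV_bracket_def delta_def sharp_flat[OF s(1)] sharp_flat[OF s(2)] sharp_flat[OF s(3)]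
  by (simp add: pair_flat s mul_section bracket_section eval2_sym[OF s(3)] fun_eq_iff)

lemma koszul_vinberg_iff: "koszul_vinberg_structure A H \<longleftrightarrow> pseudo_hessian_structure A B"
  unfolding koszul_vinberg_structure_def pseudo_hessian_structure_def delta_closed_def dual_sections_eq
  by (simp add: H B KV_bracket_flat)

lemma sharp_prod_flat_dual_section:
  assumes x: "x \<in> sections A" and y: "y \<in> sections A"
  shows "sharp_prod A H (flat_sec x) (flat_sec y) \<in> dual_sections A"
  by (rule sharp_prod_eval(1)) (simp_all add: flat_sec_dual_section sharp_flat H_flat smooth_eval2 x y)

text \<open>For closed \<open>B\<close> the product on dual sections is transported from \<open>\<cdot>\<^sub>A\<close> by \<open>B\<^sup>\<natural>\<close>;
  in general \<open>\<delta>B\<close> measures the defect.\<close>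

lemma sharp_prod_flat:
  assumes x: "x \<in> sections A" and y: "y \<in> sections A" and z: "z \<in> sections A"
  shows "pair (sharp_prod A H (flat_sec x) (flat_sec y)) z p = delta A B x z y p + eval2 B (mul A x y) z p"
proof -
  have "pair (sharp_prod A H (flat_sec x) (flat_sec y)) z p =
      act A x (eval2 B y z) p - eval2 B y (bracket A x z) p + eval2 B x (mul A z y) p - act A z (eval2 B x y) p"
    using sharp_prod_eval(2)[of "flat_sec x" "flat_sec y" H z p]
    by (simp add: flat_sec_dual_section sharp_flat H_flat smooth_eval2 x y z pair_flat mul_section bracket_section)
  then show ?thesis
    unfolding delta_def
    using eval2_sym[OF y z] eval2_sym[OF y bracket_section[OF x z]] eval2_sym[OF z mul_section[OF x y]]
    by simp
qed

end

text \<open>The conditions tying \<open>B\<close> to \<open>H\<close> concern the bundle alone,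
  which the deformation leaves unchanged.\<close>

lemma (in hessian_pair) hessian_pair_deformation:
  assumes N: "bundle_endo A N"
  shows "hessian_pair (deformation A N) B H"
proof -
  interpret D: anchored_bundle "deformation A N"
    by (rule anchored_bundle_deformation[OF N])
  show ?thesis
    by unfold_locales (simp_all add: B H sharp_mem natural_sharp sharp_natural H_sharp)
qed

section \<open>Comparison of the products under a self-adjoint endomorphism\<close>

locale self_adjoint_endo = hessian_pair A B H
  for A :: "('m::{t2_space, second_countable_topology}, 'e::real_inner, 'a::real_vector, 'f::real_inner, 'z)
    algebroid_scheme" and B H +
  fixes N :: "'m \<Rightarrow> 'a \<Rightarrow> 'a"
  assumes N: "bundle_endo A N"
    and adj: "\<And>x y. x \<in> sections A \<Longrightarrow> y \<in> sections A \<Longrightarrow> eval2 B (app N x) y = eval2 B x (app N y)"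
begin

lemma N_section: "x \<in> sections A \<Longrightarrow> app N x \<in> sections A"
  by (rule app_section[OF N])

lemma eval2_deformed_mul:
  assumes x: "x \<in> sections A" and y: "y \<in> sections A" and z: "z \<in> sections A"
  shows "eval2 B z (deformed_mul A N x y) =
    (\<lambda>p. eval2 B z (mul A (app N x) y) p + eval2 B z (mul A x (app N y)) p - eval2 B (app N z) (mul A x y) p)"
proof -
  have "eval2 B z (deformed_mul A N x y) = (\<lambda>p. eval2 B z (mul A (app N x) y) p
      + eval2 B z (mul A x (app N y)) p - eval2 B z (app N (mul A x y)) p)"
    unfolding deformed_mul_def
    by (simp add: eval2_diff eval2_add sections_add mul_section N_section x y z)
  then show ?thesis
    by (simp only: adj[OF z mul_section[OF x y]])
qed

text \<open>By self-adjointness the terms a(x) B(N y, z) and a(y) B(N x, z) each occur twice in the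
  sum of the three \<open>delta A B\<close>, and the factor 2 removes them. Product terms such as
  B(N y, x . z) occur once, so the same factor reverses their sign, as required by the term with N
  outside in the deformed product.\<close>

lemma delta_deformation:
  assumes x: "x \<in> sections A" and y: "y \<in> sections A" and z: "z \<in> sections A"
  shows "delta (deformation A N) B x y z p =
    delta A B (app N x) y z p + delta A B x (app N y) z p + delta A B x y (app N z) p
    - 2 * delta A (\<lambda>p v w. B p (N p v) w) x y z p"
proof -
  note s = x y z N_section[OF x] N_section[OF y] N_section[OF z]
  have br: "eval2 B (bracket A u v) w p = eval2 B w (mul A u v) p - eval2 B w (mul A v u) p"
    if "u \<in> sections A" "v \<in> sections A" "w \<in> sections A" for u v w
    using eval2_sym[OF bracket_section[OF that(1,2)] that(3)] eval2_bracket[OF that] by simp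
  have "eval2 B (bracket (deformation A N) x y) z p
      = eval2 B z (deformed_mul A N x y) p - eval2 B z (deformed_mul A N y x) p"
  proof -
    have m: "deformed_mul A N x y \<in> sections A" "deformed_mul A N y x \<in> sections A"
      by (intro deformed_mul_section N x y)+
    show ?thesis
      using eval2_sym[OF sections_diff[OF m] z] eval2_diff[OF z m] by (simp add: bracket_def)
  qed
  moreover have BN: "eval2 (\<lambda>p v w. B p (N p v) w) u v = eval2 B (app N u) v" for u v
    by (simp add: eval2_def app_def)
  have "eval2 B (app N (bracket A x y)) z p = eval2 B (app N z) (mul A x y) p - eval2 B (app N z) (mul A y x) p"
    using adj[OF bracket_section[OF x y] z] br[OF x y N_section[OF z]] by simp
  ultimately show ?thesis
    unfolding delta_def BN
    by (simp add: br s eval2_deformed_mul adj[OF y z, symmetric] adj[OF x z, symmetric])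
qed

text \<open>Three uses of \<open>sharp_prod_flat\<close>; the last is at N z, because pairing the
  image of a covector under \<open>dual_map A N\<close> with z means pairing the covector with N z.
  By \<open>eval2_deformed_mul\<close> the three product terms combine into the deformed
  product.\<close>

lemma dual_deformed_prod_flat:
  assumes x: "x \<in> sections A" and y: "y \<in> sections A" and z: "z \<in> sections A"
  shows "dual_deformed_prod A H N (flat_sec x) (flat_sec y) \<in> dual_sections A"
    and "pair (dual_deformed_prod A H N (flat_sec x) (flat_sec y)) z p =
      delta A B (app N x) z y p + delta A B x z (app N y) p - delta A B x (app N z) y p
      + eval2 B (deformed_mul A N x y) z p"
proof -
  note s = x y z N_section[OF x] N_section[OF y] N_section[OF z]
  let ?P = "sharp_prod A H (flat_sec x) (flat_sec y)"
  note P = sharp_prod_flat_dual_section[OF x y]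
  \<comment> \<open>Writing the product as the flat of a section shows that its image under the dual
    map is again a smooth dual section.\<close>
  have nP: "app (dual_map A N) ?P = flat_sec (app N (sharp_sec A H ?P))"
    using dual_map_flat[OF N adj sharp_sec_section[OF P]] flat_sharp[OF P] by simp
  have eq: "dual_deformed_prod A H N (flat_sec x) (flat_sec y) = (\<lambda>p v.
      sharp_prod A H (flat_sec (app N x)) (flat_sec y) p v + sharp_prod A H (flat_sec x) (flat_sec (app N y)) p v
      - app (dual_map A N) ?P p v)"
    unfolding dual_deformed_prod_def
    by (simp only: dual_map_flat[OF N adj x] dual_map_flat[OF N adj y])
  show "dual_deformed_prod A H N (flat_sec x) (flat_sec y) \<in> dual_sections A"
    unfolding eq nP
    by (intro dual_sections_diff dual_sections_add sharp_prod_flat_dual_section flat_sec_dual_section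
        N_section sharp_sec_section P x y)
  have "pair (app (dual_map A N) ?P) z p = pair ?P (app N z) p"
    by (simp add: pair_def app_def dual_map_def section_in_fib[OF z])
  then have "pair (dual_deformed_prod A H N (flat_sec x) (flat_sec y)) z p =
      delta A B (app N x) z y p + eval2 B (mul A (app N x) y) z p
      + (delta A B x z (app N y) p + eval2 B (mul A x (app N y)) z p)
      - (delta A B x (app N z) y p + eval2 B (mul A x y) (app N z) p)"
    unfolding eq by (simp add: sharp_prod_flat[symmetric] s) (simp add: pair_def)
  moreover have "eval2 B (deformed_mul A N x y) z p = eval2 B (mul A (app N x) y) z p
      + eval2 B (mul A x (app N y)) z p - eval2 B (mul A x y) (app N z) p"
    using eval2_sym[OF deformed_mul_section[OF N x y] z] eval2_deformed_mul[OF x y z]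
      eval2_sym[OF z mul_section] eval2_sym[OF N_section[OF z] mul_section] s by simp
  ultimately show "pair (dual_deformed_prod A H N (flat_sec x) (flat_sec y)) z p =
      delta A B (app N x) z y p + delta A B x z (app N y) p - delta A B x (app N z) y p
      + eval2 B (deformed_mul A N x y) z p"
    by simp
qed

text \<open>Since \<open>star_prod\<close> is \<open>sharp_prod\<close> of the deformation,
  \<open>sharp_prod_flat\<close> is applied there.\<close>

lemma star_prod_flat:
  assumes x: "x \<in> sections A" and y: "y \<in> sections A" and z: "z \<in> sections A"
  shows "star_prod A H N (flat_sec x) (flat_sec y) \<in> dual_sections A"
    and "pair (star_prod A H N (flat_sec x) (flat_sec y)) z p =
      delta (deformation A N) B x z y p + eval2 B (deformed_mul A N x y) z p"
proof -
  interpret D: hessian_pair "deformation A N" B H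
    by (rule hessian_pair_deformation[OF N])
  show "star_prod A H N (flat_sec x) (flat_sec y) \<in> dual_sections A"
    using D.sharp_prod_flat_dual_section x y unfolding star_prod_def by simp
  show "pair (star_prod A H N (flat_sec x) (flat_sec y)) z p =
      delta (deformation A N) B x z y p + eval2 B (deformed_mul A N x y) z p"
    using D.sharp_prod_flat x y z unfolding star_prod_def by simp
qed

text \<open>For closed \<open>B\<close> the pairings of the two products with z differ by -2 times
  \<open>delta\<close> of the twisted form at (x, z, y). That z lands in the middle slot does no
  harm, as all three sections are arbitrary.\<close>

lemma star_prod_eq_iff:
  assumes closed: "delta_closed A B"
  shows "(\<forall>\<alpha>\<in>dual_sections A. \<forall>\<beta>\<in>dual_sections A. star_prod A H N \<alpha> \<beta> = dual_deformed_prod A H N \<alpha> \<beta>)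
    \<longleftrightarrow> delta_closed A (\<lambda>p v w. B p (N p v) w)"
proof -
  have zero: "delta A B x y z p = 0" if "x \<in> sections A" "y \<in> sections A" "z \<in> sections A" for x y z p
    using closed that unfolding delta_closed_def by metis
  have "star_prod A H N (flat_sec x) (flat_sec y) = dual_deformed_prod A H N (flat_sec x) (flat_sec y)
      \<longleftrightarrow> (\<forall>z\<in>sections A. delta A (\<lambda>p v w. B p (N p v) w) x z y = (\<lambda>p. 0))"
    (is "?L = ?R \<longleftrightarrow> _")
    if x: "x \<in> sections A" and y: "y \<in> sections A" for x y
  proof -
    note s = x y N_section[OF x] N_section[OF y]
    have "?L = ?R \<longleftrightarrow> (\<forall>z\<in>sections A. pair ?L z = pair ?R z)"
      using dual_section_eqI[OF star_prod_flat(1)[OF x y x] dual_deformed_prod_flat(1)[OF x y x]] by metis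
    moreover have "pair ?L z = pair ?R z \<longleftrightarrow> delta A (\<lambda>p v w. B p (N p v) w) x z y = (\<lambda>p. 0)"
      if z: "z \<in> sections A" for z
      by (simp add: fun_eq_iff star_prod_flat(2)[OF x y z] dual_deformed_prod_flat(2)[OF x y z]
          delta_deformation[OF x z y] zero s z N_section)
    ultimately show ?thesis by simp
  qed
  then show ?thesis
    unfolding dual_sections_eq delta_closed_def by auto
qed

end

text \<open>Either structure implies all the conditions of the case split, so both sides fail
  without them. With them \<open>self_adjoint_endo\<close> applies, and
  \<open>star_prod_eq_iff\<close> matches the remaining conditions.\<close>

lemma (in hessian_pair) KVN_iff_HN: "KVN_structure A H N \<longleftrightarrow> HN_structure A B N"
proof (cases "bundle_endo A N \<and> pseudo_hessian_structure A B \<and>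
    (\<forall>x\<in>sections A. \<forall>y\<in>sections A. eval2 B (app N x) y = eval2 B x (app N y))")
  case True
  then interpret self_adjoint_endo A B H N
    by unfold_locales auto
  have "delta_closed A B"
    using True unfolding pseudo_hessian_structure_def by simp
  then show ?thesis
    using star_prod_eq_iff koszul_vinberg_iff self_adjoint_iff[OF N] True
    unfolding KVN_structure_def HN_structure_def by auto
next
  case False
  then show ?thesis
    using koszul_vinberg_iff self_adjoint_iff[of N]
    unfolding KVN_structure_def HN_structure_def nijenhuis_operator_def by auto
qed

theorem theorem6p2:
  fixes A :: "('m::{t2_space, second_countable_topology}, 'e::real_inner,
                'a::real_vector, 'f::real_inner) algebroid"
  assumes "left_symmetric_algebroid A"
  shows "(\<forall>B N. HN_structure A B N \<and> nondegenerate_dual A B \<longrightarrow>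
            KVN_structure A (inverse_of_dual A B) N) \<and>
         (\<forall>H N. KVN_structure A H N \<and> nondegenerate A H \<longrightarrow>
            HN_structure A (inverse_of A H) N)"
proof -
  interpret anchored_bundle A
    by (rule left_symmetric_algebroid_anchored[OF assms])
  show ?thesis
  proof (intro conjI allI impI; elim conjE)
    fix B N assume HN: "HN_structure A B N" and nd: "nondegenerate_dual A B"
    then have "B \<in> Sym2_dual A"
      unfolding HN_structure_def pseudo_hessian_structure_def by simp
    then interpret inverse_tensors A B "inverse_of_dual A B"
      using nd by (rule inverse_tensors_of_dual)
    interpret hessian_pair A B "inverse_of_dual A B" ..
    show "KVN_structure A (inverse_of_dual A B) N"
      using HN KVN_iff_HN by simp
  next
    fix H N assume KVN: "KVN_structure A H N" and nd: "nondegenerate A H"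
    then have "H \<in> Sym2 A"
      unfolding KVN_structure_def koszul_vinberg_structure_def by simp
    then interpret inverse_tensors A "inverse_of A H" H
      using nd by (rule inverse_tensors_of)
    interpret hessian_pair A "inverse_of A H" H ..
    show "HN_structure A (inverse_of A H) N"
      using KVN KVN_iff_HN by simp
  qed
qed

end
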